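(* Let $R$ be a Noetherian commutative ring with countable spectrum. Then all flat $R$-modules are quite flat.
   Context: "Countable" means at most countable; the spectrum of $R$ is the set of its prime ideals. An $R$-module $C$ over a commutative ring $R$ is almost cotorsion if $\operatorname{Ext}^1_R(S^{-1}R,C)=0$ for all (at most) countable multiplicative subsets $S\subset R$. An $R$-module $F$ is quite flat if $\operatorname{Ext}^1_R(F,C)=0$ for all almost cotorsion $R$-modules $C$. *)

theory Defs
  imports "HOL-Algebra.Module" "HOL-Algebra.Ring_Divisibility" "HOL-Library.Countable_Set" "HOL-Library.FuncSet"
begin

text \<open>
  Modules are the carrier-based modules of HOL-Algebra. The record type of modules extends that of
  rings; the fields for ring multiplication and unit carry no meaning for a module and are left
  \<^const>\<open>undefined\<close> below, except for localizations, which really are rings.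
\<close>

text \<open>Homomorphisms are extensional, so that equality of functions is equality of maps.\<close>

definition hom_module ::
  "('r, 'm) ring_scheme \<Rightarrow> ('r, 'a) module \<Rightarrow> ('r, 'b) module \<Rightarrow> ('r, 'a \<Rightarrow> 'b) module"
  where "hom_module R M N =
    \<lparr>carrier = {f \<in> carrier M \<rightarrow>\<^sub>E carrier N.
        (\<forall>x \<in> carrier M. \<forall>y \<in> carrier M. f (x \<oplus>\<^bsub>M\<^esub> y) = f x \<oplus>\<^bsub>N\<^esub> f y) \<and>
        (\<forall>r \<in> carrier R. \<forall>x \<in> carrier M. f (r \<odot>\<^bsub>M\<^esub> x) = r \<odot>\<^bsub>N\<^esub> f x)},
     mult = undefined, one = undefined,
     zero = (\<lambda>x \<in> carrier M. \<zero>\<^bsub>N\<^esub>),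
     add = (\<lambda>f g. \<lambda>x \<in> carrier M. f x \<oplus>\<^bsub>N\<^esub> g x),
     smult = (\<lambda>r f. \<lambda>x \<in> carrier M. r \<odot>\<^bsub>N\<^esub> f x)\<rparr>"

definition quotient_module :: "('r, 'a) module \<Rightarrow> 'a set \<Rightarrow> ('r, 'a set) module"
  where "quotient_module M H =
    \<lparr>carrier = a_rcosets\<^bsub>M\<^esub> H, mult = undefined, one = undefined,
     zero = H, add = (\<lambda>X Y. X <+>\<^bsub>M\<^esub> Y),
     smult = (\<lambda>r X. \<Union>x \<in> X. H +>\<^bsub>M\<^esub> (r \<odot>\<^bsub>M\<^esub> x))\<rparr>"

definition zero_module :: "('r, 'a) module \<Rightarrow> bool"
  where "zero_module M \<longleftrightarrow> carrier M = {\<zero>\<^bsub>M\<^esub>}"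


text \<open>The free module on a set \<open>X\<close>, as the finitely supported functions from \<open>X\<close> to \<open>R\<close>,
  extended by zero outside of \<open>X\<close>.\<close>

definition fun_support :: "('r, 'm) ring_scheme \<Rightarrow> ('x \<Rightarrow> 'r) \<Rightarrow> 'x set"
  where "fun_support R f = {x. f x \<noteq> \<zero>\<^bsub>R\<^esub>}"

definition free_module :: "('r, 'm) ring_scheme \<Rightarrow> 'x set \<Rightarrow> ('r, 'x \<Rightarrow> 'r) module"
  where "free_module R X =
    \<lparr>carrier = {f. range f \<subseteq> carrier R \<and> finite (fun_support R f) \<and> fun_support R f \<subseteq> X},
     mult = undefined, one = undefined,
     zero = (\<lambda>x. \<zero>\<^bsub>R\<^esub>),
     add = (\<lambda>f g x. f x \<oplus>\<^bsub>R\<^esub> g x),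
     smult = (\<lambda>r f x. r \<otimes>\<^bsub>R\<^esub> f x)\<rparr>"

definition free_gen :: "('r, 'm) ring_scheme \<Rightarrow> 'x \<Rightarrow> ('x \<Rightarrow> 'r)"
  where "free_gen R x = (\<lambda>y. if y = x then \<one>\<^bsub>R\<^esub> else \<zero>\<^bsub>R\<^esub>)"

text \<open>The linear extension of a map \<open>h\<close> from \<open>X\<close> to \<open>M\<close> to the free module on \<open>X\<close>.\<close>

definition linear_ext ::
  "('r, 'm) ring_scheme \<Rightarrow> ('r, 'a) module \<Rightarrow> ('x \<Rightarrow> 'a) \<Rightarrow> ('x \<Rightarrow> 'r) \<Rightarrow> 'a"
  where "linear_ext R M h f = (\<Oplus>\<^bsub>M\<^esub> x \<in> fun_support R f. f x \<odot>\<^bsub>M\<^esub> h x)"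


subsection \<open>Tensor products and flatness\<close>

definition tensor_gen_relations ::
  "('r, 'm) ring_scheme \<Rightarrow> ('r, 'a) module \<Rightarrow> ('r, 'b) module \<Rightarrow> ('a \<times> 'b \<Rightarrow> 'r) set"
  where "tensor_gen_relations R M N =
    (let P = free_module R (carrier M \<times> carrier N); e = (\<lambda>m n. free_gen R (m, n)) in
      {e (m \<oplus>\<^bsub>M\<^esub> m') n \<ominus>\<^bsub>P\<^esub> (e m n \<oplus>\<^bsub>P\<^esub> e m' n) |m m' n.
          m \<in> carrier M \<and> m' \<in> carrier M \<and> n \<in> carrier N} \<union>
      {e m (n \<oplus>\<^bsub>N\<^esub> n') \<ominus>\<^bsub>P\<^esub> (e m n \<oplus>\<^bsub>P\<^esub> e m n') |m n n'.
          m \<in> carrier M \<and> n \<in> carrier N \<and> n' \<in> carrier N} \<union>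
      {e (r \<odot>\<^bsub>M\<^esub> m) n \<ominus>\<^bsub>P\<^esub> r \<odot>\<^bsub>P\<^esub> e m n |r m n.
          r \<in> carrier R \<and> m \<in> carrier M \<and> n \<in> carrier N} \<union>
      {e m (r \<odot>\<^bsub>N\<^esub> n) \<ominus>\<^bsub>P\<^esub> r \<odot>\<^bsub>P\<^esub> e m n |r m n.
          r \<in> carrier R \<and> m \<in> carrier M \<and> n \<in> carrier N})"

definition tensor_relations ::
  "('r, 'm) ring_scheme \<Rightarrow> ('r, 'a) module \<Rightarrow> ('r, 'b) module \<Rightarrow> ('a \<times> 'b \<Rightarrow> 'r) set"
  where "tensor_relations R M N =
    (\<lambda>H. submodule H R (free_module R (carrier M \<times> carrier N))) hull tensor_gen_relations R M N"

definition tensor ::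
  "('r, 'm) ring_scheme \<Rightarrow> ('r, 'a) module \<Rightarrow> ('r, 'b) module \<Rightarrow> ('r, ('a \<times> 'b \<Rightarrow> 'r) set) module"
  where "tensor R M N =
    quotient_module (free_module R (carrier M \<times> carrier N)) (tensor_relations R M N)"

text \<open>The map from the tensor product of \<open>M\<close> and \<open>F\<close> to that of \<open>N\<close> and \<open>F\<close> induced by a map
  \<open>f\<close> from \<open>M\<close> to \<open>N\<close> (only \<open>N\<close> and \<open>F\<close> are needed in order to write it down).\<close>

definition tensor_map ::
  "('r, 'm) ring_scheme \<Rightarrow> ('r, 'b) module \<Rightarrow> ('r, 'f) module \<Rightarrow> ('a \<Rightarrow> 'b) \<Rightarrow>
    ('a \<times> 'f \<Rightarrow> 'r) set \<Rightarrow> ('b \<times> 'f \<Rightarrow> 'r) set"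
  where "tensor_map R N F f X =
    (let P = free_module R (carrier N \<times> carrier F) in
      \<Union>z \<in> X. tensor_relations R N F +>\<^bsub>P\<^esub> linear_ext R P (\<lambda>(m, x). free_gen R (f m, x)) z)"

text \<open>HOL cannot quantify over types inside a formula, so the modules \<open>M\<close> and \<open>N\<close> against which
  flatness is tested have to live on a fixed type. On the type \<^typ>\<open>(nat \<Rightarrow> 'r) set\<close> one finds every
  quotient of a free module on a set of natural numbers, and hence, up to isomorphism, every
  countably generated module. This is no restriction: if \<open>f\<close> from \<open>M\<close> to \<open>N\<close> is injective and an
  element of the tensor product of \<open>M\<close> and \<open>F\<close> is sent to zero, then this is already seen on
  finitely generated submodules of \<open>M\<close> and \<open>N\<close>.\<close>

definition flat_module :: "('r, 'm) ring_scheme \<Rightarrow> ('r, 'f) module \<Rightarrow> bool"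
  where "flat_module R F \<longleftrightarrow> module R F \<and>
    (\<forall>(M :: ('r, (nat \<Rightarrow> 'r) set) module) (N :: ('r, (nat \<Rightarrow> 'r) set) module) f.
      module R M \<and> module R N \<and> f \<in> carrier (hom_module R M N) \<and> inj_on f (carrier M) \<longrightarrow>
      inj_on (tensor_map R N F f) (carrier (tensor R M F)))"


subsection \<open>The module Ext^1\<close>

text \<open>The first three terms of the canonical free resolution of \<open>F\<close>: the free module on the
  underlying set of \<open>F\<close>, and then at each step the free module on the underlying set of the kernel
  of the preceding map. All maps are the tautological ones.\<close>

definition res0 :: "('r, 'm) ring_scheme \<Rightarrow> ('r, 'f) module \<Rightarrow> ('r, 'f \<Rightarrow> 'r) module"
  where "res0 R F = free_module R (carrier F)"

definition aug :: "('r, 'm) ring_scheme \<Rightarrow> ('r, 'f) module \<Rightarrow> ('f \<Rightarrow> 'r) \<Rightarrow> 'f"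
  where "aug R F = linear_ext R F (\<lambda>x. x)"

definition res1 ::
  "('r, 'm) ring_scheme \<Rightarrow> ('r, 'f) module \<Rightarrow> ('r, ('f \<Rightarrow> 'r) \<Rightarrow> 'r) module"
  where "res1 R F = free_module R (a_kernel (res0 R F) F (aug R F))"

definition diff1 ::
  "('r, 'm) ring_scheme \<Rightarrow> ('r, 'f) module \<Rightarrow> (('f \<Rightarrow> 'r) \<Rightarrow> 'r) \<Rightarrow> ('f \<Rightarrow> 'r)"
  where "diff1 R F = linear_ext R (res0 R F) (\<lambda>x. x)"

definition res2 ::
  "('r, 'm) ring_scheme \<Rightarrow> ('r, 'f) module \<Rightarrow> ('r, (('f \<Rightarrow> 'r) \<Rightarrow> 'r) \<Rightarrow> 'r) module"
  where "res2 R F = free_module R (a_kernel (res1 R F) (res0 R F) (diff1 R F))"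

definition diff2 ::
  "('r, 'm) ring_scheme \<Rightarrow> ('r, 'f) module \<Rightarrow>
    ((('f \<Rightarrow> 'r) \<Rightarrow> 'r) \<Rightarrow> 'r) \<Rightarrow> (('f \<Rightarrow> 'r) \<Rightarrow> 'r)"
  where "diff2 R F = linear_ext R (res1 R F) (\<lambda>x. x)"

text \<open>\<open>Ext1 R F C\<close> is the first cohomology of \<open>Hom(-, C)\<close> applied to this resolution.\<close>

definition cocycles1 ::
  "('r, 'm) ring_scheme \<Rightarrow> ('r, 'f) module \<Rightarrow> ('r, 'c) module \<Rightarrow> ((('f \<Rightarrow> 'r) \<Rightarrow> 'r) \<Rightarrow> 'c) set"
  where "cocycles1 R F C =
    a_kernel (hom_module R (res1 R F) C) (hom_module R (res2 R F) C)
      (\<lambda>g. compose (carrier (res2 R F)) g (diff2 R F))"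

definition coboundaries1 ::
  "('r, 'm) ring_scheme \<Rightarrow> ('r, 'f) module \<Rightarrow> ('r, 'c) module \<Rightarrow> ((('f \<Rightarrow> 'r) \<Rightarrow> 'r) \<Rightarrow> 'c) set"
  where "coboundaries1 R F C =
    (\<lambda>h. compose (carrier (res1 R F)) h (diff1 R F)) ` carrier (hom_module R (res0 R F) C)"

definition Ext1 ::
  "('r, 'm) ring_scheme \<Rightarrow> ('r, 'f) module \<Rightarrow> ('r, 'c) module \<Rightarrow>
    ('r, ((('f \<Rightarrow> 'r) \<Rightarrow> 'r) \<Rightarrow> 'c) set) module"
  where "Ext1 R F C =
    quotient_module ((hom_module R (res1 R F) C)\<lparr>carrier := cocycles1 R F C\<rparr>)
      (coboundaries1 R F C)"


subsection \<open>Localization\<close>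

definition frac_rel :: "('r, 'm) ring_scheme \<Rightarrow> 'r set \<Rightarrow> (('r \<times> 'r) \<times> ('r \<times> 'r)) set"
  where "frac_rel R S =
    {((a, s), (b, t)). a \<in> carrier R \<and> b \<in> carrier R \<and> s \<in> S \<and> t \<in> S \<and>
      (\<exists>u \<in> S. u \<otimes>\<^bsub>R\<^esub> (a \<otimes>\<^bsub>R\<^esub> t \<ominus>\<^bsub>R\<^esub> b \<otimes>\<^bsub>R\<^esub> s) = \<zero>\<^bsub>R\<^esub>)}"

definition fraction :: "('r, 'm) ring_scheme \<Rightarrow> 'r set \<Rightarrow> 'r \<Rightarrow> 'r \<Rightarrow> ('r \<times> 'r) set"
  where "fraction R S a s = frac_rel R S `` {(a, s)}"

text \<open>No condition \<open>0 \<notin> S\<close> is imposed; if \<open>0 \<in> S\<close>, the localization is zero.\<close>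

definition localization :: "('r, 'm) ring_scheme \<Rightarrow> 'r set \<Rightarrow> ('r, ('r \<times> 'r) set) module"
  where "localization R S =
    \<lparr>carrier = (carrier R \<times> S) // frac_rel R S,
     mult = (\<lambda>X Y. \<Union>(a, s) \<in> X. \<Union>(b, t) \<in> Y. fraction R S (a \<otimes>\<^bsub>R\<^esub> b) (s \<otimes>\<^bsub>R\<^esub> t)),
     one = fraction R S \<one>\<^bsub>R\<^esub> \<one>\<^bsub>R\<^esub>,
     zero = fraction R S \<zero>\<^bsub>R\<^esub> \<one>\<^bsub>R\<^esub>,
     add = (\<lambda>X Y. \<Union>(a, s) \<in> X. \<Union>(b, t) \<in> Y.
        fraction R S (a \<otimes>\<^bsub>R\<^esub> t \<oplus>\<^bsub>R\<^esub> b \<otimes>\<^bsub>R\<^esub> s) (s \<otimes>\<^bsub>R\<^esub> t)),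
     smult = (\<lambda>r X. \<Union>(a, s) \<in> X. fraction R S (r \<otimes>\<^bsub>R\<^esub> a) s)\<rparr>"


subsection \<open>Almost cotorsion and quite flat modules\<close>

definition almost_cotorsion :: "('r, 'm) ring_scheme \<Rightarrow> ('r, 'c) module \<Rightarrow> bool"
  where "almost_cotorsion R C \<longleftrightarrow> module R C \<and>
    (\<forall>S. submonoid S R \<and> countable S \<longrightarrow> zero_module (Ext1 R (localization R S) C))"

text \<open>The type argument is the type of the elements of the test modules \<open>C\<close>. A theorem concluding
  \<^prop>\<open>quite_flat TYPE('c) R F\<close> for a type variable \<open>'c\<close> is a statement about all modules \<open>C\<close>.\<close>

definition quite_flat :: "'c itself \<Rightarrow> ('r, 'm) ring_scheme \<Rightarrow> ('r, 'f) module \<Rightarrow> bool"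
  where "quite_flat _ R F \<longleftrightarrow> module R F \<and>
    (\<forall>C :: ('r, 'c) module. almost_cotorsion R C \<longrightarrow> zero_module (Ext1 R F C))"

definition Spec :: "('r, 'm) ring_scheme \<Rightarrow> 'r set set"
  where "Spec R = {P. primeideal P R}"

end

theory Submission
  imports Defs
begin

text \<open>
  Write \<open>F = P / G\<close> with \<open>P\<close> free. Then \<open>Ext\<^sup>1(F, C) = 0\<close> says that every homomorphism from \<open>G\<close> to
  \<open>C\<close> extends to \<open>P\<close>. Flatness of \<open>F\<close> says that every element of \<open>G\<close> is fixed by some linear map
  from \<open>P\<close> to \<open>G\<close>. This criterion of Chase and Villamayor is inherited by the syzygies of \<open>F\<close>, and it
  shows that a map from \<open>G\<close> to a module killed by an ideal \<open>I\<close> vanishes on \<open>G \<inter> IP\<close>.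

  The proof is a Noetherian induction on the annihilator of \<open>C\<close>. If \<open>ab\<close> kills \<open>C\<close> and neither \<open>a\<close> nor
  \<open>b\<close> does, then \<open>C\<close> is an extension of \<open>C / aC\<close> by \<open>aC\<close>, and both have larger annihilators. So let the
  annihilator be a prime ideal \<open>p\<close>. As the spectrum is countable, one picks an element outside of \<open>p\<close>
  from each prime ideal strictly above \<open>p\<close>; they generate a countable multiplicative set \<open>S\<close> that misses
  \<open>p\<close>, and \<open>K = S\<^sup>-\<^sup>1(R / p)\<close> is a field. Since \<open>F\<close> is flat and \<open>p\<close> kills \<open>C\<close>, the groups \<open>Ext\<^sup>i(F, C)\<close> may be
  computed over \<open>R / p\<close>, with \<open>F / pF\<close> in place of \<open>F\<close>. For \<open>s \<in> S\<close>, multiplication by \<open>s\<close> on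
  \<open>Ext\<^sup>1(F, C)\<close> is surjective: it is the composite of the maps to \<open>Ext\<^sup>1(F, sC)\<close> and back to \<open>Ext\<^sup>1(F, C)\<close>,
  whose cokernels embed into \<open>Ext\<^sup>2(F, {c. sc = 0})\<close> and \<open>Ext\<^sup>1(F, C / sC)\<close>, which vanish by induction.
  Hence a class \<open>\<xi> = \<xi>\<^sub>0\<close> can be divided successively, \<open>\<xi>\<^sub>n = s\<^sub>n \<xi>\<^sub>n\<^sub>+\<^sub>1\<close>, along a sequence that takes each
  value in \<open>S\<close> infinitely often. The extensions \<open>\<xi>\<^sub>n\<close> form a direct system whose colimit is an extension
  of \<open>F \<otimes> K\<close> by \<open>C\<close> over \<open>R / p\<close>, and \<open>\<xi>\<close> is its pullback to \<open>F / pF\<close>. But \<open>F \<otimes> K\<close> is a direct sum of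
  copies of \<open>K\<close>, and \<open>Ext\<^sup>1(K, C)\<close>, formed over \<open>R / p\<close>, equals \<open>Ext\<^sup>1(S\<^sup>-\<^sup>1R, C)\<close> over \<open>R\<close>, which vanishes if
  \<open>C\<close> is almost cotorsion. So the colimit splits, and \<open>\<xi> = 0\<close> (\<open>tower_extends\<close>,
  \<open>prime_tower_extends_telescopic\<close>, \<open>homs_extend_to_telescopic\<close>).

  Two points need care. First, the induction passes to quotients of \<open>C\<close>, so almost cotorsion modules
  have to be closed under quotients. Here countability of the multiplicative sets enters: with
  \<open>S\<^sup>-\<^sup>1R\<close> written as a sequential colimit of copies of \<open>R\<close>, the vanishing of \<open>Ext\<^sup>1(S\<^sup>-\<^sup>1R, C)\<close> becomes the
  solvability of all systems \<open>d\<^sub>n = c\<^sub>n + s\<^sub>n d\<^sub>n\<^sub>+\<^sub>1\<close> in \<open>C\<close>, which clearly descends to quotients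
  (\<open>telescopic\<close>, \<open>almost_cotorsion_telescopic\<close>, \<open>telescopic_image\<close>).

  Second, \<open>{c. sc = 0}\<close> need not be almost cotorsion, so the vanishing of \<open>Ext\<^sup>2(F, -)\<close> is needed on all
  modules; equivalently, \<open>Ext\<^sup>1(F', -) = 0\<close> for every first syzygy \<open>F'\<close> of a flat module
  (\<open>homs_extend_from_syzygy\<close>). The same induction proves it, with \<open>Ext\<^sup>1\<close> of the next syzygy in the role
  of \<open>Ext\<^sup>2\<close>; only the last step has to change. There \<open>F'\<close> is a submodule of a free module \<open>P\<close>, and
  \<open>F' \<otimes> K\<close> is a direct summand of \<open>P \<otimes> K\<close>. The canonical map from \<open>F'\<close> to \<open>F' \<otimes> K\<close> factors through
  \<open>P\<close>, from which every map to \<open>F' \<otimes> K\<close> lifts to the colimit extension; so \<open>\<xi>\<close> splits again, whatever \<open>C\<close> is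
  (\<open>prime_tower_extends_syzygy\<close>).
\<close>

section \<open>Linear maps and submodules\<close>

text \<open>Homomorphisms without the requirement of extensionality in \<^const>\<open>hom_module\<close>, so that they can
  be given by plain \<open>\<lambda>\<close>-terms and composed freely.\<close>

definition linear_map ::
  "('r, 'm) ring_scheme \<Rightarrow> ('r, 'a) module \<Rightarrow> ('r, 'b) module \<Rightarrow> ('a \<Rightarrow> 'b) \<Rightarrow> bool"
  where "linear_map R M N f \<longleftrightarrow>
    (\<forall>x \<in> carrier M. f x \<in> carrier N) \<and>
    (\<forall>x \<in> carrier M. \<forall>y \<in> carrier M. f (x \<oplus>\<^bsub>M\<^esub> y) = f x \<oplus>\<^bsub>N\<^esub> f y) \<and>
    (\<forall>r \<in> carrier R. \<forall>x \<in> carrier M. f (r \<odot>\<^bsub>M\<^esub> x) = r \<odot>\<^bsub>N\<^esub> f x)"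

lemma linear_mapI:
  assumes "\<And>x. x \<in> carrier M \<Longrightarrow> f x \<in> carrier N"
    and "\<And>x y. x \<in> carrier M \<Longrightarrow> y \<in> carrier M \<Longrightarrow> f (x \<oplus>\<^bsub>M\<^esub> y) = f x \<oplus>\<^bsub>N\<^esub> f y"
    and "\<And>r x. r \<in> carrier R \<Longrightarrow> x \<in> carrier M \<Longrightarrow> f (r \<odot>\<^bsub>M\<^esub> x) = r \<odot>\<^bsub>N\<^esub> f x"
  shows "linear_map R M N f"
  using assms by (simp add: linear_map_def)

lemma linear_map_closed: "linear_map R M N f \<Longrightarrow> x \<in> carrier M \<Longrightarrow> f x \<in> carrier N"
  by (simp add: linear_map_def)

lemma linear_map_add:
  "linear_map R M N f \<Longrightarrow> x \<in> carrier M \<Longrightarrow> y \<in> carrier M \<Longrightarrow> f (x \<oplus>\<^bsub>M\<^esub> y) = f x \<oplus>\<^bsub>N\<^esub> f y"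
  by (simp add: linear_map_def)

lemma linear_map_smult:
  "linear_map R M N f \<Longrightarrow> r \<in> carrier R \<Longrightarrow> x \<in> carrier M \<Longrightarrow> f (r \<odot>\<^bsub>M\<^esub> x) = r \<odot>\<^bsub>N\<^esub> f x"
  by (simp add: linear_map_def)

lemma linear_map_compose:
  "linear_map R M N f \<Longrightarrow> linear_map R N L g \<Longrightarrow> linear_map R M L (\<lambda>x. g (f x))"
  by (simp add: linear_map_def)

lemma linear_map_id: "linear_map R M M (\<lambda>x. x)"
  by (simp add: linear_map_def)

lemma linear_map_cong:
  assumes "module R M" "linear_map R M N f" "\<And>x. x \<in> carrier M \<Longrightarrow> g x = f x"
  shows "linear_map R M N g"
proof -
  interpret module R M by fact
  show ?thesis using assms(2,3) by (auto simp: linear_map_def)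
qed

lemma linear_map_zero:
  assumes "module R M" "module R N" "linear_map R M N f"
  shows "f \<zero>\<^bsub>M\<^esub> = \<zero>\<^bsub>N\<^esub>"
proof -
  interpret M: module R M by fact
  interpret N: module R N by fact
  have "f (\<zero>\<^bsub>R\<^esub> \<odot>\<^bsub>M\<^esub> \<zero>\<^bsub>M\<^esub>) = \<zero>\<^bsub>R\<^esub> \<odot>\<^bsub>N\<^esub> f \<zero>\<^bsub>M\<^esub>"
    using assms by (intro linear_map_smult) auto
  then show ?thesis using assms by (simp add: linear_map_closed)
qed

lemma (in module) smult_minus_one: "x \<in> carrier M \<Longrightarrow> (\<ominus> \<one>) \<odot>\<^bsub>M\<^esub> x = \<ominus>\<^bsub>M\<^esub> x"
  by (simp add: smult_l_minus)

lemma linear_map_uminus: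
  assumes "module R M" "module R N" "linear_map R M N f" "x \<in> carrier M"
  shows "f (\<ominus>\<^bsub>M\<^esub> x) = \<ominus>\<^bsub>N\<^esub> f x"
proof -
  interpret M: module R M by fact
  interpret N: module R N by fact
  have "f ((\<ominus>\<^bsub>R\<^esub> \<one>\<^bsub>R\<^esub>) \<odot>\<^bsub>M\<^esub> x) = (\<ominus>\<^bsub>R\<^esub> \<one>\<^bsub>R\<^esub>) \<odot>\<^bsub>N\<^esub> f x"
    using assms by (intro linear_map_smult) auto
  then show ?thesis using assms by (simp add: linear_map_closed M.smult_minus_one N.smult_minus_one)
qed

lemma linear_map_minus:
  assumes "module R M" "module R N" "linear_map R M N f" "x \<in> carrier M" "y \<in> carrier M"
  shows "f (x \<ominus>\<^bsub>M\<^esub> y) = f x \<ominus>\<^bsub>N\<^esub> f y"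
proof -
  interpret M: module R M by fact
  interpret N: module R N by fact
  show ?thesis unfolding a_minus_def
    using assms by (simp add: linear_map_add linear_map_uminus)
qed

lemma (in module) smult_r_diff: 
  "a \<in> carrier R \<Longrightarrow> x \<in> carrier M \<Longrightarrow> y \<in> carrier M \<Longrightarrow>
    a \<odot>\<^bsub>M\<^esub> (x \<ominus>\<^bsub>M\<^esub> y) = a \<odot>\<^bsub>M\<^esub> x \<ominus>\<^bsub>M\<^esub> a \<odot>\<^bsub>M\<^esub> y"
  by (simp add: a_minus_def smult_r_distr smult_r_minus)

lemma (in module) smult_commute:
  "a \<in> carrier R \<Longrightarrow> b \<in> carrier R \<Longrightarrow> x \<in> carrier M \<Longrightarrow>
    a \<odot>\<^bsub>M\<^esub> (b \<odot>\<^bsub>M\<^esub> x) = b \<odot>\<^bsub>M\<^esub> (a \<odot>\<^bsub>M\<^esub> x)"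
  by (metis R.m_comm smult_assoc1)

lemma linear_map_addf:
  assumes "module R N" "linear_map R M N f" "linear_map R M N g"
  shows "linear_map R M N (\<lambda>x. f x \<oplus>\<^bsub>N\<^esub> g x)"
proof -
  interpret N: module R N by fact
  show ?thesis using assms
    by (intro linear_mapI) (simp_all add: linear_map_closed linear_map_add linear_map_smult N.smult_r_distr N.add.m_ac)
qed

lemma linear_map_smultf:
  assumes "module R N" "linear_map R M N f" "r \<in> carrier R"
  shows "linear_map R M N (\<lambda>x. r \<odot>\<^bsub>N\<^esub> f x)"
proof -
  interpret N: module R N by fact
  show ?thesis using assms
    by (intro linear_mapI) (simp_all add: linear_map_closed linear_map_add linear_map_smult N.smult_r_distr N.smult_commute)
qed

lemma linear_map_minusf:
  assumes "module R N" "linear_map R M N f" "linear_map R M N g"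
  shows "linear_map R M N (\<lambda>x. f x \<ominus>\<^bsub>N\<^esub> g x)"
proof -
  interpret N: module R N by fact
  show ?thesis using assms
    by (intro linear_mapI) (simp_all add: linear_map_closed linear_map_add linear_map_smult N.smult_r_diff
         a_minus_def N.minus_add N.add.m_ac N.smult_r_distr N.smult_r_minus)
qed

lemma linear_map_zerof:
  assumes "module R N"
  shows "linear_map R M N (\<lambda>x. \<zero>\<^bsub>N\<^esub>)"
proof -
  interpret N: module R N by fact
  show ?thesis by (intro linear_mapI) simp_all
qed

lemma submodule_carrier_module:
  assumes "module R M" "submodule H R M"
  shows "module R (M\<lparr>carrier := H\<rparr>)"
  using assms submodule.submodule_is_module by blast

lemma submodule_simps:
  assumes "module R M" "submodule H R M"
  shows "x \<in> H \<Longrightarrow> x \<in> carrier M"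
    and "\<zero>\<^bsub>M\<^esub> \<in> H"
    and "x \<in> H \<Longrightarrow> y \<in> H \<Longrightarrow> x \<oplus>\<^bsub>M\<^esub> y \<in> H"
    and "r \<in> carrier R \<Longrightarrow> x \<in> H \<Longrightarrow> r \<odot>\<^bsub>M\<^esub> x \<in> H"
    and "x \<in> H \<Longrightarrow> \<ominus>\<^bsub>M\<^esub> x \<in> H"
    and "x \<in> H \<Longrightarrow> y \<in> H \<Longrightarrow> x \<ominus>\<^bsub>M\<^esub> y \<in> H"
proof -
  interpret M: module R M by fact
  interpret H: submodule H R M by fact
  show "x \<in> H \<Longrightarrow> x \<in> carrier M" using M.submoduleE(1)[OF assms(2)] by auto
  show "\<zero>\<^bsub>M\<^esub> \<in> H" using H.one_closed by simp
  show *: "x \<in> H \<Longrightarrow> y \<in> H \<Longrightarrow> x \<oplus>\<^bsub>M\<^esub> y \<in> H" for x y using M.submoduleE(5)[OF assms(2)] by auto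
  show "r \<in> carrier R \<Longrightarrow> x \<in> H \<Longrightarrow> r \<odot>\<^bsub>M\<^esub> x \<in> H" by simp
  show **: "x \<in> H \<Longrightarrow> \<ominus>\<^bsub>M\<^esub> x \<in> H" for x using M.submoduleE(3)[OF assms(2)] by auto
  show "x \<in> H \<Longrightarrow> y \<in> H \<Longrightarrow> x \<ominus>\<^bsub>M\<^esub> y \<in> H" using * ** by (simp add: a_minus_def)
qed

lemma submodule_of_closedI:
  assumes "module R M" "H \<subseteq> carrier M" "\<zero>\<^bsub>M\<^esub> \<in> H"
    "\<And>x y. x \<in> H \<Longrightarrow> y \<in> H \<Longrightarrow> x \<oplus>\<^bsub>M\<^esub> y \<in> H"
    "\<And>r x. r \<in> carrier R \<Longrightarrow> x \<in> H \<Longrightarrow> r \<odot>\<^bsub>M\<^esub> x \<in> H"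
  shows "submodule H R M"
proof -
  interpret M: module R M by fact
  show ?thesis
  proof (rule M.submoduleI)
    fix a assume a: "a \<in> H"
    have "(\<ominus>\<^bsub>R\<^esub> \<one>\<^bsub>R\<^esub>) \<odot>\<^bsub>M\<^esub> a \<in> H" using assms(5) a by simp
    then show "\<ominus>\<^bsub>M\<^esub> a \<in> H" using assms(2) a by (auto simp: M.smult_minus_one)
  qed (use assms in auto)
qed

lemma linear_map_kernel:
  assumes "module R M" "module R N" "linear_map R M N f"
  shows "submodule {x \<in> carrier M. f x = \<zero>\<^bsub>N\<^esub>} R M"
proof -
  interpret M: module R M by fact
  interpret N: module R N by fact
  show ?thesis using assms
    by (intro submodule_of_closedI) (auto simp: linear_map_zero linear_map_add linear_map_smult)
qed

lemma linear_map_vimage: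
  assumes "module R M" "module R N" "linear_map R M N f" "submodule H R N"
  shows "submodule {x \<in> carrier M. f x \<in> H} R M"
proof -
  interpret M: module R M by fact
  interpret N: module R N by fact
  show ?thesis using assms
    by (intro submodule_of_closedI) (auto simp: linear_map_zero linear_map_add linear_map_smult submodule_simps)
qed

lemma linear_map_image:
  assumes "module R M" "module R N" "linear_map R M N f"
  shows "submodule (f ` carrier M) R N"
proof -
  interpret M: module R M by fact
  interpret N: module R N by fact
  show ?thesis
  proof (rule submodule_of_closedI)
    show "module R N" by fact
    show "f ` carrier M \<subseteq> carrier N" using assms by (auto simp: linear_map_closed)
    show "\<zero>\<^bsub>N\<^esub> \<in> f ` carrier M" using linear_map_zero[OF assms] M.zero_closed by (metis imageI)
  next
    fix x y assume "x \<in> f ` carrier M" "y \<in> f ` carrier M"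
    then obtain a b where "x = f a" "y = f b" "a \<in> carrier M" "b \<in> carrier M" by auto
    then have "x \<oplus>\<^bsub>N\<^esub> y = f (a \<oplus>\<^bsub>M\<^esub> b)" "a \<oplus>\<^bsub>M\<^esub> b \<in> carrier M" using assms by (auto simp: linear_map_add)
    then show "x \<oplus>\<^bsub>N\<^esub> y \<in> f ` carrier M" by auto
  next
    fix r x assume r: "r \<in> carrier R" and "x \<in> f ` carrier M"
    then obtain a where "x = f a" "a \<in> carrier M" by auto
    then have "r \<odot>\<^bsub>N\<^esub> x = f (r \<odot>\<^bsub>M\<^esub> a)" "r \<odot>\<^bsub>M\<^esub> a \<in> carrier M" using assms r by (auto simp: linear_map_smult)
    then show "r \<odot>\<^bsub>N\<^esub> x \<in> f ` carrier M" by auto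
  qed
qed

lemma linear_map_restrict_domain:
  "linear_map R M N f \<Longrightarrow> H \<subseteq> carrier M \<Longrightarrow> linear_map R (M\<lparr>carrier := H\<rparr>) N f"
  by (simp add: linear_map_def subset_iff)

lemma linear_map_restrict_codomain:
  "linear_map R M N f \<Longrightarrow> (\<And>x. x \<in> carrier M \<Longrightarrow> f x \<in> H) \<Longrightarrow> linear_map R M (N\<lparr>carrier := H\<rparr>) f"
  by (auto simp: linear_map_def)

lemma linear_map_into_submodule:
  "module R N \<Longrightarrow> submodule H R N \<Longrightarrow> linear_map R M (N\<lparr>carrier := H\<rparr>) f \<Longrightarrow> linear_map R M N f"
  by (auto simp: linear_map_def submodule_simps)

section \<open>Free modules\<close>

lemma mem_free_module:
  "f \<in> carrier (free_module R X) \<longleftrightarrow>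
    (\<forall>x. f x \<in> carrier R) \<and> finite {x. f x \<noteq> \<zero>\<^bsub>R\<^esub>} \<and> (\<forall>x. x \<notin> X \<longrightarrow> f x = \<zero>\<^bsub>R\<^esub>)"
  by (auto simp: free_module_def fun_support_def)

lemma free_module_simps:
  "\<zero>\<^bsub>free_module R X\<^esub> = (\<lambda>x. \<zero>\<^bsub>R\<^esub>)"
  "f \<oplus>\<^bsub>free_module R X\<^esub> g = (\<lambda>x. f x \<oplus>\<^bsub>R\<^esub> g x)"
  "r \<odot>\<^bsub>free_module R X\<^esub> f = (\<lambda>x. r \<otimes>\<^bsub>R\<^esub> f x)"
  by (simp_all add: free_module_def)

context cring
begin

lemma free_module_abelian_group: "abelian_group (free_module R X)"
proof (rule abelian_groupI)
  fix x y assume xy: "x \<in> carrier (free_module R X)" "y \<in> carrier (free_module R X)"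
  have "{t. x t \<oplus> y t \<noteq> \<zero>} \<subseteq> {t. x t \<noteq> \<zero>} \<union> {t. y t \<noteq> \<zero>}" by auto
  with xy show "x \<oplus>\<^bsub>free_module R X\<^esub> y \<in> carrier (free_module R X)"
    unfolding mem_free_module free_module_simps by (auto intro: finite_subset)
next
  fix x assume x: "x \<in> carrier (free_module R X)"
  have "{t. \<ominus> x t \<noteq> \<zero>} \<subseteq> {t. x t \<noteq> \<zero>}" by auto
  with x have "(\<lambda>t. \<ominus> x t) \<in> carrier (free_module R X)"
    unfolding mem_free_module free_module_simps by (auto intro: finite_subset)
  moreover have "(\<lambda>t. \<ominus> x t) \<oplus>\<^bsub>free_module R X\<^esub> x = \<zero>\<^bsub>free_module R X\<^esub>"
    using x by (simp add: mem_free_module free_module_simps l_neg)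
  ultimately show "\<exists>y\<in>carrier (free_module R X). y \<oplus>\<^bsub>free_module R X\<^esub> x = \<zero>\<^bsub>free_module R X\<^esub>"
    by blast
qed (simp_all add: mem_free_module free_module_simps a_assoc a_comm a_lcomm)

lemma free_module_is_module: "module R (free_module R X)"
proof (rule moduleI)
  show "cring R" by (rule is_cring)
  show "abelian_group (free_module R X)" by (rule free_module_abelian_group)
next
  fix a x assume x: "a \<in> carrier R" "x \<in> carrier (free_module R X)"
  have "{t. a \<otimes> x t \<noteq> \<zero>} \<subseteq> {t. x t \<noteq> \<zero>}" using x by auto
  with x show "a \<odot>\<^bsub>free_module R X\<^esub> x \<in> carrier (free_module R X)"
    unfolding mem_free_module free_module_simps by (auto intro: finite_subset)
qed (simp_all add: mem_free_module free_module_simps l_distr r_distr m_assoc)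

lemma free_module_uminus:
  assumes "x \<in> carrier (free_module R X)"
  shows "\<ominus>\<^bsub>free_module R X\<^esub> x = (\<lambda>t. \<ominus> x t)"
proof -
  interpret P: module R "free_module R X" by (rule free_module_is_module)
  have "\<ominus>\<^bsub>free_module R X\<^esub> x = (\<ominus> \<one>) \<odot>\<^bsub>free_module R X\<^esub> x" using assms by (simp add: P.smult_minus_one)
  then show ?thesis using assms by (auto simp: free_module_simps mem_free_module l_minus)
qed

lemma free_module_minus:
  assumes "y \<in> carrier (free_module R X)"
  shows "x \<ominus>\<^bsub>free_module R X\<^esub> y = (\<lambda>t. x t \<ominus> y t)"
  using assms by (simp add: a_minus_def free_module_uminus free_module_simps)

lemma free_gen_closed: "x \<in> X \<Longrightarrow> free_gen R x \<in> carrier (free_module R X)"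
  by (auto simp: mem_free_module free_gen_def)

text \<open>Since \<open>f x = \<zero>\<close> in the step, the coefficients of \<open>f + r x\<close> are those of \<open>f\<close> together with \<open>r\<close>; this
  lets one carry a condition on the coefficients through the induction.\<close>

lemma free_module_induct [consumes 1, case_names zero add]:
  assumes f: "f \<in> carrier (free_module R X)"
    and zero: "Q (\<zero>\<^bsub>free_module R X\<^esub>)"
    and add: "\<And>x r f. x \<in> X \<Longrightarrow> r \<in> carrier R \<Longrightarrow> r \<noteq> \<zero> \<Longrightarrow> f \<in> carrier (free_module R X) \<Longrightarrow> f x = \<zero> \<Longrightarrow> Q f \<Longrightarrow>
      Q (f \<oplus>\<^bsub>free_module R X\<^esub> r \<odot>\<^bsub>free_module R X\<^esub> free_gen R x)"
  shows "Q f"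
proof -
  have "finite {x. f x \<noteq> \<zero>}" using f by (simp add: mem_free_module)
  then show ?thesis using f
  proof (induction "{x. f x \<noteq> \<zero>}" arbitrary: f rule: finite_induct)
    case empty
    then have "f = \<zero>\<^bsub>free_module R X\<^esub>" by (auto simp: free_module_simps)
    then show ?case using zero by simp
  next
    case (insert x A)
    define g where "g = f(x := \<zero>)"
    have gs: "{x. g x \<noteq> \<zero>} = A" using insert(2,4) by (auto simp: g_def)
    have g: "g \<in> carrier (free_module R X)" using insert gs by (auto simp: mem_free_module g_def)
    have fx: "f x \<noteq> \<zero>" using insert(4) by auto
    then have x: "x \<in> X" "f x \<in> carrier R" using insert(5) by (auto simp: mem_free_module)
    have "f = g \<oplus>\<^bsub>free_module R X\<^esub> f x \<odot>\<^bsub>free_module R X\<^esub> free_gen R x"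
      using insert(5) x by (auto simp: free_module_simps g_def free_gen_def fun_eq_iff mem_free_module)
    moreover have "Q (g \<oplus>\<^bsub>free_module R X\<^esub> f x \<odot>\<^bsub>free_module R X\<^esub> free_gen R x)"
      by (rule add) (use x fx g gs insert(3)[of g] in \<open>auto simp: g_def\<close>)
    ultimately show ?case by simp
  qed
qed

lemma linear_ext_superset:
  assumes "module R M" "h \<in> X \<rightarrow> carrier M" "f \<in> carrier (free_module R X)"
    and "finite A" "{x. f x \<noteq> \<zero>} \<subseteq> A" "A \<subseteq> X"
  shows "linear_ext R M h f = (\<Oplus>\<^bsub>M\<^esub> x \<in> A. f x \<odot>\<^bsub>M\<^esub> h x)"
proof -
  interpret M: module R M by fact
  show ?thesis unfolding linear_ext_def fun_support_def
    using assms
    by (intro M.add.finprod_mono_neutral_cong_left) (auto simp: mem_free_module Pi_def subset_iff)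
qed

lemma linear_ext_linear:
  assumes M: "module R M" and h: "h \<in> X \<rightarrow> carrier M"
  shows "linear_map R (free_module R X) M (linear_ext R M h)"
proof -
  interpret M: module R M by fact
  interpret P: module R "free_module R X" by (rule free_module_is_module)
  show ?thesis
  proof (rule linear_mapI)
    fix x assume x: "x \<in> carrier (free_module R X)"
    show "linear_ext R M h x \<in> carrier M" unfolding linear_ext_def fun_support_def
      using x h by (intro M.finsum_closed) (auto simp: mem_free_module Pi_def)
  next
    fix x y assume x: "x \<in> carrier (free_module R X)" and y: "y \<in> carrier (free_module R X)"
    let ?A = "{t. x t \<noteq> \<zero>} \<union> {t. y t \<noteq> \<zero>}"
    have A: "finite ?A" "?A \<subseteq> X" using x y by (auto simp: mem_free_module)
    have hA: "h t \<in> carrier M" if "t \<in> ?A" for t using A(2) h that by auto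
    have xy: "x \<oplus>\<^bsub>free_module R X\<^esub> y \<in> carrier (free_module R X)" using x y by simp
    have "linear_ext R M h (x \<oplus>\<^bsub>free_module R X\<^esub> y) =
      (\<Oplus>\<^bsub>M\<^esub> t \<in> ?A. (x t \<oplus> y t) \<odot>\<^bsub>M\<^esub> h t)"
      by (subst linear_ext_superset[OF M h xy A(1) _ A(2)]) (auto simp: free_module_simps)
    also have "\<dots> = (\<Oplus>\<^bsub>M\<^esub> t \<in> ?A. x t \<odot>\<^bsub>M\<^esub> h t \<oplus>\<^bsub>M\<^esub> y t \<odot>\<^bsub>M\<^esub> h t)"
      using x y hA by (intro M.finsum_cong') (auto simp: mem_free_module M.smult_l_distr Pi_def simp del: Un_iff)
    also have "\<dots> = (\<Oplus>\<^bsub>M\<^esub> t \<in> ?A. x t \<odot>\<^bsub>M\<^esub> h t) \<oplus>\<^bsub>M\<^esub> (\<Oplus>\<^bsub>M\<^esub> t \<in> ?A. y t \<odot>\<^bsub>M\<^esub> h t)"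
      using x y hA by (intro M.finsum_addf) (auto simp: mem_free_module simp del: Un_iff)
    also have "\<dots> = linear_ext R M h x \<oplus>\<^bsub>M\<^esub> linear_ext R M h y"
      by (subst (1 2) linear_ext_superset[OF M h _ A(1) _ A(2)]) (use x y in auto)
    finally show "linear_ext R M h (x \<oplus>\<^bsub>free_module R X\<^esub> y) = linear_ext R M h x \<oplus>\<^bsub>M\<^esub> linear_ext R M h y" .
  next
    fix r x assume r: "r \<in> carrier R" and x: "x \<in> carrier (free_module R X)"
    let ?A = "{t. x t \<noteq> \<zero>}"
    have A: "finite ?A" "?A \<subseteq> X" using x by (auto simp: mem_free_module)
    have hA: "h t \<in> carrier M" if "t \<in> ?A" for t using A(2) h that by auto
    have xy: "r \<odot>\<^bsub>free_module R X\<^esub> x \<in> carrier (free_module R X)" using x r by simp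
    have "linear_ext R M h (r \<odot>\<^bsub>free_module R X\<^esub> x) =
      (\<Oplus>\<^bsub>M\<^esub> t \<in> ?A. (r \<otimes> x t) \<odot>\<^bsub>M\<^esub> h t)"
      by (subst linear_ext_superset[OF M h xy A(1) _ A(2)]) (use r in \<open>auto simp: free_module_simps\<close>)
    also have "\<dots> = (\<Oplus>\<^bsub>M\<^esub> t \<in> ?A. r \<odot>\<^bsub>M\<^esub> (x t \<odot>\<^bsub>M\<^esub> h t))"
      using x r hA by (intro M.finsum_cong') (auto simp: mem_free_module M.smult_assoc1 Pi_def)
    also have "\<dots> = r \<odot>\<^bsub>M\<^esub> (\<Oplus>\<^bsub>M\<^esub> t \<in> ?A. x t \<odot>\<^bsub>M\<^esub> h t)"
      using x r hA A by (intro M.finsum_smult_ldistr[symmetric]) (auto simp: mem_free_module)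
    also have "\<dots> = r \<odot>\<^bsub>M\<^esub> linear_ext R M h x"
      by (simp add: linear_ext_def fun_support_def)
    finally show "linear_ext R M h (r \<odot>\<^bsub>free_module R X\<^esub> x) = r \<odot>\<^bsub>M\<^esub> linear_ext R M h x" .
  qed
qed

lemma linear_ext_gen:
  assumes M: "module R M" and h: "h \<in> X \<rightarrow> carrier M" and x: "x \<in> X"
  shows "linear_ext R M h (free_gen R x) = h x"
proof -
  interpret M: module R M by fact
  have hx: "h x \<in> carrier M" using h x by auto
  have "linear_ext R M h (free_gen R x) = (\<Oplus>\<^bsub>M\<^esub> t \<in> {x}. free_gen R x t \<odot>\<^bsub>M\<^esub> h t)"
    by (rule linear_ext_superset[OF M h free_gen_closed[OF x]]) (use x in \<open>auto simp: free_gen_def\<close>)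
  also have "\<dots> = h x" using hx by (simp add: free_gen_def)
  finally show ?thesis .
qed

lemma linear_map_free_eqI:
  assumes M: "module R M" and f: "linear_map R (free_module R X) M f"
    and g: "linear_map R (free_module R X) M g"
    and eq: "\<And>x. x \<in> X \<Longrightarrow> f (free_gen R x) = g (free_gen R x)"
    and y: "y \<in> carrier (free_module R X)"
  shows "f y = g y"
proof -
  interpret M: module R M by fact
  interpret P: module R "free_module R X" by (rule free_module_is_module)
  note z = linear_map_zero[OF free_module_is_module M]
  show ?thesis using y
  proof (induction y rule: free_module_induct)
    case zero
    show ?case by (simp add: z f g)
  next
    case (add x r h)
    then show ?case using f g eq
      by (simp add: linear_map_add linear_map_smult free_gen_closed)
  qed
qed

text \<open>Free modules are projective.\<close>

lemma free_module_lift: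
  assumes N: "module R N" and M: "module R M"
    and \<pi>: "linear_map R N M \<pi>" and f: "linear_map R (free_module R X) M f"
    and onto: "\<And>x. x \<in> X \<Longrightarrow> f (free_gen R x) \<in> \<pi> ` carrier N"
  obtains h where "linear_map R (free_module R X) N h" 
    "\<And>x. x \<in> carrier (free_module R X) \<Longrightarrow> \<pi> (h x) = f x"
proof -
  from onto have "\<forall>x\<in>X. \<exists>y. y \<in> carrier N \<and> \<pi> y = f (free_gen R x)" by (metis imageE)
  then obtain k where k: "\<And>x. x \<in> X \<Longrightarrow> k x \<in> carrier N" "\<And>x. x \<in> X \<Longrightarrow> \<pi> (k x) = f (free_gen R x)"
    by metis
  have kX: "k \<in> X \<rightarrow> carrier N" using k by auto
  have lin: "linear_map R (free_module R X) N (linear_ext R N k)" by (rule linear_ext_linear[OF N kX])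
  show ?thesis
  proof (rule that)
    show "linear_map R (free_module R X) N (linear_ext R N k)" by fact
    fix x assume "x \<in> carrier (free_module R X)"
    then show "\<pi> (linear_ext R N k x) = f x"
    proof (rule linear_map_free_eqI[OF M linear_map_compose[OF lin \<pi>] f, rotated])
      fix x assume "x \<in> X"
      then show "\<pi> (linear_ext R N k (free_gen R x)) = f (free_gen R x)"
        by (simp add: linear_ext_gen[OF N kX] k)
    qed
  qed
qed

end

section \<open>Extending homomorphisms from a submodule of a free module\<close>

text \<open>For a free module \<open>P\<close> this is the vanishing of \<open>Ext\<^sup>1(P / G, C)\<close>.\<close>

definition homs_extend ::
  "('r, 'm) ring_scheme \<Rightarrow> ('r, 'a) module \<Rightarrow> 'a set \<Rightarrow> ('r, 'c) module \<Rightarrow> bool"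
  where "homs_extend R P G C \<longleftrightarrow>
    (\<forall>g. linear_map R (P\<lparr>carrier := G\<rparr>) C g \<longrightarrow>
      (\<exists>h. linear_map R P C h \<and> (\<forall>x \<in> G. h x = g x)))"

lemma linear_map_sub_simps:
  assumes "linear_map R (P\<lparr>carrier := G\<rparr>) C g"
  shows "x \<in> G \<Longrightarrow> g x \<in> carrier C"
    and "x \<in> G \<Longrightarrow> y \<in> G \<Longrightarrow> g (x \<oplus>\<^bsub>P\<^esub> y) = g x \<oplus>\<^bsub>C\<^esub> g y"
    and "r \<in> carrier R \<Longrightarrow> x \<in> G \<Longrightarrow> g (r \<odot>\<^bsub>P\<^esub> x) = r \<odot>\<^bsub>C\<^esub> g x"
  using assms by (auto simp: linear_map_def)

lemma linear_map_sub_minus: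
  assumes "module R P" "submodule G R P" "module R C" "linear_map R (P\<lparr>carrier := G\<rparr>) C g"
    and "x \<in> G" "y \<in> G"
  shows "g (x \<ominus>\<^bsub>P\<^esub> y) = g x \<ominus>\<^bsub>C\<^esub> g y"
proof -
  interpret P: module R P by fact
  interpret C: module R C by fact
  have y: "y \<in> carrier P" using assms submodule_simps(1)[OF assms(1,2)] by auto
  have "g ((\<ominus>\<^bsub>R\<^esub> \<one>\<^bsub>R\<^esub>) \<odot>\<^bsub>P\<^esub> y) = (\<ominus>\<^bsub>R\<^esub> \<one>\<^bsub>R\<^esub>) \<odot>\<^bsub>C\<^esub> g y"
    using assms by (intro linear_map_sub_simps(3)[OF assms(4)]) auto
  then have "g (\<ominus>\<^bsub>P\<^esub> y) = \<ominus>\<^bsub>C\<^esub> g y"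
    using y assms by (simp add: P.smult_minus_one C.smult_minus_one linear_map_sub_simps)
  then show ?thesis using assms by (simp add: a_minus_def linear_map_sub_simps submodule_simps)
qed

lemma (in abelian_group) minus_minus_cancel: 
  "x \<in> carrier G \<Longrightarrow> y \<in> carrier G \<Longrightarrow> x \<ominus> (x \<ominus> y) = y"
  by (simp add: a_minus_def minus_add r_neg2)

lemma (in abelian_group) minus_add_cancel: 
  "x \<in> carrier G \<Longrightarrow> y \<in> carrier G \<Longrightarrow> (x \<ominus> y) \<oplus> y = x"
  by (simp add: a_minus_def a_assoc l_neg)

lemma (in abelian_group) minus_self: 
  "x \<in> carrier G \<Longrightarrow> x \<ominus> x = \<zero>"
  by (simp add: a_minus_def r_neg)

lemma (in abelian_group) minus_zero_right:
  "x \<in> carrier G \<Longrightarrow> x \<ominus> \<zero> = x"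
  using minus_add_cancel[of x \<zero>] by simp

lemma (in abelian_group) minus_eq_zeroD:
  "x \<in> carrier G \<Longrightarrow> y \<in> carrier G \<Longrightarrow> x \<ominus> y = \<zero> \<Longrightarrow> x = y"
  by (metis minus_add_cancel l_zero)

lemma (in abelian_group) minus_minus_swap:
  "x \<in> carrier G \<Longrightarrow> y \<in> carrier G \<Longrightarrow> \<ominus> (x \<ominus> y) = y \<ominus> x"
  by (simp add: a_minus_def minus_add a_comm)

lemma (in abelian_group) minus_cancel_right:
  assumes "x \<in> carrier G" "y \<in> carrier G" "z \<in> carrier G"
  shows "(x \<ominus> z) \<ominus> (y \<ominus> z) = x \<ominus> y"
  using assms by (simp add: a_minus_def minus_add a_assoc a_comm[of "\<ominus> y" z] r_neg1)

lemma (in abelian_group) add_minus_cancel_right: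
  assumes "x \<in> carrier G" "y \<in> carrier G" "z \<in> carrier G"
  shows "(x \<oplus> z) \<ominus> (y \<oplus> z) = x \<ominus> y"
  using assms minus_cancel_right[of x y "\<ominus> z"] by (simp add: a_minus_def)

lemma (in abelian_group) minus_add_minus:
  assumes "x \<in> carrier G" "y \<in> carrier G" "z \<in> carrier G"
  shows "(x \<ominus> y) \<oplus> (y \<ominus> z) = x \<ominus> z"
  using assms by (simp add: a_minus_def a_assoc r_neg1)

context cring
begin

text \<open>The argument of Schanuel's lemma: by freeness, the two presentations of the same module map to each
  other over that module. A map \<open>g\<close> from the second kernel is transported to the first one by \<open>q\<close> and
  extended there; going forth and back differs from the identity by a map into the second kernel,
  which corrects the extension.\<close>

lemma homs_extend_change_presentation:
  assumes M: "module R M" and C: "module R C"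
    and \<alpha>: "linear_map R (free_module R X) M \<alpha>" and \<beta>: "linear_map R (free_module R Y) M \<beta>"
    and im: "\<alpha> ` carrier (free_module R X) = \<beta> ` carrier (free_module R Y)"
    and ext: "homs_extend R (free_module R X) {x \<in> carrier (free_module R X). \<alpha> x = \<zero>\<^bsub>M\<^esub>} C"
  shows "homs_extend R (free_module R Y) {x \<in> carrier (free_module R Y). \<beta> x = \<zero>\<^bsub>M\<^esub>} C"
proof -
  let ?P = "free_module R X" and ?Q = "free_module R Y"
  let ?K = "{x \<in> carrier ?P. \<alpha> x = \<zero>\<^bsub>M\<^esub>}" and ?L = "{x \<in> carrier ?Q. \<beta> x = \<zero>\<^bsub>M\<^esub>}"
  interpret M: module R M by fact
  interpret C: module R C by fact
  interpret P: module R ?P by (rule free_module_is_module)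
  interpret Q: module R ?Q by (rule free_module_is_module)
  note PM = free_module_is_module[of X] and QM = free_module_is_module[of Y]
  have L: "submodule ?L R ?Q" by (rule linear_map_kernel[OF QM M \<beta>])
  have "\<beta> (free_gen R x) \<in> \<alpha> ` carrier ?P" if "x \<in> Y" for x
    unfolding im by (rule imageI[OF free_gen_closed[OF that]])
  from free_module_lift[OF PM M \<alpha> \<beta> this] obtain l where l: "linear_map R ?Q ?P l"
    "\<And>x. x \<in> carrier ?Q \<Longrightarrow> \<alpha> (l x) = \<beta> x" by metis
  have "\<alpha> (free_gen R x) \<in> \<beta> ` carrier ?Q" if "x \<in> X" for x
    unfolding im[symmetric] by (rule imageI[OF free_gen_closed[OF that]])
  from free_module_lift[OF QM M \<beta> \<alpha> this] obtain q where q: "linear_map R ?P ?Q q"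
    "\<And>x. x \<in> carrier ?P \<Longrightarrow> \<beta> (q x) = \<alpha> x" by metis
  show ?thesis unfolding homs_extend_def
  proof (intro allI impI)
    fix g assume g: "linear_map R (?Q\<lparr>carrier := ?L\<rparr>) C g"
    have "linear_map R (?P\<lparr>carrier := ?K\<rparr>) (?Q\<lparr>carrier := ?L\<rparr>) q"
      by (rule linear_map_restrict_codomain[OF linear_map_restrict_domain[OF q(1)]])
        (use q in \<open>auto simp: linear_map_closed\<close>)
    from linear_map_compose[OF this g] ext obtain h where h: "linear_map R ?P C h"
      "\<And>x. x \<in> ?K \<Longrightarrow> h x = g (q x)"
      unfolding homs_extend_def by blast
    let ?d = "\<lambda>x. q (l x) \<ominus>\<^bsub>?Q\<^esub> x"
    have dl: "linear_map R ?Q ?Q ?d"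
      by (rule linear_map_minusf[OF QM linear_map_compose[OF l(1) q(1)] linear_map_id])
    have "?d x \<in> ?L" if "x \<in> carrier ?Q" for x
      using that linear_map_minus[OF QM M \<beta>, of "q (l x)" x] l q \<beta>
      by (auto simp: linear_map_closed M.minus_self)
    then have d: "linear_map R ?Q (?Q\<lparr>carrier := ?L\<rparr>) ?d"
      by (rule linear_map_restrict_codomain[OF dl])
    show "\<exists>h. linear_map R ?Q C h \<and> (\<forall>x\<in>?L. h x = g x)"
    proof (intro exI conjI ballI)
      show "linear_map R ?Q C (\<lambda>x. h (l x) \<ominus>\<^bsub>C\<^esub> g (?d x))"
        by (intro linear_map_minusf[OF C] linear_map_compose[OF d g] linear_map_compose[OF l(1) h(1)])
    next
      fix x assume x: "x \<in> ?L"
      then have "l x \<in> ?K" using l by (auto simp: linear_map_closed)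
      then have 1: "h (l x) = g (q (l x))" "q (l x) \<in> ?L" using h q by (auto simp: linear_map_closed)
      have "g (?d x) = g (q (l x)) \<ominus>\<^bsub>C\<^esub> g x"
        by (rule linear_map_sub_minus[OF QM L C g 1(2) x])
      then show "h (l x) \<ominus>\<^bsub>C\<^esub> g (?d x) = g x"
        using 1 x linear_map_sub_simps(1)[OF g] by (simp add: C.minus_minus_cancel)
    qed
  qed
qed

end

section \<open>Flatness as local retractability\<close>

text \<open>For a free module \<open>P\<close> this is equivalent to flatness of \<open>P / G\<close> (Chase, Villamayor).\<close>

definition locally_retract ::
  "('r, 'm) ring_scheme \<Rightarrow> ('r, 'a) module \<Rightarrow> 'a set \<Rightarrow> bool"
  where "locally_retract R P G \<longleftrightarrow> submodule G R P \<and>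
    (\<forall>y \<in> G. \<exists>\<theta>. linear_map R P P \<theta> \<and> \<theta> ` carrier P \<subseteq> G \<and> \<theta> y = y)"

text \<open>If \<open>\<theta>\<close> fixes \<open>Y\<close> and \<open>\<eta>\<close> fixes \<open>y - \<theta> y\<close>, then \<open>(1 - \<eta>) (1 - \<theta>)\<close> kills \<open>Y\<close> and \<open>y\<close>.\<close>

lemma locally_retract_finite:
  assumes P: "module R P" and G: "locally_retract R P G" and Y: "finite Y" "Y \<subseteq> G"
  shows "\<exists>\<theta>. linear_map R P P \<theta> \<and> \<theta> ` carrier P \<subseteq> G \<and> (\<forall>y \<in> Y. \<theta> y = y)"
  using Y
proof (induction Y rule: finite_induct)
  case empty
  interpret P: module R P by fact
  have "\<zero>\<^bsub>P\<^esub> \<in> G" using G submodule_simps(2)[OF P] by (auto simp: locally_retract_def)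
  then show ?case using linear_map_zerof[OF P, of P] by auto
next
  case (insert y Y)
  interpret P: module R P by fact
  have sG: "submodule G R P" using G by (auto simp: locally_retract_def)
  note sub = submodule_simps[OF P sG]
  obtain \<theta> where t: "linear_map R P P \<theta>" "\<theta> ` carrier P \<subseteq> G" "\<And>z. z \<in> Y \<Longrightarrow> \<theta> z = z"
    using insert by auto
  have y: "y \<in> G" "y \<in> carrier P" "\<theta> y \<in> G" "\<theta> y \<in> carrier P" using insert t sub(1) by auto
  then have "y \<ominus>\<^bsub>P\<^esub> \<theta> y \<in> G" by (intro sub(6)) auto
  then obtain \<eta> where e: "linear_map R P P \<eta>" "\<eta> ` carrier P \<subseteq> G" "\<eta> (y \<ominus>\<^bsub>P\<^esub> \<theta> y) = y \<ominus>\<^bsub>P\<^esub> \<theta> y"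
    using G by (auto simp: locally_retract_def)
  \<comment> \<open>\<open>\<zeta>\<close> is \<open>1 - (1 - \<eta>) (1 - \<theta>)\<close>.\<close>
  define \<zeta> where "\<zeta> = (\<lambda>x. \<theta> x \<oplus>\<^bsub>P\<^esub> \<eta> (x \<ominus>\<^bsub>P\<^esub> \<theta> x))"
  have "linear_map R P P \<zeta>" unfolding \<zeta>_def
    by (intro linear_map_addf[OF P] t linear_map_compose[OF _ e(1)] linear_map_minusf[OF P] linear_map_id)
  moreover have "\<zeta> ` carrier P \<subseteq> G"
    using t e by (auto simp: \<zeta>_def linear_map_closed intro!: sub(3))
  moreover have "\<zeta> y = y" unfolding \<zeta>_def e(3) using y P.minus_add_cancel[of y "\<theta> y"]
    by (simp add: P.a_comm)
  moreover have "\<zeta> z = z" if "z \<in> Y" for z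
  proof -
    have "z \<in> carrier P" using that insert sub(1) by auto
    then show ?thesis unfolding \<zeta>_def t(3)[OF that]
      using linear_map_zero[OF P P e(1)] by (simp add: P.minus_self)
  qed
  ultimately show ?case by auto
qed

context cring
begin

lemma free_module_mono:
  "U \<subseteq> X \<Longrightarrow> carrier (free_module R U) \<subseteq> carrier (free_module R X)"
  unfolding mem_free_module subset_iff by blast

lemma linear_map_free_subset:
  "linear_map R (free_module R X) M f \<Longrightarrow> U \<subseteq> X \<Longrightarrow> linear_map R (free_module R U) M f"
  using free_module_mono[of U X] unfolding linear_map_def free_module_simps subset_iff by blast

lemma linear_map_eq_on_support:
  assumes M: "module R M" and f: "linear_map R (free_module R X) M f"
    and g: "linear_map R (free_module R X) M g"
    and y: "y \<in> carrier (free_module R X)"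
    and eq: "\<And>x. y x \<noteq> \<zero> \<Longrightarrow> f (free_gen R x) = g (free_gen R x)"
  shows "f y = g y"
proof -
  let ?U = "{x. y x \<noteq> \<zero>}"
  have U: "?U \<subseteq> X" and yU: "y \<in> carrier (free_module R ?U)" using y by (auto simp: mem_free_module)
  show ?thesis
    by (rule linear_map_free_eqI[OF M linear_map_free_subset[OF f U] linear_map_free_subset[OF g U] _ yU])
      (use eq in auto)
qed

text \<open>A syzygy of a flat module is flat. For \<open>y\<close> in the kernel, let \<open>\<theta>\<close> be a map to the image that
  fixes the finitely many \<open>\<phi> e\<^sub>t\<close> with \<open>t\<close> in the support of \<open>y\<close>, and let \<open>\<eta>\<close> lift \<open>\<theta>\<close> along \<open>\<phi>\<close>. Then
  \<open>1 - \<eta> \<phi>\<close> fixes \<open>y\<close>, and it sends these \<open>e\<^sub>t\<close> to the kernel.\<close>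

lemma locally_retract_kernel:
  assumes \<phi>: "linear_map R (free_module R X) (free_module R Y) \<phi>"
    and G: "locally_retract R (free_module R Y) (\<phi> ` carrier (free_module R X))"
  shows "locally_retract R (free_module R X)
    {x \<in> carrier (free_module R X). \<phi> x = \<zero>\<^bsub>free_module R Y\<^esub>}"
proof -
  let ?P = "free_module R X" and ?Q = "free_module R Y"
  let ?K = "{x \<in> carrier ?P. \<phi> x = \<zero>\<^bsub>?Q\<^esub>}"
  interpret P: module R ?P by (rule free_module_is_module)
  interpret Q: module R ?Q by (rule free_module_is_module)
  note PM = free_module_is_module[of X] and QM = free_module_is_module[of Y]
  have K: "submodule ?K R ?P" by (rule linear_map_kernel[OF PM QM \<phi>])
  have "\<exists>\<theta>. linear_map R ?P ?P \<theta> \<and> \<theta> ` carrier ?P \<subseteq> ?K \<and> \<theta> y = y" if y: "y \<in> ?K" for y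
  proof -
    let ?U = "{t. y t \<noteq> \<zero>}"
    have U: "finite ?U" "?U \<subseteq> X" using y by (auto simp: mem_free_module)
    have "(\<lambda>t. \<phi> (free_gen R t)) ` ?U \<subseteq> \<phi> ` carrier ?P"
      using U free_gen_closed[of _ X] by auto
    from locally_retract_finite[OF QM G _ this] U obtain \<theta> where
      t: "linear_map R ?Q ?Q \<theta>" "\<theta> ` carrier ?Q \<subseteq> \<phi> ` carrier ?P"
        "\<And>t. t \<in> ?U \<Longrightarrow> \<theta> (\<phi> (free_gen R t)) = \<phi> (free_gen R t)"
      by auto
    have "\<theta> (free_gen R x) \<in> \<phi> ` carrier ?P" if "x \<in> Y" for x
      using t(2) free_gen_closed[OF that] by auto
    from free_module_lift[OF PM QM \<phi> t(1) this] obtain \<eta> where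
      e: "linear_map R ?Q ?P \<eta>" "\<And>x. x \<in> carrier ?Q \<Longrightarrow> \<phi> (\<eta> x) = \<theta> x" by metis
    let ?d = "\<lambda>x. x \<ominus>\<^bsub>?P\<^esub> \<eta> (\<phi> x)"
    have d: "linear_map R ?P ?P ?d"
      by (rule linear_map_minusf[OF PM linear_map_id linear_map_compose[OF \<phi> e(1)]])
    have dU: "?d (free_gen R t) \<in> ?K" if "t \<in> ?U" for t
    proof -
      have g: "free_gen R t \<in> carrier ?P" using that U free_gen_closed[of t X] by auto
      then have "\<phi> (?d (free_gen R t)) = \<phi> (free_gen R t) \<ominus>\<^bsub>?Q\<^esub> \<phi> (\<eta> (\<phi> (free_gen R t)))"
        using linear_map_minus[OF PM QM \<phi>] linear_map_closed[OF e(1)] linear_map_closed[OF \<phi>] by simp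
      then show ?thesis using g \<phi> e t(3)[OF that]
        by (auto simp: linear_map_closed Q.minus_self)
    qed
    \<comment> \<open>Outside of the support of \<open>y\<close> the map may be replaced by zero.\<close>
    define h where "h = (\<lambda>t. if t \<in> ?U then ?d (free_gen R t) else \<zero>\<^bsub>?P\<^esub>)"
    have hK: "h t \<in> ?K" for t using dU submodule_simps(2)[OF PM K] by (auto simp: h_def)
    have hP: "h \<in> X \<rightarrow> carrier ?P" using hK by auto
    have l: "linear_map R ?P ?P (linear_ext R ?P h)" by (rule linear_ext_linear[OF PM hP])
    have "\<phi> (linear_ext R ?P h x) = \<zero>\<^bsub>?Q\<^esub>" if "x \<in> carrier ?P" for x
      using that
    proof (rule linear_map_free_eqI[OF QM linear_map_compose[OF l \<phi>] linear_map_zerof[OF QM], rotated])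
      fix x assume "x \<in> X" then show "\<phi> (linear_ext R ?P h (free_gen R x)) = \<zero>\<^bsub>?Q\<^esub>"
        using hK by (simp add: linear_ext_gen[OF PM hP])
    qed
    then have im: "linear_ext R ?P h ` carrier ?P \<subseteq> ?K" using linear_map_closed[OF l] by auto
    have "linear_ext R ?P h y = ?d y"
    proof (rule linear_map_eq_on_support[OF PM l d])
      show "y \<in> carrier ?P" using y by simp
      fix x assume "y x \<noteq> \<zero>"
      then show "linear_ext R ?P h (free_gen R x) = ?d (free_gen R x)"
        using linear_ext_gen[OF PM hP, of x] U by (auto simp: h_def)
    qed
    also have "\<dots> = y" using y linear_map_zero[OF QM PM e(1)] by (simp add: a_minus_def)
    finally show ?thesis using l im by auto
  qed
  then show ?thesis using K by (auto simp: locally_retract_def)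
qed

section \<open>Coefficients in an ideal\<close>

text \<open>The submodule \<open>IP\<close> of the free module \<open>P\<close> on \<open>X\<close>.\<close>

definition coeffs_in :: "'a set \<Rightarrow> 'x set \<Rightarrow> ('x \<Rightarrow> 'a) set"
  where "coeffs_in I X = {x \<in> carrier (free_module R X). \<forall>t. x t \<in> I}"

lemma coeffs_in_submodule:
  assumes "ideal I R"
  shows "submodule (coeffs_in I X) R (free_module R X)"
proof -
  interpret I: ideal I R by fact
  interpret P: module R "free_module R X" by (rule free_module_is_module)
  show ?thesis
  proof (rule submodule_of_closedI)
    show "module R (free_module R X)" by (rule free_module_is_module)
    show "coeffs_in I X \<subseteq> carrier (free_module R X)" by (auto simp: coeffs_in_def)
  next
    fix x y assume "x \<in> coeffs_in I X" "y \<in> coeffs_in I X"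
    then show "x \<oplus>\<^bsub>free_module R X\<^esub> y \<in> coeffs_in I X"
      using P.add.m_closed[of x y] by (auto simp: coeffs_in_def free_module_simps)
  next
    fix r x assume "r \<in> carrier R" "x \<in> coeffs_in I X"
    then show "r \<odot>\<^bsub>free_module R X\<^esub> x \<in> coeffs_in I X"
      using P.smult_closed[of r x] by (auto simp: coeffs_in_def free_module_simps I.I_l_closed)
  qed (use P.zero_closed in \<open>auto simp: coeffs_in_def free_module_simps\<close>)
qed

lemma linear_map_coeffs_in:
  assumes M: "module R M" and f: "linear_map R (free_module R X) M f"
    and H: "submodule H R M" and I: "ideal I R"
    and IH: "\<And>a x. a \<in> I \<Longrightarrow> x \<in> carrier M \<Longrightarrow> a \<odot>\<^bsub>M\<^esub> x \<in> H"
    and y: "y \<in> coeffs_in I X"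
  shows "f y \<in> H"
proof -
  interpret M: module R M by fact
  interpret I: ideal I R by fact
  interpret P: module R "free_module R X" by (rule free_module_is_module)
  note sub = submodule_simps[OF M H]
  have "y \<in> carrier (free_module R X)" "\<forall>t. y t \<in> I" using y by (auto simp: coeffs_in_def)
  then show ?thesis
  proof (induction y rule: free_module_induct)
    case zero
    show ?case using sub linear_map_zero[OF free_module_is_module M f] by simp
  next
    case (add x r h)
    have *: "h t \<oplus> r \<otimes> free_gen R x t \<in> I" for t
      using add.prems by (simp add: free_module_simps)
    have "r \<in> I" using *[of x] add.hyps by (simp add: free_gen_def)
    moreover have "h t \<in> I" for t
    proof (cases "t = x")
      case False
      then show ?thesis using *[of t] add.hyps by (simp add: free_gen_def mem_free_module)
    qed (use add.hyps in simp)
    ultimately show ?case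
      using add f by (simp add: linear_map_add linear_map_smult free_gen_closed sub IH linear_map_closed)
  qed
qed

lemma linear_map_free_coeffs_in:
  assumes "linear_map R (free_module R X) (free_module R Y) f" "ideal I R" "y \<in> coeffs_in I X"
  shows "f y \<in> coeffs_in I Y"
proof (rule linear_map_coeffs_in[OF free_module_is_module assms(1) coeffs_in_submodule[OF assms(2)] assms(2) _ assms(3)])
  interpret I: ideal I R by fact
  interpret P: module R "free_module R Y" by (rule free_module_is_module)
  fix a x assume "a \<in> I" "x \<in> carrier (free_module R Y)"
  then show "a \<odot>\<^bsub>free_module R Y\<^esub> x \<in> coeffs_in I Y"
    using P.smult_closed[of a x] by (auto simp: coeffs_in_def free_module_simps I.I_r_closed I.Icarr mem_free_module)
qed

lemma linear_map_kills_coeffs_in: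
  assumes M: "module R M" and "linear_map R (free_module R X) M f" "ideal I R" "y \<in> coeffs_in I X"
    and "\<And>a x. a \<in> I \<Longrightarrow> x \<in> carrier M \<Longrightarrow> a \<odot>\<^bsub>M\<^esub> x = \<zero>\<^bsub>M\<^esub>"
  shows "f y = \<zero>\<^bsub>M\<^esub>"
proof -
  interpret M: module R M by fact
  have "submodule {\<zero>\<^bsub>M\<^esub>} R M" by (rule submodule_of_closedI[OF M]) auto
  from linear_map_coeffs_in[OF M assms(2) this assms(3) _ assms(4)] assms(5) show ?thesis by auto
qed

text \<open>If \<open>\<theta>\<close> fixes \<open>y\<close>, then \<open>f y = (f \<theta>) y\<close>, and \<open>f \<theta>\<close> is defined on all of \<open>P\<close>, hence kills \<open>IP\<close>.\<close>

lemma linear_map_retract_kills_coeffs_in: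
  assumes M: "module R M" and G: "locally_retract R (free_module R X) G"
    and f: "linear_map R (free_module R X\<lparr>carrier := G\<rparr>) M f" and I: "ideal I R"
    and y: "y \<in> coeffs_in I X" "y \<in> G"
    and IM: "\<And>a x. a \<in> I \<Longrightarrow> x \<in> carrier M \<Longrightarrow> a \<odot>\<^bsub>M\<^esub> x = \<zero>\<^bsub>M\<^esub>"
  shows "f y = \<zero>\<^bsub>M\<^esub>"
proof -
  obtain \<theta> where t: "linear_map R (free_module R X) (free_module R X) \<theta>"
    "\<theta> ` carrier (free_module R X) \<subseteq> G" "\<theta> y = y" using G y by (auto simp: locally_retract_def)
  have "linear_map R (free_module R X) (free_module R X\<lparr>carrier := G\<rparr>) \<theta>"
    using t by (intro linear_map_restrict_codomain) auto
  from linear_map_kills_coeffs_in[OF M linear_map_compose[OF this f] I y(1) IM] t(3)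
  show ?thesis by auto
qed

text \<open>The image is pure in the free module, so that the elements of the image in \<open>IQ\<close> come from \<open>IP\<close>: lift
  a map to the image that fixes \<open>y\<close> along \<open>\<phi>\<close>, and apply the lift to \<open>y\<close>.\<close>

lemma locally_retract_image_coeffs_in:
  assumes \<phi>: "linear_map R (free_module R X) (free_module R Y) \<phi>"
    and G: "locally_retract R (free_module R Y) (\<phi> ` carrier (free_module R X))"
    and I: "ideal I R"
    and y: "y \<in> coeffs_in I Y" "y \<in> \<phi> ` carrier (free_module R X)"
  shows "\<exists>z \<in> coeffs_in I X. \<phi> z = y"
proof -
  let ?P = "free_module R X" and ?Q = "free_module R Y"
  note PM = free_module_is_module[of X] and QM = free_module_is_module[of Y]
  obtain \<theta> where t: "linear_map R ?Q ?Q \<theta>" "\<theta> ` carrier ?Q \<subseteq> \<phi> ` carrier ?P" "\<theta> y = y"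
    using G y by (auto simp: locally_retract_def)
  have "\<theta> (free_gen R x) \<in> \<phi> ` carrier ?P" if "x \<in> Y" for x
    using t(2) free_gen_closed[OF that] by auto
  from free_module_lift[OF PM QM \<phi> t(1) this] obtain \<eta> where
    e: "linear_map R ?Q ?P \<eta>" "\<And>x. x \<in> carrier ?Q \<Longrightarrow> \<phi> (\<eta> x) = \<theta> x" by metis
  have "y \<in> carrier ?Q" using y by (simp add: coeffs_in_def)
  then show ?thesis using linear_map_free_coeffs_in[OF e(1) I y(1)] e(2)[of y] t(3) by (intro bexI[of _ "\<eta> y"]) auto
qed

end

section \<open>Extensions and quotients of the target module\<close>

text \<open>The exact sequence \<open>Ext\<^sup>1(F, K) \<rightarrow> Ext\<^sup>1(F, C) \<rightarrow> Ext\<^sup>1(F, Q)\<close> for an extension \<open>C\<close> of \<open>Q\<close> by \<open>K\<close>.\<close>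

lemma (in cring) homs_extend_extension:
  assumes C: "module R C" and Q: "module R Q" and \<pi>: "linear_map R C Q \<pi>"
    and onto: "\<pi> ` carrier C = carrier Q" and G: "submodule G R (free_module R X)"
    and ext1: "homs_extend R (free_module R X) G (C\<lparr>carrier := {x \<in> carrier C. \<pi> x = \<zero>\<^bsub>Q\<^esub>}\<rparr>)"
    and ext2: "homs_extend R (free_module R X) G Q"
  shows "homs_extend R (free_module R X) G C"
  unfolding homs_extend_def
proof (intro allI impI)
  let ?P = "free_module R X" and ?K = "{x \<in> carrier C. \<pi> x = \<zero>\<^bsub>Q\<^esub>}"
  interpret C: module R C by fact
  interpret Q: module R Q by fact
  interpret P: module R ?P by (rule free_module_is_module)
  note PM = free_module_is_module[of X]
  have K: "submodule ?K R C" by (rule linear_map_kernel[OF C Q \<pi>])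
  fix g assume g: "linear_map R (?P\<lparr>carrier := G\<rparr>) C g"
  from linear_map_compose[OF g \<pi>] ext2 obtain k where
    k: "linear_map R ?P Q k" "\<And>x. x \<in> G \<Longrightarrow> k x = \<pi> (g x)" unfolding homs_extend_def by blast
  have "k (free_gen R x) \<in> \<pi> ` carrier C" if "x \<in> X" for x
    unfolding onto using linear_map_closed[OF k(1) free_gen_closed[OF that]] .
  from free_module_lift[OF C Q \<pi> k(1) this] obtain h where
    h: "linear_map R ?P C h" "\<And>x. x \<in> carrier ?P \<Longrightarrow> \<pi> (h x) = k x" by metis
  note GP = submodule_simps(1)[OF PM G]
  have hG: "linear_map R (?P\<lparr>carrier := G\<rparr>) C h"
    using GP by (intro linear_map_restrict_domain[OF h(1)]) auto
  have "linear_map R (?P\<lparr>carrier := G\<rparr>) (C\<lparr>carrier := ?K\<rparr>) (\<lambda>x. g x \<ominus>\<^bsub>C\<^esub> h x)"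
  proof (rule linear_map_restrict_codomain[OF linear_map_minusf[OF C g hG]])
    fix x assume "x \<in> carrier (?P\<lparr>carrier := G\<rparr>)"
    then have x: "x \<in> G" by simp
    then have gh: "g x \<in> carrier C" "h x \<in> carrier C"
      using g linear_map_sub_simps(1) linear_map_closed[OF h(1)] GP by fastforce+
    then show "g x \<ominus>\<^bsub>C\<^esub> h x \<in> ?K"
      using linear_map_minus[OF C Q \<pi>, of "g x" "h x"] h(2) k(2) x GP linear_map_closed[OF \<pi>]
      by (auto simp: Q.minus_self)
  qed
  with ext1 obtain l where l: "linear_map R ?P (C\<lparr>carrier := ?K\<rparr>) l"
    "\<And>x. x \<in> G \<Longrightarrow> l x = g x \<ominus>\<^bsub>C\<^esub> h x" unfolding homs_extend_def by blast
  have l': "linear_map R ?P C l" by (rule linear_map_into_submodule[OF C K l(1)])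
  show "\<exists>h. linear_map R ?P C h \<and> (\<forall>x\<in>G. h x = g x)"
  proof (intro exI conjI ballI)
    show "linear_map R ?P C (\<lambda>x. l x \<oplus>\<^bsub>C\<^esub> h x)" by (rule linear_map_addf[OF C l' h(1)])
    fix x assume x: "x \<in> G"
    then have gh: "g x \<in> carrier C" "h x \<in> carrier C"
      using g linear_map_sub_simps(1) linear_map_closed[OF h(1)] GP by fastforce+
    then show "l x \<oplus>\<^bsub>C\<^esub> h x = g x" using l(2) x by (simp add: C.minus_add_cancel)
  qed
qed

text \<open>The Noetherian induction below ranges over modules on one fixed type, so quotients have to be
  formed on the type of the module itself. They are carried by a set of representatives of the cosets,
  chosen by the function \<open>rep\<close>.\<close>

lemma quotient_on_same_type:
  fixes M :: "('r, 'a) module"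
  assumes M: "module R M" and H: "submodule H R M"
  obtains Q :: "('r, 'a) module" and \<pi> where "module R Q" "linear_map R M Q \<pi>"
    "\<pi> ` carrier M = carrier Q" "{x \<in> carrier M. \<pi> x = \<zero>\<^bsub>Q\<^esub>} = H"
proof -
  interpret M: module R M by fact
  note sub = submodule_simps[OF M H]
  define rep where "rep = (\<lambda>x. SOME y. y \<in> carrier M \<and> x \<ominus>\<^bsub>M\<^esub> y \<in> H)"
  have rep: "rep x \<in> carrier M \<and> x \<ominus>\<^bsub>M\<^esub> rep x \<in> H" if "x \<in> carrier M" for x
    unfolding rep_def by (rule someI[of _ x]) (use that sub in \<open>auto simp: M.minus_self\<close>)
  have rep_eq: "rep x = rep y \<longleftrightarrow> x \<ominus>\<^bsub>M\<^esub> y \<in> H" if "x \<in> carrier M" "y \<in> carrier M" for x y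
  proof
    assume "rep x = rep y"
    then have "(x \<ominus>\<^bsub>M\<^esub> rep x) \<ominus>\<^bsub>M\<^esub> (y \<ominus>\<^bsub>M\<^esub> rep x) \<in> H" using rep[OF that(1)] rep[OF that(2)] sub by auto
    moreover have "(x \<ominus>\<^bsub>M\<^esub> rep x) \<ominus>\<^bsub>M\<^esub> (y \<ominus>\<^bsub>M\<^esub> rep x) = x \<ominus>\<^bsub>M\<^esub> y"
      using that rep[OF that(1)] by (simp add: M.minus_cancel_right)
    ultimately show "x \<ominus>\<^bsub>M\<^esub> y \<in> H" by simp
  next
    assume a: "x \<ominus>\<^bsub>M\<^esub> y \<in> H"
    have "x \<ominus>\<^bsub>M\<^esub> z \<in> H \<longleftrightarrow> y \<ominus>\<^bsub>M\<^esub> z \<in> H" if z: "z \<in> carrier M" for z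
    proof -
      have "x \<ominus>\<^bsub>M\<^esub> z = (x \<ominus>\<^bsub>M\<^esub> y) \<oplus>\<^bsub>M\<^esub> (y \<ominus>\<^bsub>M\<^esub> z)" "y \<ominus>\<^bsub>M\<^esub> z = \<ominus>\<^bsub>M\<^esub> (x \<ominus>\<^bsub>M\<^esub> y) \<oplus>\<^bsub>M\<^esub> (x \<ominus>\<^bsub>M\<^esub> z)"
        using z \<open>x \<in> carrier M\<close> \<open>y \<in> carrier M\<close> by (simp_all add: M.minus_minus_swap M.minus_add_minus)
      then show ?thesis using a sub by metis
    qed
    then show "rep x = rep y" unfolding rep_def by (metis (no_types))
  qed
  have rr: "rep (rep x) = rep x" if "x \<in> carrier M" for x
  proof -
    have "\<ominus>\<^bsub>M\<^esub> (x \<ominus>\<^bsub>M\<^esub> rep x) \<in> H" using rep[OF that] sub by blast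
    moreover have "\<ominus>\<^bsub>M\<^esub> (x \<ominus>\<^bsub>M\<^esub> rep x) = rep x \<ominus>\<^bsub>M\<^esub> x"
      using that rep[OF that] by (simp add: M.minus_minus_swap)
    ultimately show ?thesis using rep[OF that] that by (subst rep_eq) auto
  qed
  have rl: "rep (rep x \<oplus>\<^bsub>M\<^esub> y) = rep (x \<oplus>\<^bsub>M\<^esub> y)" if "x \<in> carrier M" "y \<in> carrier M" for x y
  proof (subst rep_eq)
    have "\<ominus>\<^bsub>M\<^esub> (x \<ominus>\<^bsub>M\<^esub> rep x) \<in> H" using rep[OF that(1)] sub by blast
    moreover have "\<ominus>\<^bsub>M\<^esub> (x \<ominus>\<^bsub>M\<^esub> rep x) = (rep x \<oplus>\<^bsub>M\<^esub> y) \<ominus>\<^bsub>M\<^esub> (x \<oplus>\<^bsub>M\<^esub> y)"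
      using that rep[OF that(1)] by (simp add: M.minus_minus_swap M.add_minus_cancel_right)
    ultimately show "(rep x \<oplus>\<^bsub>M\<^esub> y) \<ominus>\<^bsub>M\<^esub> (x \<oplus>\<^bsub>M\<^esub> y) \<in> H" by simp
  qed (use that rep in auto)
  have rl2: "rep (x \<oplus>\<^bsub>M\<^esub> rep y) = rep (x \<oplus>\<^bsub>M\<^esub> y)" if "x \<in> carrier M" "y \<in> carrier M" for x y
    using rl[OF that(2,1)] rep that by (simp add: M.a_comm)
  have rs: "rep (r \<odot>\<^bsub>M\<^esub> rep x) = rep (r \<odot>\<^bsub>M\<^esub> x)" if "x \<in> carrier M" "r \<in> carrier R" for x r
  proof (subst rep_eq)
    have "r \<odot>\<^bsub>M\<^esub> (\<ominus>\<^bsub>M\<^esub> (x \<ominus>\<^bsub>M\<^esub> rep x)) \<in> H" using rep[OF that(1)] sub that by blast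
    moreover have "r \<odot>\<^bsub>M\<^esub> (\<ominus>\<^bsub>M\<^esub> (x \<ominus>\<^bsub>M\<^esub> rep x)) = r \<odot>\<^bsub>M\<^esub> rep x \<ominus>\<^bsub>M\<^esub> r \<odot>\<^bsub>M\<^esub> x"
      using that rep[OF that(1)] by (simp add: M.minus_minus_swap M.smult_r_diff)
    ultimately show "r \<odot>\<^bsub>M\<^esub> rep x \<ominus>\<^bsub>M\<^esub> r \<odot>\<^bsub>M\<^esub> x \<in> H" by simp
  qed (use that rep in auto)
  have repc: "rep x \<in> carrier M" if "x \<in> carrier M" for x using rep that by auto
  define Q :: "('r, 'a) module" where "Q = \<lparr>carrier = rep ` carrier M, mult = undefined, one = undefined,
     zero = rep \<zero>\<^bsub>M\<^esub>, add = (\<lambda>x y. rep (x \<oplus>\<^bsub>M\<^esub> y)), smult = (\<lambda>r x. rep (r \<odot>\<^bsub>M\<^esub> x))\<rparr>"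
  have "abelian_group Q"
  proof (rule abelian_groupI)
    fix x assume "x \<in> carrier Q"
    then obtain a where a: "x = rep a" "a \<in> carrier M" by (auto simp: Q_def)
    then show "\<exists>y\<in>carrier Q. y \<oplus>\<^bsub>Q\<^esub> x = \<zero>\<^bsub>Q\<^esub>"
      by (intro bexI[of _ "rep (\<ominus>\<^bsub>M\<^esub> a)"]) (auto simp: Q_def rl rl2 repc M.l_neg)
  next
    fix x y assume "x \<in> carrier Q" "y \<in> carrier Q"
    then show "x \<oplus>\<^bsub>Q\<^esub> y = y \<oplus>\<^bsub>Q\<^esub> x" by (auto simp: Q_def repc M.a_comm)
  qed (auto simp: Q_def rl rl2 repc M.a_assoc rr)
  have r1: "rep (a \<odot>\<^bsub>M\<^esub> rep x \<oplus>\<^bsub>M\<^esub> b \<odot>\<^bsub>M\<^esub> rep x) = rep (a \<odot>\<^bsub>M\<^esub> x \<oplus>\<^bsub>M\<^esub> b \<odot>\<^bsub>M\<^esub> x)"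
    if "x \<in> carrier M" "a \<in> carrier R" "b \<in> carrier R" for a b x
    using rs[OF that(1), of "a \<oplus>\<^bsub>R\<^esub> b"] that repc[OF that(1)] by (simp add: M.smult_l_distr)
  have r2: "rep (a \<odot>\<^bsub>M\<^esub> (b \<odot>\<^bsub>M\<^esub> rep x)) = rep (a \<odot>\<^bsub>M\<^esub> (b \<odot>\<^bsub>M\<^esub> x))"
    if "x \<in> carrier M" "a \<in> carrier R" "b \<in> carrier R" for a b x
    using rs[OF that(1), of "a \<otimes>\<^bsub>R\<^esub> b"] that repc[OF that(1)] by (simp add: M.smult_assoc1)
  have 1: "module R Q"
  proof (rule moduleI)
    show "cring R" by (rule M.is_cring)
    show "abelian_group Q" by fact
    fix a b x assume a: "a \<in> carrier R" and b: "b \<in> carrier R" and "x \<in> carrier Q"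
    then obtain u where u: "x = rep u" "u \<in> carrier M" by (auto simp: Q_def)
    show "(a \<oplus>\<^bsub>R\<^esub> b) \<odot>\<^bsub>Q\<^esub> x = a \<odot>\<^bsub>Q\<^esub> x \<oplus>\<^bsub>Q\<^esub> b \<odot>\<^bsub>Q\<^esub> x"
      using u r1[OF u(2) a b] a b by (simp add: Q_def rl rl2 repc M.smult_l_distr)
    show "(a \<otimes>\<^bsub>R\<^esub> b) \<odot>\<^bsub>Q\<^esub> x = a \<odot>\<^bsub>Q\<^esub> (b \<odot>\<^bsub>Q\<^esub> x)"
      using u r2[OF u(2) a b] a b by (simp add: Q_def rs repc M.smult_assoc1)
  next
    fix a x y assume a: "a \<in> carrier R" and "x \<in> carrier Q" "y \<in> carrier Q"
    then obtain u v where u: "x = rep u" "u \<in> carrier M" and v: "y = rep v" "v \<in> carrier M" by (auto simp: Q_def)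
    have "rep (a \<odot>\<^bsub>M\<^esub> rep (u \<oplus>\<^bsub>M\<^esub> v)) = rep (rep (a \<odot>\<^bsub>M\<^esub> u) \<oplus>\<^bsub>M\<^esub> rep (a \<odot>\<^bsub>M\<^esub> v))"
      using u v a by (simp add: rs rl rl2 repc M.smult_r_distr)
    then show "a \<odot>\<^bsub>Q\<^esub> (x \<oplus>\<^bsub>Q\<^esub> y) = a \<odot>\<^bsub>Q\<^esub> x \<oplus>\<^bsub>Q\<^esub> a \<odot>\<^bsub>Q\<^esub> y"
      using u v a by (simp add: Q_def rl rl2 rs repc)
  qed (auto simp: Q_def repc rr)
  have 2: "linear_map R M Q rep"
    by (intro linear_mapI) (auto simp: Q_def rl rl2 rs repc)
  have 3: "rep ` carrier M = carrier Q" by (simp add: Q_def)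
  have 4: "{x \<in> carrier M. rep x = \<zero>\<^bsub>Q\<^esub>} = H"
  proof -
    have "rep x = \<zero>\<^bsub>Q\<^esub> \<longleftrightarrow> x \<in> H" if "x \<in> carrier M" for x
      using rep_eq[OF that M.zero_closed] that by (simp add: Q_def M.minus_zero_right)
    then show ?thesis using sub(1) by blast
  qed
  show ?thesis by (rule that[OF 1 2 3 4])
qed

context cring
begin

section \<open>Splitting a tower of extensions\<close>

text \<open>The submodule \<open>G + IP\<close>.\<close>

definition plus_coeffs_in :: "'a set \<Rightarrow> 'x set \<Rightarrow> ('x \<Rightarrow> 'a) set \<Rightarrow> ('x \<Rightarrow> 'a) set"
  where "plus_coeffs_in I X G = {x \<in> carrier (free_module R X). \<exists>y \<in> G. x \<ominus>\<^bsub>free_module R X\<^esub> y \<in> coeffs_in I X}"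

lemma plus_coeffs_in_submodule:
  assumes I: "ideal I R" and G: "submodule G R (free_module R X)"
  shows "submodule (plus_coeffs_in I X G) R (free_module R X)"
proof -
  let ?P = "free_module R X"
  interpret P: module R ?P by (rule free_module_is_module)
  note PM = free_module_is_module[of X]
  note sub = submodule_simps[OF PM G]
  note csub = submodule_simps[OF PM coeffs_in_submodule[OF I, of X]]
  show ?thesis
  proof (rule submodule_of_closedI[OF PM])
    show "\<zero>\<^bsub>?P\<^esub> \<in> plus_coeffs_in I X G"
      using sub(2) csub(2) by (auto simp: plus_coeffs_in_def P.minus_self intro!: bexI[of _ "\<zero>\<^bsub>?P\<^esub>"])
  next
    fix x y assume "x \<in> plus_coeffs_in I X G" "y \<in> plus_coeffs_in I X G"
    then obtain a b where a: "a \<in> G" "x \<ominus>\<^bsub>?P\<^esub> a \<in> coeffs_in I X" "x \<in> carrier ?P"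
      and b: "b \<in> G" "y \<ominus>\<^bsub>?P\<^esub> b \<in> coeffs_in I X" "y \<in> carrier ?P" by (auto simp: plus_coeffs_in_def)
    have "(x \<oplus>\<^bsub>?P\<^esub> y) \<ominus>\<^bsub>?P\<^esub> (a \<oplus>\<^bsub>?P\<^esub> b) = (x \<ominus>\<^bsub>?P\<^esub> a) \<oplus>\<^bsub>?P\<^esub> (y \<ominus>\<^bsub>?P\<^esub> b)"
      using a b sub(1) by (simp add: a_minus_def P.minus_add P.a_ac)
    then have "(x \<oplus>\<^bsub>?P\<^esub> y) \<ominus>\<^bsub>?P\<^esub> (a \<oplus>\<^bsub>?P\<^esub> b) \<in> coeffs_in I X" using a b csub by simp
    then show "x \<oplus>\<^bsub>?P\<^esub> y \<in> plus_coeffs_in I X G" using a b sub by (auto simp: plus_coeffs_in_def)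
  next
    fix r x assume r: "r \<in> carrier R" and "x \<in> plus_coeffs_in I X G"
    then obtain a where a: "a \<in> G" "x \<ominus>\<^bsub>?P\<^esub> a \<in> coeffs_in I X" "x \<in> carrier ?P" by (auto simp: plus_coeffs_in_def)
    then have "r \<odot>\<^bsub>?P\<^esub> x \<ominus>\<^bsub>?P\<^esub> r \<odot>\<^bsub>?P\<^esub> a \<in> coeffs_in I X"
      using csub(4)[OF r a(2)] r sub(1) by (simp add: P.smult_r_diff)
    then show "r \<odot>\<^bsub>?P\<^esub> x \<in> plus_coeffs_in I X G" using a r sub by (auto simp: plus_coeffs_in_def)
  qed (auto simp: plus_coeffs_in_def)
qed

lemma plus_coeffs_in_simps:
  assumes I: "ideal I R" and G: "submodule G R (free_module R X)"
  shows "x \<in> G \<Longrightarrow> x \<in> plus_coeffs_in I X G"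
    and "x \<in> coeffs_in I X \<Longrightarrow> x \<in> plus_coeffs_in I X G"
proof -
  let ?P = "free_module R X"
  interpret P: module R ?P by (rule free_module_is_module)
  note sub = submodule_simps[OF free_module_is_module G]
  note csub = submodule_simps[OF free_module_is_module[of X] coeffs_in_submodule[OF I, of X]]
  show "x \<in> G \<Longrightarrow> x \<in> plus_coeffs_in I X G" using sub csub(2) by (auto simp: plus_coeffs_in_def P.minus_self intro!: bexI[of _ x])
  show "x \<in> coeffs_in I X \<Longrightarrow> x \<in> plus_coeffs_in I X G" using sub(2) csub(1)
    by (auto simp: plus_coeffs_in_def P.minus_zero_right intro!: bexI[of _ "\<zero>\<^bsub>?P\<^esub>"])
qed

lemma linear_map_in_submodule_on_support:
  assumes M: "module R M" and f: "linear_map R (free_module R X) M f"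
    and H: "submodule H R M"
    and y: "y \<in> carrier (free_module R X)"
    and eq: "\<And>x. y x \<noteq> \<zero> \<Longrightarrow> f (free_gen R x) \<in> H"
  shows "f y \<in> H"
proof -
  let ?U = "{x. y x \<noteq> \<zero>}"
  have U: "?U \<subseteq> X" and yU: "y \<in> carrier (free_module R ?U)" using y by (auto simp: mem_free_module)
  have f': "linear_map R (free_module R ?U) M f" by (rule linear_map_free_subset[OF f U])
  interpret M: module R M by fact
  interpret P: module R "free_module R ?U" by (rule free_module_is_module)
  note sub = submodule_simps[OF M H]
  show ?thesis using yU
  proof (induction y rule: free_module_induct)
    case zero
    show ?case using sub linear_map_zero[OF free_module_is_module M f'] by simp
  next
    case (add x r h)
    then show ?case using f' eq by (simp add: linear_map_add linear_map_smult free_gen_closed sub)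
  qed
qed

lemma free_module_submodule:
  assumes "U \<subseteq> X" shows "submodule (carrier (free_module R U)) R (free_module R X)"
proof -
  interpret U: module R "free_module R U" by (rule free_module_is_module)
  note c = U.add.m_closed U.smult_closed U.zero_closed
  show ?thesis
    by (rule submodule_of_closedI[OF free_module_is_module free_module_mono[OF assms]])
      (use c in \<open>auto simp: free_module_simps\<close>)
qed

text \<open>The product of \<open>s\<^sub>m, \<dots>, s\<^sub>k\<^sub>-\<^sub>1\<close>, which is the transition factor from level \<open>m\<close> to level \<open>k\<close> of the
  colimit of \<open>R \<rightarrow> R \<rightarrow> \<dots>\<close> along multiplication by the \<open>s\<^sub>n\<close>. The denominator of level \<open>k\<close> is
  \<open>\<sigma>\<^sub>k = segment_prod s 0 k\<close>. For \<open>k < m\<close> the value \<open>\<one>\<close> is a default.\<close>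

primrec segment_prod :: "(nat \<Rightarrow> 'a) \<Rightarrow> nat \<Rightarrow> nat \<Rightarrow> 'a" where
  "segment_prod s m 0 = \<one>"
| "segment_prod s m (Suc k) = (if m \<le> k then s k \<otimes> segment_prod s m k else \<one>)"

lemma segment_prod_closed [simp]: "(\<And>n. s n \<in> carrier R) \<Longrightarrow> segment_prod s m k \<in> carrier R"
  by (induction k) auto

lemma segment_prod_self: "segment_prod s m m = \<one>"
  by (cases m) auto

lemma segment_prod_mult:
  assumes "\<And>n. s n \<in> carrier R" "m \<le> k"
  shows "segment_prod s m k \<otimes> segment_prod s 0 m = segment_prod s 0 k"
  using assms(2)
proof (induction k rule: dec_induct)
  case base
  then show ?case using assms(1) by (simp add: segment_prod_self)
next
  case (step k)
  then show ?case using assms(1) by (simp add: m_assoc)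
qed

text \<open>The maps \<open>g\<^sub>n\<close> describe extensions \<open>E\<^sub>n\<close> of \<open>F = P / G\<close> by \<open>C\<close>, and the maps \<open>h\<^sub>n\<close> describe maps
  \<open>E\<^sub>n \<rightarrow> E\<^sub>n\<^sub>+\<^sub>1\<close> over multiplication by \<open>s\<^sub>n\<close> on \<open>F\<close>. An element of the colimit is represented at level \<open>k\<close>
  by a pair of an element of \<open>P\<close> and an element of \<open>C\<close>. Here \<open>(\<tau>\<^sub>k x, \<eta>\<^sub>k x)\<close> are representatives, at the
  levels \<open>k\<close> that are large enough for \<open>x\<close>, of the image of \<open>x\<close> under a linear map from \<open>P\<close> to the
  colimit. The condition on \<open>\<sigma>\<^sub>k x - \<tau>\<^sub>k x\<close> says that this map lies over the canonical map from \<open>P\<close> to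
  the localization of \<open>F / IF\<close>, and the last two that it vanishes on \<open>G\<close>. So it is a lift on \<open>F\<close>,
  and subtracting it from the canonical map of \<open>P\<close> to the colimit, represented by \<open>(x, 0)\<close> at level
  \<open>0\<close>, gives the extension \<open>u\<close> of \<open>g\<^sub>0\<close>.\<close>

lemma tower_extends:
  fixes C :: "('a, 'c) module" and X :: "'x set"
  defines "P \<equiv> free_module R X"
  assumes C: "module R C" and G: "locally_retract R P G" and I: "ideal I R"
    and IC: "\<And>a x. a \<in> I \<Longrightarrow> x \<in> carrier C \<Longrightarrow> a \<odot>\<^bsub>C\<^esub> x = \<zero>\<^bsub>C\<^esub>"
    and s: "\<And>n. s n \<in> carrier R"
    and g: "\<And>n. linear_map R (P\<lparr>carrier := G\<rparr>) C (g n)"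
    and h: "\<And>n. linear_map R P C (h n)"
    and gh: "\<And>n y. y \<in> G \<Longrightarrow> g n y = s n \<odot>\<^bsub>C\<^esub> g (Suc n) y \<oplus>\<^bsub>C\<^esub> h n y"
    and \<tau>: "\<And>n. linear_map R P P (\<tau> n)"
    and \<eta>: "\<And>n. linear_map R P C (\<eta> n)"
    and \<tau>_Suc: "\<And>x. x \<in> carrier P \<Longrightarrow> \<forall>\<^sub>F k in sequentially. \<tau> (Suc k) x = s k \<odot>\<^bsub>P\<^esub> \<tau> k x"
    and \<eta>_Suc: "\<And>x. x \<in> carrier P \<Longrightarrow> \<forall>\<^sub>F k in sequentially. \<eta> (Suc k) x = \<eta> k x \<oplus>\<^bsub>C\<^esub> h k (\<tau> k x)"
    and near: "\<And>x. x \<in> carrier P \<Longrightarrow>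
      \<forall>\<^sub>F k in sequentially. segment_prod s 0 k \<odot>\<^bsub>P\<^esub> x \<ominus>\<^bsub>P\<^esub> \<tau> k x \<in> plus_coeffs_in I X G"
    and \<tau>_G: "\<And>x. x \<in> G \<Longrightarrow> \<forall>\<^sub>F k in sequentially. \<tau> k x \<in> coeffs_in I X"
    and \<eta>_G: "\<And>x. x \<in> G \<Longrightarrow> \<forall>\<^sub>F k in sequentially. \<eta> k x = \<zero>\<^bsub>C\<^esub>"
  shows "\<exists>u. linear_map R P C u \<and> (\<forall>x \<in> G. u x = g 0 x)"
proof -
  interpret C: module R C by fact
  interpret P: module R P unfolding P_def by (rule free_module_is_module)
  have PM: "module R P" unfolding P_def by (rule free_module_is_module)
  have sG: "submodule G R P" using G by (simp add: locally_retract_def)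
  note sub = submodule_simps[OF PM sG]
  note csub = submodule_simps[OF PM coeffs_in_submodule[OF I, of X, folded P_def]]
  let ?s = "segment_prod s 0"
  have sc [simp]: "?s k \<in> carrier R" for k using s by simp
  have kill: "f y = \<zero>\<^bsub>C\<^esub>" if "linear_map R P C f" "y \<in> coeffs_in I X" for f y
    using linear_map_kills_coeffs_in[OF C _ I _ IC] that unfolding P_def by blast
  have gkill: "g n y = \<zero>\<^bsub>C\<^esub>" if "y \<in> coeffs_in I X" "y \<in> G" for n y
    using linear_map_retract_kills_coeffs_in[OF C G[unfolded P_def] g[unfolded P_def] I that IC] .
  have gc: "g n y \<in> carrier C" if "y \<in> G" for n y using linear_map_sub_simps(1)[OF g that] .
  have hc: "h n y \<in> carrier C" if "y \<in> carrier P" for n y using linear_map_closed[OF h that] .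
  \<comment> \<open>\<open>q\<^sub>n\<close> extends \<open>g\<^sub>n\<close> by zero to \<open>G + IP\<close>, which is possible as \<open>g\<^sub>n\<close> vanishes on \<open>G \<inter> IP\<close>.\<close>
  define q where "q = (\<lambda>n z. g n (SOME y. y \<in> G \<and> z \<ominus>\<^bsub>P\<^esub> y \<in> coeffs_in I X))"
  have q: "q n z = g n y" if "y \<in> G" "z \<ominus>\<^bsub>P\<^esub> y \<in> coeffs_in I X" "z \<in> carrier P" for n y z
  proof -
    define y' where "y' = (SOME y. y \<in> G \<and> z \<ominus>\<^bsub>P\<^esub> y \<in> coeffs_in I X)"
    have y': "y' \<in> G \<and> z \<ominus>\<^bsub>P\<^esub> y' \<in> coeffs_in I X" unfolding y'_def by (rule someI[of _ y]) (use that in auto)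
    have "(z \<ominus>\<^bsub>P\<^esub> y) \<ominus>\<^bsub>P\<^esub> (z \<ominus>\<^bsub>P\<^esub> y') \<in> coeffs_in I X" using that y' csub by auto
    moreover have "(z \<ominus>\<^bsub>P\<^esub> y) \<ominus>\<^bsub>P\<^esub> (z \<ominus>\<^bsub>P\<^esub> y') = (y' \<ominus>\<^bsub>P\<^esub> z) \<oplus>\<^bsub>P\<^esub> (z \<ominus>\<^bsub>P\<^esub> y)"
      using that y' sub by (simp add: a_minus_def P.minus_add P.a_ac)
    moreover have "\<dots> = y' \<ominus>\<^bsub>P\<^esub> y" using that y' sub by (simp add: P.minus_add_minus)
    ultimately have "g n (y' \<ominus>\<^bsub>P\<^esub> y) = \<zero>\<^bsub>C\<^esub>" using that y' sub by (intro gkill) auto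
    then have "g n y' \<ominus>\<^bsub>C\<^esub> g n y = \<zero>\<^bsub>C\<^esub>" using linear_map_sub_minus[OF PM sG C g, of y' y n] y' that by simp
    then have "g n y' = g n y" using C.minus_eq_zeroD gc y' that by blast
    then show ?thesis by (simp add: q_def y'_def)
  qed
  have nearE: "\<exists>y \<in> G. z \<ominus>\<^bsub>P\<^esub> y \<in> coeffs_in I X" if "z \<in> plus_coeffs_in I X G" for z
    using that by (auto simp: plus_coeffs_in_def P_def)
  have nearP: "z \<in> carrier P" if "z \<in> plus_coeffs_in I X G" for z
    using that by (auto simp: plus_coeffs_in_def P_def)
  have qc: "q n z \<in> carrier C" if "z \<in> plus_coeffs_in I X G" for n z
    using nearE[OF that] nearP[OF that] q gc by metis
  have q_add: "q n (z \<oplus>\<^bsub>P\<^esub> z') = q n z \<oplus>\<^bsub>C\<^esub> q n z'" if "z \<in> plus_coeffs_in I X G" "z' \<in> plus_coeffs_in I X G" for n z z'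
  proof -
    from nearE[OF that(1)] nearE[OF that(2)] obtain y y' where
      y: "y \<in> G" "z \<ominus>\<^bsub>P\<^esub> y \<in> coeffs_in I X" and y': "y' \<in> G" "z' \<ominus>\<^bsub>P\<^esub> y' \<in> coeffs_in I X" by auto
    have "(z \<oplus>\<^bsub>P\<^esub> z') \<ominus>\<^bsub>P\<^esub> (y \<oplus>\<^bsub>P\<^esub> y') = (z \<ominus>\<^bsub>P\<^esub> y) \<oplus>\<^bsub>P\<^esub> (z' \<ominus>\<^bsub>P\<^esub> y')"
      using y y' sub(1) nearP that by (simp add: a_minus_def P.minus_add P.a_ac)
    then have "q n (z \<oplus>\<^bsub>P\<^esub> z') = g n (y \<oplus>\<^bsub>P\<^esub> y')"
      using y y' sub csub that nearP by (intro q) auto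
    then show ?thesis using y y' q that nearP linear_map_sub_simps(2)[OF g] by metis
  qed
  have q_smult: "q n (r \<odot>\<^bsub>P\<^esub> z) = r \<odot>\<^bsub>C\<^esub> q n z" if "z \<in> plus_coeffs_in I X G" "r \<in> carrier R" for n z r
  proof -
    from nearE[OF that(1)] obtain y where y: "y \<in> G" "z \<ominus>\<^bsub>P\<^esub> y \<in> coeffs_in I X" by auto
    have "r \<odot>\<^bsub>P\<^esub> z \<ominus>\<^bsub>P\<^esub> r \<odot>\<^bsub>P\<^esub> y \<in> coeffs_in I X"
      using csub(4)[OF that(2) y(2)] sub(1) y nearP that by (simp add: P.smult_r_diff)
    then have "q n (r \<odot>\<^bsub>P\<^esub> z) = g n (r \<odot>\<^bsub>P\<^esub> y)"
      using y sub that nearP by (intro q) auto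
    then show ?thesis using y q that nearP linear_map_sub_simps(3)[OF g] by metis
  qed
  \<comment> \<open>\<open>A\<^sub>k x\<close> is the sum of \<open>h\<^sub>i (\<sigma>\<^sub>i x)\<close> over \<open>i < k\<close>: the element of \<open>C\<close> picked up by \<open>(x, 0)\<close> on its
    way from level \<open>0\<close> to level \<open>k\<close>.\<close>
  define A where "A = rec_nat (\<lambda>x. \<zero>\<^bsub>C\<^esub>) (\<lambda>k f x. f x \<oplus>\<^bsub>C\<^esub> h k (?s k \<odot>\<^bsub>P\<^esub> x))"
  have A_0: "A 0 x = \<zero>\<^bsub>C\<^esub>" and A_Suc: "A (Suc k) x = A k x \<oplus>\<^bsub>C\<^esub> h k (?s k \<odot>\<^bsub>P\<^esub> x)" for k x
    by (simp_all add: A_def)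
  have A: "linear_map R P C (A k)" for k
  proof (induction k)
    case 0
    then show ?case by (rule linear_map_cong[OF PM linear_map_zerof[OF C]]) (simp add: A_0)
  next
    case (Suc k)
    have "linear_map R P C (\<lambda>x. h k (?s k \<odot>\<^bsub>P\<^esub> x))"
      by (rule linear_map_compose[OF linear_map_smultf[OF PM linear_map_id sc] h])
    from linear_map_addf[OF C Suc this] show ?case
      by (rule linear_map_cong[OF PM]) (simp add: A_Suc)
  qed
  let ?z = "\<lambda>k x. ?s k \<odot>\<^bsub>P\<^esub> x \<ominus>\<^bsub>P\<^esub> \<tau> k x"
  \<comment> \<open>The difference of \<open>(\<sigma>\<^sub>k x, A\<^sub>k x)\<close> and \<open>(\<tau>\<^sub>k x, \<eta>\<^sub>k x)\<close>, an element of \<open>C\<close> since the first components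
    agree modulo \<open>G + IP\<close>. It does not depend on the level \<open>k\<close> once \<open>k\<close> is large.\<close>
  define v where "v = (\<lambda>k x. (A k x \<ominus>\<^bsub>C\<^esub> \<eta> k x) \<oplus>\<^bsub>C\<^esub> q k (?z k x))"
  have \<tau>c: "\<tau> k x \<in> carrier P" and \<eta>c: "\<eta> k x \<in> carrier C" and Ac: "A k x \<in> carrier C"
    if "x \<in> carrier P" for k x
    by (rule linear_map_closed[OF \<tau> that] linear_map_closed[OF \<eta> that] linear_map_closed[OF A that])+
  have vc: "\<forall>\<^sub>F k in sequentially. v k x \<in> carrier C" if "x \<in> carrier P" for x
    using near[OF that] by eventually_elim (use that qc \<eta>c Ac in \<open>auto simp: v_def\<close>)
  have v_Suc: "\<forall>\<^sub>F k in sequentially. v (Suc k) x = v k x" if x: "x \<in> carrier P" for x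
    using \<tau>_Suc[OF x] \<eta>_Suc[OF x] near[OF x]
  proof eventually_elim
    case (elim k)
    from nearE[OF elim(3)] obtain y where y: "y \<in> G" "?z k x \<ominus>\<^bsub>P\<^esub> y \<in> coeffs_in I X" by auto
    have zP: "?z k x \<in> carrier P" using x \<tau>c by simp
    have yP: "y \<in> carrier P" using y sub by simp
    have "?z (Suc k) x = s k \<odot>\<^bsub>P\<^esub> ?z k x"
      using x \<tau>c s elim(1) by (simp add: P.smult_r_diff P.smult_assoc1)
    then have "q (Suc k) (?z (Suc k) x) = s k \<odot>\<^bsub>C\<^esub> g (Suc k) y"
      using q_smult[OF elim(3) s] q[OF y zP] by simp
    moreover have "q k (?z k x) = s k \<odot>\<^bsub>C\<^esub> g (Suc k) y \<oplus>\<^bsub>C\<^esub> (h k (?s k \<odot>\<^bsub>P\<^esub> x) \<ominus>\<^bsub>C\<^esub> h k (\<tau> k x))"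
    proof -
      have "h k (?z k x) \<ominus>\<^bsub>C\<^esub> h k y = \<zero>\<^bsub>C\<^esub>"
        using kill[OF h y(2)] linear_map_minus[OF PM C h zP yP] by simp
      then have "h k y = h k (?z k x)" using C.minus_eq_zeroD hc zP yP by metis
      also have "\<dots> = h k (?s k \<odot>\<^bsub>P\<^esub> x) \<ominus>\<^bsub>C\<^esub> h k (\<tau> k x)"
        using x \<tau>c by (intro linear_map_minus[OF PM C h]) auto
      finally show ?thesis using q[OF y zP, of k] gh[OF y(1), of k] by simp
    qed
    moreover have "g (Suc k) y \<in> carrier C" by (rule gc[OF y(1)])
    ultimately show ?case
      using x \<tau>c \<eta>c Ac hc s elim(2) by (simp add: v_def A_Suc a_minus_def C.minus_add C.a_ac)
  qed
  have "\<exists>c. \<forall>\<^sub>F k in sequentially. v k x = c" if "x \<in> carrier P" for x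
  proof -
    from v_Suc[OF that] obtain N where N: "\<And>k. k \<ge> N \<Longrightarrow> v (Suc k) x = v k x"
      by (auto simp: eventually_sequentially)
    have "v k x = v N x" if "k \<ge> N" for k using that
      by (induction k rule: dec_induct) (auto simp: N)
    then show ?thesis by (auto simp: eventually_sequentially)
  qed
  then obtain u where u: "\<And>x. x \<in> carrier P \<Longrightarrow> \<forall>\<^sub>F k in sequentially. v k x = u x" by metis
  have evD: "Q" if "\<forall>\<^sub>F k in sequentially. Q" for Q using that by simp
  show ?thesis
  proof (intro exI conjI ballI)
    show "linear_map R P C u"
    proof (rule linear_mapI)
      fix x assume x: "x \<in> carrier P"
      have "\<forall>\<^sub>F k in sequentially. u x \<in> carrier C"
        using u[OF x] vc[OF x] by eventually_elim simp
      then show "u x \<in> carrier C" by (rule evD)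
    next
      fix x y assume x: "x \<in> carrier P" and y: "y \<in> carrier P"
      have "\<forall>\<^sub>F k in sequentially. u (x \<oplus>\<^bsub>P\<^esub> y) = u x \<oplus>\<^bsub>C\<^esub> u y"
        using u[OF x] u[OF y] u[OF P.add.m_closed[OF x y]] near[OF x] near[OF y]
      proof eventually_elim
        case (elim k)
        have "?z k (x \<oplus>\<^bsub>P\<^esub> y) = ?z k x \<oplus>\<^bsub>P\<^esub> ?z k y"
          using x y \<tau>c by (simp add: P.smult_r_distr linear_map_add[OF \<tau>] a_minus_def P.minus_add P.a_ac)
        then have "v k (x \<oplus>\<^bsub>P\<^esub> y) = v k x \<oplus>\<^bsub>C\<^esub> v k y"
          using x y \<tau>c \<eta>c Ac qc elim(4,5) q_add[OF elim(4,5)]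
          by (simp add: v_def linear_map_add[OF \<eta>] linear_map_add[OF A] a_minus_def C.minus_add C.a_ac)
        then show ?case using elim by simp
      qed
      then show "u (x \<oplus>\<^bsub>P\<^esub> y) = u x \<oplus>\<^bsub>C\<^esub> u y" by (rule evD)
    next
      fix r x assume r: "r \<in> carrier R" and x: "x \<in> carrier P"
      have "\<forall>\<^sub>F k in sequentially. u (r \<odot>\<^bsub>P\<^esub> x) = r \<odot>\<^bsub>C\<^esub> u x"
        using u[OF x] u[OF P.smult_closed[OF r x]] near[OF x]
      proof eventually_elim
        case (elim k)
        have "?z k (r \<odot>\<^bsub>P\<^esub> x) = r \<odot>\<^bsub>P\<^esub> ?z k x"
          using r x \<tau>c by (simp add: P.smult_r_diff linear_map_smult[OF \<tau>] P.smult_commute)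
        then have "v k (r \<odot>\<^bsub>P\<^esub> x) = r \<odot>\<^bsub>C\<^esub> v k x"
          using r x \<tau>c \<eta>c Ac qc elim(3) q_smult[OF elim(3) r]
          by (simp add: v_def linear_map_smult[OF \<eta>] linear_map_smult[OF A] C.smult_r_distr C.smult_r_diff)
        then show ?case using elim by simp
      qed
      then show "u (r \<odot>\<^bsub>P\<^esub> x) = r \<odot>\<^bsub>C\<^esub> u x" by (rule evD)
    qed
  next
    fix x assume xG: "x \<in> G"
    then have x: "x \<in> carrier P" using sub by simp
    have A_g: "A k x \<oplus>\<^bsub>C\<^esub> ?s k \<odot>\<^bsub>C\<^esub> g k x = g 0 x" for k
    proof (induction k)
      case 0
      then show ?case using gc[OF xG] by (simp add: A_0)
    next
      case (Suc k)
      have "?s k \<odot>\<^bsub>C\<^esub> g k x = ?s (Suc k) \<odot>\<^bsub>C\<^esub> g (Suc k) x \<oplus>\<^bsub>C\<^esub> h k (?s k \<odot>\<^bsub>P\<^esub> x)"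
        using gh[OF xG, of k] gc[OF xG] hc[OF x] s x
        by (simp add: C.smult_r_distr linear_map_smult[OF h] C.smult_assoc1 C.smult_commute)
      then show ?case using Suc Ac[OF x] gc[OF xG] hc x s by (simp add: A_Suc C.a_ac del: segment_prod.simps)
    qed
    have "\<forall>\<^sub>F k in sequentially. u x = g 0 x"
      using u[OF x] \<tau>_G[OF xG] \<eta>_G[OF xG]
    proof eventually_elim
      case (elim k)
      have "?z k x \<ominus>\<^bsub>P\<^esub> ?s k \<odot>\<^bsub>P\<^esub> x = \<ominus>\<^bsub>P\<^esub> \<tau> k x"
        using x \<tau>c by (simp add: a_minus_def P.a_ac P.r_neg2 P.r_neg1 P.r_neg)
      then have "q k (?z k x) = g k (?s k \<odot>\<^bsub>P\<^esub> x)"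
        using xG sub csub(5)[OF elim(2)] x \<tau>c by (intro q) auto
      then have "q k (?z k x) = ?s k \<odot>\<^bsub>C\<^esub> g k x" using linear_map_sub_simps(3)[OF g sc xG] by simp
      then have "v k x = A k x \<oplus>\<^bsub>C\<^esub> ?s k \<odot>\<^bsub>C\<^esub> g k x"
        using elim(3) Ac[OF x] by (simp add: v_def C.minus_zero_right)
      then show ?case using A_g elim by simp
    qed
    then show "u x = g 0 x" by (rule evD)
  qed
qed

text \<open>The basis vectors in \<open>B\<close> give a basis of the vector space \<open>F \<otimes> K\<close>, where \<open>F = P / G\<close> and \<open>K\<close> is the
  field of fractions of \<open>R / p\<close>: by maximality, every \<open>t\<close> is a combination of \<open>B\<close> after multiplication
  with some \<open>a\<close> outside of \<open>p\<close>. Zorn's lemma applies since dependence involves finitely many vectors.\<close>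

lemma exists_maximal_independent:
  fixes X :: "'x set"
  defines "P \<equiv> free_module R X"
  assumes G: "submodule G R P" and p: "primeideal p R"
  shows "\<exists>B \<subseteq> X. plus_coeffs_in p X G \<inter> carrier (free_module R B) \<subseteq> coeffs_in p X \<and>
    (\<forall>t \<in> X. \<exists>a \<in> carrier R - p. \<exists>w \<in> carrier (free_module R B).
      a \<odot>\<^bsub>P\<^esub> free_gen R t \<ominus>\<^bsub>P\<^esub> w \<in> plus_coeffs_in p X G)"
proof -
  interpret p: primeideal p R by fact
  interpret P: module R P unfolding P_def by (rule free_module_is_module)
  have PM: "module R P" unfolding P_def by (rule free_module_is_module)
  have I: "ideal p R" by (rule p.is_ideal)
  note csub = submodule_simps[OF PM coeffs_in_submodule[OF I, of X, folded P_def]]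
  note nsub = submodule_simps[OF PM plus_coeffs_in_submodule[OF I G[unfolded P_def], folded P_def]]
  note nn = plus_coeffs_in_simps[OF I G[unfolded P_def]]
  define \<A> where "\<A> = {B. B \<subseteq> X \<and> plus_coeffs_in p X G \<inter> carrier (free_module R B) \<subseteq> coeffs_in p X}"
  have "{} \<in> \<A>"
  proof -
    have "carrier (free_module R {}) = {\<zero>\<^bsub>P\<^esub>}" by (auto simp: mem_free_module P_def free_module_simps)
    then show ?thesis using csub(2) by (auto simp: \<A>_def)
  qed
  moreover have "\<Union>\<C> \<in> \<A>" if "\<C> \<noteq> {}" "subset.chain \<A> \<C>" for \<C>
  proof -
    have \<C>: "\<C> \<subseteq> \<A>" using that(2) by (simp add: subset.chain_def)
    have "w \<in> coeffs_in p X" if w: "w \<in> plus_coeffs_in p X G" "w \<in> carrier (free_module R (\<Union>\<C>))" for w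
    proof -
      have "finite {t. w t \<noteq> \<zero>}" "{t. w t \<noteq> \<zero>} \<subseteq> \<Union>\<C>" using w(2) by (auto simp: mem_free_module)
      then obtain B where B: "B \<in> \<C>" "{t. w t \<noteq> \<zero>} \<subseteq> B"
        using finite_subset_Union_chain[OF _ _ \<open>\<C> \<noteq> {}\<close> \<open>subset.chain \<A> \<C>\<close>] by metis
      then have "w \<in> carrier (free_module R B)" using w(2) by (auto simp: mem_free_module)
      then show ?thesis using B(1) \<C> w(1) by (auto simp: \<A>_def)
    qed
    then show ?thesis using \<C> by (auto simp: \<A>_def)
  qed
  ultimately obtain B where B: "B \<in> \<A>" and max: "\<And>B'. B' \<in> \<A> \<Longrightarrow> B \<subseteq> B' \<Longrightarrow> B' = B"
    using subset_Zorn_nonempty[of \<A>] by blast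
  have BX: "B \<subseteq> X" and BN: "plus_coeffs_in p X G \<inter> carrier (free_module R B) \<subseteq> coeffs_in p X"
    using B by (auto simp: \<A>_def)
  have "\<exists>a \<in> carrier R - p. \<exists>w \<in> carrier (free_module R B).
      a \<odot>\<^bsub>P\<^esub> free_gen R t \<ominus>\<^bsub>P\<^esub> w \<in> plus_coeffs_in p X G" if t: "t \<in> X" for t
  proof (cases "t \<in> B")
    case True
    have e: "free_gen R t \<in> carrier P" using t by (simp add: P_def free_gen_closed)
    then have "\<one> \<odot>\<^bsub>P\<^esub> free_gen R t \<ominus>\<^bsub>P\<^esub> free_gen R t \<in> plus_coeffs_in p X G"
      using nsub(2) by (simp add: P.minus_self)
    moreover have "\<one> \<in> carrier R - p" using p.one_imp_carrier p.I_notcarr by auto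
    ultimately show ?thesis using True free_gen_closed[OF True] by blast
  next
    case False
    have e: "free_gen R t \<in> carrier P" using t by (simp add: P_def free_gen_closed)
    have "insert t B \<notin> \<A>" using max[of "insert t B"] False by auto
    then obtain w where w: "w \<in> plus_coeffs_in p X G" "w \<in> carrier (free_module R (insert t B))" "w \<notin> coeffs_in p X"
      using t BX by (auto simp: \<A>_def)
    define w' where "w' = w \<ominus>\<^bsub>P\<^esub> w t \<odot>\<^bsub>P\<^esub> free_gen R t"
    have wt: "w t \<in> carrier R" and wP: "w \<in> carrier P" using w nsub(1) by (auto simp: mem_free_module)
    have w'_eq: "w' = (\<lambda>x. if x = t then \<zero> else w x)"
      using w(2) e wt P.smult_closed[OF wt e] unfolding w'_def P_def
      by (subst free_module_minus) (auto simp: free_module_simps free_gen_def mem_free_module fun_eq_iff a_minus_def r_neg)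
    have w'B: "w' \<in> carrier (free_module R B)"
    proof -
      have "{x. (if x = t then \<zero> else w x) \<noteq> \<zero>} \<subseteq> {x. w x \<noteq> \<zero>}" by auto
      then show ?thesis using w(2) unfolding w'_eq mem_free_module by (auto intro: finite_subset)
    qed
    then have w'P: "w' \<in> carrier P" using free_module_mono[OF BX] by (auto simp: P_def)
    have "w t \<notin> p"
    proof
      assume a: "w t \<in> p"
      have ae: "w t \<odot>\<^bsub>P\<^esub> free_gen R t \<in> coeffs_in p X"
        using P.smult_closed[OF wt e] a by (auto simp: coeffs_in_def P_def free_module_simps free_gen_def)
      then have "w' \<in> plus_coeffs_in p X G" unfolding w'_def by (intro nsub(6) w(1) nn(2))
      then have "w' \<in> coeffs_in p X" using w'B BN by auto
      then have "w' \<oplus>\<^bsub>P\<^esub> w t \<odot>\<^bsub>P\<^esub> free_gen R t \<in> coeffs_in p X" using ae by (intro csub(3))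
      then show False using w(3) wP wt e by (simp add: w'_def P.minus_add_cancel)
    qed
    moreover have "w t \<odot>\<^bsub>P\<^esub> free_gen R t \<ominus>\<^bsub>P\<^esub> (\<ominus>\<^bsub>P\<^esub> w') = w"
      using w'P wt wP e P.minus_add_cancel[of w "w t \<odot>\<^bsub>P\<^esub> free_gen R t"]
      by (simp add: a_minus_def[of P _ "\<ominus>\<^bsub>P\<^esub> w'"]) (simp add: w'_def P.a_comm)
    moreover have "\<ominus>\<^bsub>P\<^esub> w' \<in> carrier (free_module R B)"
      using submodule_simps(5)[OF PM free_module_submodule[OF BX, folded P_def] w'B] .
    ultimately show ?thesis using wt w(1) by (intro bexI[of _ "w t"] bexI[of _ "\<ominus>\<^bsub>P\<^esub> w'"]) auto
  qed
  then show ?thesis using BX BN by blast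
qed

lemma eventually_all_support:
  assumes "y \<in> carrier (free_module R X)" "\<And>t. \<forall>\<^sub>F k in sequentially. Q t k"
  shows "\<forall>\<^sub>F k in sequentially. \<forall>t. y t \<noteq> \<zero> \<longrightarrow> Q t k"
proof -
  have "finite {t. y t \<noteq> \<zero>}" using assms by (simp add: mem_free_module)
  then have "\<forall>\<^sub>F k in sequentially. \<forall>t \<in> {t. y t \<noteq> \<zero>}. Q t k"
    using assms(2) by (intro eventually_ball_finite) auto
  then show ?thesis by simp
qed

lemma free_support: "x \<in> carrier (free_module R X) \<Longrightarrow> x t \<noteq> \<zero> \<Longrightarrow> t \<in> X"
  by (auto simp: mem_free_module)

text \<open>The linear map to the colimit which sends the basis vector of \<open>t\<close> to the fraction \<open>w t / \<sigma>\<^sub>n\<close> with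
  \<open>n = K t\<close>, represented at level \<open>k\<close>. The vectors whose denominator has not yet occurred at level \<open>k\<close>
  are sent to zero; for each vector this happens at finitely many levels.\<close>

definition fraction_map ::
  "('a, 'd) module \<Rightarrow> (nat \<Rightarrow> 'a) \<Rightarrow> ('x \<Rightarrow> nat) \<Rightarrow> ('x \<Rightarrow> 'd) \<Rightarrow> nat \<Rightarrow> ('x \<Rightarrow> 'a) \<Rightarrow> 'd"
  where "fraction_map M s K w k =
    linear_ext R M (\<lambda>t. if K t \<le> k then segment_prod s (K t) k \<odot>\<^bsub>M\<^esub> w t else \<zero>\<^bsub>M\<^esub>)"

context
  fixes M :: "('a, 'd) module" and X :: "'x set" and s :: "nat \<Rightarrow> 'a" and K :: "'x \<Rightarrow> nat" and w :: "'x \<Rightarrow> 'd"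
  assumes M: "module R M" and s: "\<And>n. s n \<in> carrier R" and w: "\<And>t. t \<in> X \<Longrightarrow> w t \<in> carrier M"
begin

lemma fraction_map_linear: "linear_map R (free_module R X) M (fraction_map M s K w k)"
proof -
  interpret M: module R M by (rule M)
  show ?thesis unfolding fraction_map_def
    by (rule linear_ext_linear[OF M]) (use w s in auto)
qed

lemma fraction_map_gen:
  assumes "t \<in> X"
  shows "fraction_map M s K w k (free_gen R t) =
    (if K t \<le> k then segment_prod s (K t) k \<odot>\<^bsub>M\<^esub> w t else \<zero>\<^bsub>M\<^esub>)"
proof -
  interpret M: module R M by (rule M)
  show ?thesis unfolding fraction_map_def
    by (rule linear_ext_gen[OF M _ assms]) (use w s in auto)
qed

lemma fraction_map_Suc:
  assumes x: "x \<in> carrier (free_module R X)"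
  shows "\<forall>\<^sub>F k in sequentially. fraction_map M s K w (Suc k) x = s k \<odot>\<^bsub>M\<^esub> fraction_map M s K w k x"
  using eventually_all_support[OF x, where Q = "\<lambda>t k. K t \<le> k", OF eventually_ge_at_top]
proof eventually_elim
  case (elim k)
  interpret M: module R M by (rule M)
  show ?case
  proof (rule linear_map_eq_on_support[OF M fraction_map_linear _ x])
    show "linear_map R (free_module R X) M (\<lambda>x. s k \<odot>\<^bsub>M\<^esub> fraction_map M s K w k x)"
      by (intro linear_map_smultf[OF M] fraction_map_linear s)
    fix t assume "x t \<noteq> \<zero>"
    then have t: "t \<in> X" "K t \<le> k" using elim free_support[OF x] by auto
    then show "fraction_map M s K w (Suc k) (free_gen R t) = s k \<odot>\<^bsub>M\<^esub> fraction_map M s K w k (free_gen R t)"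
      using w s by (simp add: fraction_map_gen M.smult_assoc1)
  qed
qed

lemma fraction_map_in_submodule:
  assumes H: "submodule H R M" and wH: "\<And>t. t \<in> X \<Longrightarrow> w t \<in> H"
    and x: "x \<in> carrier (free_module R X)"
  shows "fraction_map M s K w k x \<in> H"
  by (rule linear_map_in_submodule_on_support[OF M fraction_map_linear H x])
    (use wH s submodule_simps[OF M H] in \<open>auto simp: fraction_map_gen free_support[OF x]\<close>)

end

text \<open>If the sequence \<open>s\<close> inverts everything outside of \<open>p\<close>, then the multipliers \<open>a\<close> in
  \<open>exists_maximal_independent\<close> can be replaced by the denominators \<open>\<sigma>\<^sub>n\<close>.\<close>

lemma exists_independent_multiples:
  fixes X :: "'x set"
  defines "P \<equiv> free_module R X"
  assumes sG: "submodule G R P" and p: "primeideal p R"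
    and s: "\<And>n. s n \<in> carrier R"
    and inv: "\<And>a. a \<in> carrier R - p \<Longrightarrow> \<exists>k. \<exists>r \<in> carrier R. segment_prod s 0 k \<ominus> r \<otimes> a \<in> p"
  obtains B K w where "B \<subseteq> X" "plus_coeffs_in p X G \<inter> carrier (free_module R B) \<subseteq> coeffs_in p X"
    "\<And>t. t \<in> X \<Longrightarrow> w t \<in> carrier (free_module R B)"
    "\<And>t. t \<in> X \<Longrightarrow> segment_prod s 0 (K t) \<odot>\<^bsub>P\<^esub> free_gen R t \<ominus>\<^bsub>P\<^esub> w t \<in> plus_coeffs_in p X G"
proof -
  interpret P: module R P unfolding P_def by (rule free_module_is_module)
  interpret p: primeideal p R by fact
  have PM: "module R P" unfolding P_def by (rule free_module_is_module)
  have I: "ideal p R" by (rule p.is_ideal)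
  note nsub = submodule_simps[OF PM plus_coeffs_in_submodule[OF I sG[unfolded P_def], folded P_def]]
  note nn = plus_coeffs_in_simps[OF I sG[unfolded P_def]]
  let ?s = "segment_prod s"
  have sc [simp]: "?s m k \<in> carrier R" for m k using s by simp
  have e: "free_gen R t \<in> carrier P" if "t \<in> X" for t using that by (simp add: P_def free_gen_closed)
  from exists_maximal_independent[OF sG[unfolded P_def] p] obtain B where
    B: "B \<subseteq> X" "plus_coeffs_in p X G \<inter> carrier (free_module R B) \<subseteq> coeffs_in p X"
    and Bw: "\<And>t. t \<in> X \<Longrightarrow> \<exists>a \<in> carrier R - p. \<exists>w \<in> carrier (free_module R B).
      a \<odot>\<^bsub>P\<^esub> free_gen R t \<ominus>\<^bsub>P\<^esub> w \<in> plus_coeffs_in p X G" unfolding P_def by blast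
  have sB: "submodule (carrier (free_module R B)) R P" unfolding P_def by (rule free_module_submodule[OF B(1)])
  note bsub = submodule_simps[OF PM sB]
  have "\<exists>k. \<exists>w \<in> carrier (free_module R B). ?s 0 k \<odot>\<^bsub>P\<^esub> free_gen R t \<ominus>\<^bsub>P\<^esub> w \<in> plus_coeffs_in p X G" if t: "t \<in> X" for t
  proof -
    from Bw[OF t] obtain a w where a: "a \<in> carrier R - p" and w: "w \<in> carrier (free_module R B)"
      "a \<odot>\<^bsub>P\<^esub> free_gen R t \<ominus>\<^bsub>P\<^esub> w \<in> plus_coeffs_in p X G" by blast
    from inv[OF a] obtain k r where r: "r \<in> carrier R" "?s 0 k \<ominus> r \<otimes> a \<in> p" by blast
    have aR: "a \<in> carrier R" using a by simp
    have 1: "(?s 0 k \<ominus> r \<otimes> a) \<odot>\<^bsub>P\<^esub> free_gen R t \<in> coeffs_in p X"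
      using P.smult_closed[OF p.Icarr[OF r(2)] e[OF t]] r(2)
      by (auto simp: coeffs_in_def P_def free_module_simps free_gen_def p.Icarr)
    have "r \<odot>\<^bsub>P\<^esub> (a \<odot>\<^bsub>P\<^esub> free_gen R t \<ominus>\<^bsub>P\<^esub> w) \<oplus>\<^bsub>P\<^esub> (?s 0 k \<ominus> r \<otimes> a) \<odot>\<^bsub>P\<^esub> free_gen R t \<in> plus_coeffs_in p X G"
      by (intro nsub(3) nsub(4) w r nn(2) 1)
    moreover have "r \<odot>\<^bsub>P\<^esub> (a \<odot>\<^bsub>P\<^esub> free_gen R t \<ominus>\<^bsub>P\<^esub> w) \<oplus>\<^bsub>P\<^esub> (?s 0 k \<ominus> r \<otimes> a) \<odot>\<^bsub>P\<^esub> free_gen R t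
      = ?s 0 k \<odot>\<^bsub>P\<^esub> free_gen R t \<ominus>\<^bsub>P\<^esub> r \<odot>\<^bsub>P\<^esub> w"
    proof -
      let ?e = "free_gen R t"
      have "(?s 0 k \<ominus> r \<otimes> a) \<odot>\<^bsub>P\<^esub> ?e = ?s 0 k \<odot>\<^bsub>P\<^esub> ?e \<ominus>\<^bsub>P\<^esub> (r \<otimes> a) \<odot>\<^bsub>P\<^esub> ?e"
        using aR r(1) e[OF t] by (simp add: a_minus_def P.smult_l_distr P.smult_l_minus)
      moreover have "r \<odot>\<^bsub>P\<^esub> (a \<odot>\<^bsub>P\<^esub> ?e \<ominus>\<^bsub>P\<^esub> w) = (r \<otimes> a) \<odot>\<^bsub>P\<^esub> ?e \<ominus>\<^bsub>P\<^esub> r \<odot>\<^bsub>P\<^esub> w"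
        using aR r(1) e[OF t] bsub(1)[OF w(1)] by (simp add: P.smult_r_diff P.smult_assoc1)
      ultimately show ?thesis
        using aR r(1) e[OF t] bsub(1)[OF w(1)] P.minus_add_minus[of "?s 0 k \<odot>\<^bsub>P\<^esub> ?e" "(r \<otimes> a) \<odot>\<^bsub>P\<^esub> ?e" "r \<odot>\<^bsub>P\<^esub> w"]
        by (simp add: P.a_comm)
    qed
    moreover have "r \<odot>\<^bsub>P\<^esub> w \<in> carrier (free_module R B)" by (rule bsub(4)[OF r(1) w(1)])
    ultimately show ?thesis by auto
  qed
  then obtain K w where "\<And>t. t \<in> X \<Longrightarrow> w t \<in> carrier (free_module R B)"
    "\<And>t. t \<in> X \<Longrightarrow> ?s 0 (K t) \<odot>\<^bsub>P\<^esub> free_gen R t \<ominus>\<^bsub>P\<^esub> w t \<in> plus_coeffs_in p X G" by metis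
  then show ?thesis using B that by blast
qed

text \<open>The colimit extension of \<open>F \<otimes> K\<close> by \<open>C\<close> splits since \<open>Ext\<^sup>1(K, C) = 0\<close>. Subtracting from
  \<open>g\<^sub>n\<close> a map \<open>v\<^sub>n\<close> on \<open>P\<close> whose values \<open>d\<^sub>n\<close> at \<open>e\<^sub>t\<close> solve \<open>d\<^sub>n = h\<^sub>n (e\<^sub>t) + s\<^sub>n d\<^sub>n\<^sub>+\<^sub>1\<close> makes all \<open>h\<^sub>n\<close> vanish. Then the vectors in \<open>B\<close> span a copy of
  \<open>F \<otimes> K\<close> in the colimit, and writing \<open>e\<^sub>t\<close> as the fraction \<open>w t / \<sigma>\<^sub>n\<close> with \<open>n = K t\<close> in the span of \<open>B\<close>
  gives the splitting \<open>\<tau>\<close>, with \<open>\<eta> = 0\<close>.\<close>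

lemma prime_tower_extends_telescopic:
  fixes C :: "('a, 'c) module" and X :: "'x set"
  defines "P \<equiv> free_module R X"
  assumes C: "module R C" and G: "locally_retract R P G" and p: "primeideal p R"
    and pC: "\<And>a x. a \<in> p \<Longrightarrow> x \<in> carrier C \<Longrightarrow> a \<odot>\<^bsub>C\<^esub> x = \<zero>\<^bsub>C\<^esub>"
    and s: "\<And>n. s n \<in> carrier R"
    and inv: "\<And>a. a \<in> carrier R - p \<Longrightarrow> \<exists>k. \<exists>r \<in> carrier R. segment_prod s 0 k \<ominus> r \<otimes> a \<in> p"
    and tel: "\<And>c. (\<And>n. c n \<in> carrier C) \<Longrightarrow>
      \<exists>d. \<forall>n. d n \<in> carrier C \<and> d n = c n \<oplus>\<^bsub>C\<^esub> s n \<odot>\<^bsub>C\<^esub> d (Suc n)"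
    and g: "\<And>n. linear_map R (P\<lparr>carrier := G\<rparr>) C (g n)"
    and h: "\<And>n. linear_map R P C (h n)"
    and gh: "\<And>n y. y \<in> G \<Longrightarrow> g n y = s n \<odot>\<^bsub>C\<^esub> g (Suc n) y \<oplus>\<^bsub>C\<^esub> h n y"
  shows "\<exists>u. linear_map R P C u \<and> (\<forall>x \<in> G. u x = g 0 x)"
proof -
  interpret C: module R C by fact
  interpret P: module R P unfolding P_def by (rule free_module_is_module)
  interpret p: primeideal p R by fact
  have PM: "module R P" unfolding P_def by (rule free_module_is_module)
  have I: "ideal p R" by (rule p.is_ideal)
  have sG: "submodule G R P" using G by (simp add: locally_retract_def)
  note sub = submodule_simps[OF PM sG]
  have sN: "submodule (plus_coeffs_in p X G) R P" by (rule plus_coeffs_in_submodule[OF I sG[unfolded P_def], folded P_def])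
  note nsub = submodule_simps[OF PM sN]
  note nn = plus_coeffs_in_simps[OF I sG[unfolded P_def]]
  let ?s = "segment_prod s"
  have sc [simp]: "?s m k \<in> carrier R" for m k using s by simp
  have e: "free_gen R t \<in> carrier P" if "t \<in> X" for t using that by (simp add: P_def free_gen_closed)
  have "\<exists>d. \<forall>n. d n \<in> carrier C \<and> d n = h n (free_gen R t) \<oplus>\<^bsub>C\<^esub> s n \<odot>\<^bsub>C\<^esub> d (Suc n)" if "t \<in> X" for t
    by (rule tel) (use linear_map_closed[OF h e[OF that]] in auto)
  then obtain d where d: "\<And>t n. t \<in> X \<Longrightarrow> d t n \<in> carrier C"
    "\<And>t n. t \<in> X \<Longrightarrow> d t n = h n (free_gen R t) \<oplus>\<^bsub>C\<^esub> s n \<odot>\<^bsub>C\<^esub> d t (Suc n)" by metis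
  define v where "v = (\<lambda>n. linear_ext R C (\<lambda>t. d t n))"
  have dX: "(\<lambda>t. d t n) \<in> X \<rightarrow> carrier C" for n using d(1) by auto
  have v: "linear_map R P C (v n)" for n unfolding v_def P_def by (rule linear_ext_linear[OF C dX])
  have v_h: "v n x = h n x \<oplus>\<^bsub>C\<^esub> s n \<odot>\<^bsub>C\<^esub> v (Suc n) x" if "x \<in> carrier P" for n x
    using that unfolding P_def
  proof (rule linear_map_free_eqI[OF C v[unfolded P_def], rotated 2])
    show "linear_map R (free_module R X) C (\<lambda>x. h n x \<oplus>\<^bsub>C\<^esub> s n \<odot>\<^bsub>C\<^esub> v (Suc n) x)"
      by (intro linear_map_addf[OF C] linear_map_smultf[OF C] h[unfolded P_def] v[unfolded P_def] s)
    fix t assume t: "t \<in> X"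
    show "v n (free_gen R t) = h n (free_gen R t) \<oplus>\<^bsub>C\<^esub> s n \<odot>\<^bsub>C\<^esub> v (Suc n) (free_gen R t)"
      unfolding v_def linear_ext_gen[OF C dX t] by (rule d(2)[OF t])
  qed
  define g' where "g' = (\<lambda>n y. g n y \<ominus>\<^bsub>C\<^esub> v n y)"
  have g': "linear_map R (P\<lparr>carrier := G\<rparr>) C (g' n)" for n unfolding g'_def
    by (rule linear_map_minusf[OF C g linear_map_restrict_domain[OF v]]) (use sub in auto)
  have g'_Suc: "g' n y = s n \<odot>\<^bsub>C\<^esub> g' (Suc n) y \<oplus>\<^bsub>C\<^esub> \<zero>\<^bsub>C\<^esub>" if y: "y \<in> G" for n y
  proof -
    have "h n y \<in> carrier C" "v n y \<in> carrier C" "v (Suc n) y \<in> carrier C"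
      "g (Suc n) y \<in> carrier C"
      by (rule linear_map_closed[OF h sub(1)[OF y]] linear_map_closed[OF v sub(1)[OF y]] linear_map_sub_simps(1)[OF g y])+
    then show ?thesis unfolding g'_def gh[OF y, of n] v_h[OF sub(1)[OF y], of n]
      using s[of n] C.add_minus_cancel_right[of "s n \<odot>\<^bsub>C\<^esub> g (Suc n) y" "s n \<odot>\<^bsub>C\<^esub> v (Suc n) y" "h n y"]
      by (simp add: C.smult_r_diff C.a_comm)
  qed
  obtain B w K where B: "B \<subseteq> X" "plus_coeffs_in p X G \<inter> carrier (free_module R B) \<subseteq> coeffs_in p X"
    and w: "\<And>t. t \<in> X \<Longrightarrow> w t \<in> carrier (free_module R B)"
      "\<And>t. t \<in> X \<Longrightarrow> ?s 0 (K t) \<odot>\<^bsub>P\<^esub> free_gen R t \<ominus>\<^bsub>P\<^esub> w t \<in> plus_coeffs_in p X G"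
    by (rule exists_independent_multiples[OF sG[unfolded P_def] p s inv, folded P_def]) (assumption | rule that)+
  have sB: "submodule (carrier (free_module R B)) R P" unfolding P_def by (rule free_module_submodule[OF B(1)])
  note bsub = submodule_simps[OF PM sB]
  have wP: "w t \<in> carrier P" if "t \<in> X" for t using w(1)[OF that] bsub(1) by simp
  define \<tau> where "\<tau> = fraction_map P s K w"
  have \<tau>: "linear_map R P P (\<tau> k)" for k unfolding \<tau>_def using fraction_map_linear[of P s X w, OF PM s wP] unfolding P_def .
  have \<tau>_gen: "\<tau> k (free_gen R t) = ?s (K t) k \<odot>\<^bsub>P\<^esub> w t" if "t \<in> X" "K t \<le> k" for t k
    unfolding \<tau>_def using fraction_map_gen[of P s X w, OF PM s wP that(1)] that(2) by simp
  have near: "\<forall>\<^sub>F k in sequentially. ?s 0 k \<odot>\<^bsub>P\<^esub> x \<ominus>\<^bsub>P\<^esub> \<tau> k x \<in> plus_coeffs_in p X G" if x: "x \<in> carrier P" for x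
    using eventually_all_support[OF x[unfolded P_def], where Q = "\<lambda>t k. K t \<le> k", OF eventually_ge_at_top]
  proof eventually_elim
    case (elim k)
    show ?case
    proof (rule linear_map_in_submodule_on_support[OF PM _ sN x[unfolded P_def]])
      show "linear_map R (free_module R X) P (\<lambda>x. ?s 0 k \<odot>\<^bsub>P\<^esub> x \<ominus>\<^bsub>P\<^esub> \<tau> k x)"
        unfolding P_def[symmetric] by (intro linear_map_minusf[OF PM] linear_map_smultf[OF PM linear_map_id] \<tau> sc)
      fix t assume "x t \<noteq> \<zero>"
      then have t: "t \<in> X" "K t \<le> k" using elim free_support[OF x[unfolded P_def]] by auto
      have "?s (K t) k \<odot>\<^bsub>P\<^esub> (?s 0 (K t) \<odot>\<^bsub>P\<^esub> free_gen R t \<ominus>\<^bsub>P\<^esub> w t) \<in> plus_coeffs_in p X G"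
        by (intro nsub(4) w t sc)
      moreover have "?s (K t) k \<odot>\<^bsub>P\<^esub> (?s 0 (K t) \<odot>\<^bsub>P\<^esub> free_gen R t \<ominus>\<^bsub>P\<^esub> w t)
        = ?s 0 k \<odot>\<^bsub>P\<^esub> free_gen R t \<ominus>\<^bsub>P\<^esub> ?s (K t) k \<odot>\<^bsub>P\<^esub> w t"
        using bsub(1)[OF w(1)[OF t(1)]] e[OF t(1)] segment_prod_mult[OF s t(2)]
        by (simp add: P.smult_r_diff P.smult_assoc1[symmetric])
      ultimately show "?s 0 k \<odot>\<^bsub>P\<^esub> free_gen R t \<ominus>\<^bsub>P\<^esub> \<tau> k (free_gen R t) \<in> plus_coeffs_in p X G"
        using \<tau>_gen[OF t] by simp
    qed
  qed
  have \<tau>B: "\<tau> k x \<in> carrier (free_module R B)" if "x \<in> carrier P" for k x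
    unfolding \<tau>_def using fraction_map_in_submodule[of P s X w, OF PM s wP sB w(1)] that unfolding P_def by blast
  have "\<exists>u. linear_map R P C u \<and> (\<forall>x \<in> G. u x = g' 0 x)"
  proof (rule tower_extends[OF C G[unfolded P_def] I pC s g'[unfolded P_def], where h = "\<lambda>n x. \<zero>\<^bsub>C\<^esub>"
        and \<tau> = \<tau> and \<eta> = "\<lambda>k x. \<zero>\<^bsub>C\<^esub>", folded P_def])
    fix x assume x: "x \<in> carrier P"
    show "\<forall>\<^sub>F k in sequentially. \<tau> (Suc k) x = s k \<odot>\<^bsub>P\<^esub> \<tau> k x"
      unfolding \<tau>_def using fraction_map_Suc[of P s X w, OF PM s wP] x unfolding P_def by blast
    show "\<forall>\<^sub>F k in sequentially. \<zero>\<^bsub>C\<^esub> = \<zero>\<^bsub>C\<^esub> \<oplus>\<^bsub>C\<^esub> \<zero>\<^bsub>C\<^esub>" by simp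
    show "\<forall>\<^sub>F k in sequentially. ?s 0 k \<odot>\<^bsub>P\<^esub> x \<ominus>\<^bsub>P\<^esub> \<tau> k x \<in> plus_coeffs_in p X G" by (rule near[OF x])
  next
    fix x assume xG: "x \<in> G"
    then have x: "x \<in> carrier P" using sub by simp
    show "\<forall>\<^sub>F k in sequentially. \<tau> k x \<in> coeffs_in p X"
      using near[OF x]
    proof eventually_elim
      case (elim k)
      have "?s 0 k \<odot>\<^bsub>P\<^esub> x \<in> plus_coeffs_in p X G" by (intro nsub(4) nn(1) xG sc)
      then have "?s 0 k \<odot>\<^bsub>P\<^esub> x \<ominus>\<^bsub>P\<^esub> (?s 0 k \<odot>\<^bsub>P\<^esub> x \<ominus>\<^bsub>P\<^esub> \<tau> k x) \<in> plus_coeffs_in p X G" using elim by (rule nsub(6))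
      then have "\<tau> k x \<in> plus_coeffs_in p X G" using x linear_map_closed[OF \<tau> x] by (simp add: P.minus_minus_cancel)
      then show ?case using \<tau>B[OF x] B by blast
    qed
  qed (rule \<tau> | rule linear_map_zerof[OF C] | erule g'_Suc | simp)+
  then obtain u where u: "linear_map R P C u" "\<And>x. x \<in> G \<Longrightarrow> u x = g' 0 x" by blast
  show ?thesis
  proof (intro exI conjI ballI)
    show "linear_map R P C (\<lambda>x. u x \<oplus>\<^bsub>C\<^esub> v 0 x)" by (rule linear_map_addf[OF C u(1) v])
    fix x assume x: "x \<in> G"
    then show "u x \<oplus>\<^bsub>C\<^esub> v 0 x = g 0 x" 
      using u(2)[OF x] linear_map_closed[OF v sub(1)[OF x]] linear_map_sub_simps(1)[OF g x]
      by (simp add: g'_def C.minus_add_cancel)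
  qed
qed

text \<open>Let \<open>G\<^sub>0\<close> be the image of \<open>\<phi>\<close>. The vectors \<open>e\<^sub>b\<close> with \<open>b \<in> B\<close> span a complement of \<open>G\<^sub>0 \<otimes> K\<close> in \<open>Q \<otimes> K\<close>, so
  the basis vector of \<open>t\<close> has a component \<open>\<phi> (z t) / \<sigma>\<^sub>n\<close> in \<open>G\<^sub>0 \<otimes> K\<close> and a component \<open>w t / \<sigma>\<^sub>n\<close> in the
  complement, where \<open>n = K t\<close>. The projection of \<open>Q\<close> to \<open>G\<^sub>0 \<otimes> K\<close> lifts to the colimit extension because
  \<open>Q\<close> is free; \<open>\<tau>\<close> and \<open>\<eta>\<close> represent the lift that sends \<open>e\<^sub>t\<close> to the class of \<open>(z t, 0)\<close> at level \<open>K t\<close>.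
  Composed with \<open>\<phi>\<close>, it splits the extension over \<open>G\<^sub>0\<close>, since the projection is the identity on \<open>G\<^sub>0\<close>.\<close>

lemma prime_tower_extends_syzygy:
  fixes C :: "('a, 'c) module" and X :: "'x set" and Y :: "'y set" and \<phi> :: "('x \<Rightarrow> 'a) \<Rightarrow> 'y \<Rightarrow> 'a"
  defines "P \<equiv> free_module R X" and "Q \<equiv> free_module R Y"
  defines "G \<equiv> {x \<in> carrier P. \<phi> x = \<zero>\<^bsub>Q\<^esub>}"
  assumes C: "module R C" and \<phi>: "linear_map R P Q \<phi>" and G0: "locally_retract R Q (\<phi> ` carrier P)"
    and p: "primeideal p R"
    and pC: "\<And>a x. a \<in> p \<Longrightarrow> x \<in> carrier C \<Longrightarrow> a \<odot>\<^bsub>C\<^esub> x = \<zero>\<^bsub>C\<^esub>"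
    and s: "\<And>n. s n \<in> carrier R"
    and inv: "\<And>a. a \<in> carrier R - p \<Longrightarrow> \<exists>k. \<exists>r \<in> carrier R. segment_prod s 0 k \<ominus> r \<otimes> a \<in> p"
    and g: "\<And>n. linear_map R (P\<lparr>carrier := G\<rparr>) C (g n)"
    and h: "\<And>n. linear_map R P C (h n)"
    and gh: "\<And>n y. y \<in> G \<Longrightarrow> g n y = s n \<odot>\<^bsub>C\<^esub> g (Suc n) y \<oplus>\<^bsub>C\<^esub> h n y"
  shows "\<exists>u. linear_map R P C u \<and> (\<forall>x \<in> G. u x = g 0 x)"
proof -
  interpret C: module R C by fact
  interpret P: module R P unfolding P_def by (rule free_module_is_module)
  interpret Q: module R Q unfolding Q_def by (rule free_module_is_module)
  interpret p: primeideal p R by fact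
  have PM: "module R P" unfolding P_def by (rule free_module_is_module)
  have QM: "module R Q" unfolding Q_def by (rule free_module_is_module)
  have I: "ideal p R" by (rule p.is_ideal)
  have sI: "submodule (\<phi> ` carrier P) R Q" using G0 by (simp add: locally_retract_def)
  have sC: "submodule (coeffs_in p Y) R Q" unfolding Q_def by (rule coeffs_in_submodule[OF I])
  note csub = submodule_simps[OF QM sC]
  have sN: "submodule (plus_coeffs_in p Y (\<phi> ` carrier P)) R Q"
    by (rule plus_coeffs_in_submodule[OF I sI[unfolded Q_def], folded Q_def])
  note nsub = submodule_simps[OF QM sN]
  note nn = plus_coeffs_in_simps[OF I sI[unfolded Q_def]]
  have G: "locally_retract R P G"
    unfolding G_def P_def Q_def by (rule locally_retract_kernel) (use \<phi> G0 in \<open>simp_all add: P_def Q_def\<close>)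
  let ?s = "segment_prod s"
  have sc [simp]: "?s m k \<in> carrier R" for m k using s by simp
  have e: "free_gen R t \<in> carrier Q" if "t \<in> Y" for t using that by (simp add: Q_def free_gen_closed)
  obtain B w K where B: "B \<subseteq> Y" "plus_coeffs_in p Y (\<phi> ` carrier P) \<inter> carrier (free_module R B) \<subseteq> coeffs_in p Y"
    and w: "\<And>t. t \<in> Y \<Longrightarrow> w t \<in> carrier (free_module R B)"
      "\<And>t. t \<in> Y \<Longrightarrow> ?s 0 (K t) \<odot>\<^bsub>Q\<^esub> free_gen R t \<ominus>\<^bsub>Q\<^esub> w t \<in> plus_coeffs_in p Y (\<phi> ` carrier P)"
    by (rule exists_independent_multiples[OF sI[unfolded Q_def] p s inv, folded Q_def]) (assumption | rule that)+
  have sB: "submodule (carrier (free_module R B)) R Q" unfolding Q_def by (rule free_module_submodule[OF B(1)])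
  have wQ: "w t \<in> carrier Q" if "t \<in> Y" for t using w(1)[OF that] submodule_simps(1)[OF QM sB] by simp
  have "\<forall>t \<in> Y. \<exists>z. z \<in> carrier P \<and> ?s 0 (K t) \<odot>\<^bsub>Q\<^esub> free_gen R t \<ominus>\<^bsub>Q\<^esub> w t \<ominus>\<^bsub>Q\<^esub> \<phi> z \<in> coeffs_in p Y"
    using w(2) unfolding plus_coeffs_in_def Q_def[symmetric] by blast
  then obtain z where z: "\<And>t. t \<in> Y \<Longrightarrow> z t \<in> carrier P"
    "\<And>t. t \<in> Y \<Longrightarrow> ?s 0 (K t) \<odot>\<^bsub>Q\<^esub> free_gen R t \<ominus>\<^bsub>Q\<^esub> w t \<ominus>\<^bsub>Q\<^esub> \<phi> (z t) \<in> coeffs_in p Y" by metis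
  define \<omega> where "\<omega> = fraction_map Q s K w"
  define \<tau> where "\<tau> = fraction_map P s K z"
  have \<omega>: "linear_map R Q Q (\<omega> k)" for k
    unfolding \<omega>_def using fraction_map_linear[of Q s Y w, OF QM s wQ] unfolding Q_def .
  have \<tau>: "linear_map R Q P (\<tau> k)" for k
    unfolding \<tau>_def using fraction_map_linear[of P s Y z, OF PM s z(1)] unfolding Q_def .
  have \<omega>_gen: "\<omega> k (free_gen R t) = ?s (K t) k \<odot>\<^bsub>Q\<^esub> w t" if "t \<in> Y" "K t \<le> k" for t k
    unfolding \<omega>_def using fraction_map_gen[of Q s Y w, OF QM s wQ that(1)] that(2) by simp
  have \<tau>_gen: "\<tau> k (free_gen R t) = ?s (K t) k \<odot>\<^bsub>P\<^esub> z t" if "t \<in> Y" "K t \<le> k" for t k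
    unfolding \<tau>_def using fraction_map_gen[of P s Y z, OF PM s z(1) that(1)] that(2) by simp
  \<comment> \<open>The element of \<open>C\<close> picked up by \<open>(z t, 0)\<close> on its way from level \<open>K t\<close> to level \<open>k\<close>.\<close>
  define \<theta> where "\<theta> = (\<lambda>t. rec_nat \<zero>\<^bsub>C\<^esub> (\<lambda>k c. if K t \<le> k then c \<oplus>\<^bsub>C\<^esub> h k (?s (K t) k \<odot>\<^bsub>P\<^esub> z t) else \<zero>\<^bsub>C\<^esub>))"
  have \<theta>_Suc: "\<theta> t (Suc k) = \<theta> t k \<oplus>\<^bsub>C\<^esub> h k (?s (K t) k \<odot>\<^bsub>P\<^esub> z t)" if "K t \<le> k" for t k
    using that by (simp add: \<theta>_def)
  have \<theta>c: "\<theta> t k \<in> carrier C" if "t \<in> Y" for t k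
    by (induction k) (use linear_map_closed[OF h P.smult_closed[OF sc z(1)[OF that]]] in \<open>auto simp: \<theta>_def\<close>)
  define \<eta> where "\<eta> = (\<lambda>k. linear_ext R C (\<lambda>t. \<theta> t k))"
  have \<theta>Y: "(\<lambda>t. \<theta> t k) \<in> Y \<rightarrow> carrier C" for k using \<theta>c by auto
  have \<eta>: "linear_map R Q C (\<eta> k)" for k unfolding \<eta>_def Q_def by (rule linear_ext_linear[OF C \<theta>Y])
  have \<eta>_gen: "\<eta> k (free_gen R t) = \<theta> t k" if "t \<in> Y" for k t
    unfolding \<eta>_def by (rule linear_ext_gen[OF C \<theta>Y that])
  have ev: "\<forall>\<^sub>F k in sequentially. \<forall>t. y t \<noteq> \<zero> \<longrightarrow> t \<in> Y \<and> K t \<le> k" if y: "y \<in> carrier Q" for y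
    using eventually_all_support[OF y[unfolded Q_def], where Q = "\<lambda>t k. K t \<le> k", OF eventually_ge_at_top]
    by eventually_elim (use free_support[OF y[unfolded Q_def]] in blast)
  have \<eta>_Suc: "\<forall>\<^sub>F k in sequentially. \<eta> (Suc k) y = \<eta> k y \<oplus>\<^bsub>C\<^esub> h k (\<tau> k y)" if y: "y \<in> carrier Q" for y
    using ev[OF y]
  proof eventually_elim
    case (elim k)
    show ?case
    proof (rule linear_map_eq_on_support[OF C \<eta>[unfolded Q_def] _ y[unfolded Q_def]])
      show "linear_map R (free_module R Y) C (\<lambda>y. \<eta> k y \<oplus>\<^bsub>C\<^esub> h k (\<tau> k y))"
        unfolding Q_def[symmetric] by (intro linear_map_addf[OF C] \<eta> linear_map_compose[OF \<tau> h])
      fix t assume "y t \<noteq> \<zero>"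
      with elim show "\<eta> (Suc k) (free_gen R t) = \<eta> k (free_gen R t) \<oplus>\<^bsub>C\<^esub> h k (\<tau> k (free_gen R t))"
        by (simp add: \<eta>_gen \<theta>_Suc \<tau>_gen)
    qed
  qed
  have approx: "\<forall>\<^sub>F k in sequentially. ?s 0 k \<odot>\<^bsub>Q\<^esub> y \<ominus>\<^bsub>Q\<^esub> \<omega> k y \<ominus>\<^bsub>Q\<^esub> \<phi> (\<tau> k y) \<in> coeffs_in p Y"
    if y: "y \<in> carrier Q" for y
    using ev[OF y]
  proof eventually_elim
    case (elim k)
    show ?case
    proof (rule linear_map_in_submodule_on_support[OF QM _ sC y[unfolded Q_def]])
      show "linear_map R (free_module R Y) Q (\<lambda>y. ?s 0 k \<odot>\<^bsub>Q\<^esub> y \<ominus>\<^bsub>Q\<^esub> \<omega> k y \<ominus>\<^bsub>Q\<^esub> \<phi> (\<tau> k y))"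
        unfolding Q_def[symmetric]
        by (intro linear_map_minusf[OF QM] linear_map_smultf[OF QM linear_map_id] \<omega> linear_map_compose[OF \<tau> \<phi>] sc)
      fix t assume "y t \<noteq> \<zero>"
      then have t: "t \<in> Y" "K t \<le> k" using elim by auto
      have "?s (K t) k \<odot>\<^bsub>Q\<^esub> (?s 0 (K t) \<odot>\<^bsub>Q\<^esub> free_gen R t \<ominus>\<^bsub>Q\<^esub> w t \<ominus>\<^bsub>Q\<^esub> \<phi> (z t)) \<in> coeffs_in p Y"
        by (intro csub(4) z t sc)
      moreover have "?s (K t) k \<odot>\<^bsub>Q\<^esub> (?s 0 (K t) \<odot>\<^bsub>Q\<^esub> free_gen R t \<ominus>\<^bsub>Q\<^esub> w t \<ominus>\<^bsub>Q\<^esub> \<phi> (z t))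
        = ?s 0 k \<odot>\<^bsub>Q\<^esub> free_gen R t \<ominus>\<^bsub>Q\<^esub> ?s (K t) k \<odot>\<^bsub>Q\<^esub> w t \<ominus>\<^bsub>Q\<^esub> \<phi> (?s (K t) k \<odot>\<^bsub>P\<^esub> z t)"
        using wQ[OF t(1)] e[OF t(1)] segment_prod_mult[OF s t(2)] linear_map_closed[OF \<phi> z(1)[OF t(1)]]
          linear_map_smult[OF \<phi> sc z(1)[OF t(1)]]
        by (simp add: Q.smult_r_diff Q.smult_assoc1[symmetric])
      ultimately show "?s 0 k \<odot>\<^bsub>Q\<^esub> free_gen R t \<ominus>\<^bsub>Q\<^esub> \<omega> k (free_gen R t) \<ominus>\<^bsub>Q\<^esub> \<phi> (\<tau> k (free_gen R t)) \<in> coeffs_in p Y"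
        using \<omega>_gen[OF t] \<tau>_gen[OF t] by simp
    qed
  qed
  have \<omega>B: "\<omega> k y \<in> carrier (free_module R B)" if "y \<in> carrier Q" for k y
    unfolding \<omega>_def using fraction_map_in_submodule[of Q s Y w, OF QM s wQ sB w(1)] that unfolding Q_def by blast
  show ?thesis
  proof (rule tower_extends[OF C G[unfolded P_def] I pC s g[unfolded P_def] h[unfolded P_def], where
        \<tau> = "\<lambda>k x. \<tau> k (\<phi> x)" and \<eta> = "\<lambda>k x. \<eta> k (\<phi> x)", folded P_def])
    show "g n y = s n \<odot>\<^bsub>C\<^esub> g (Suc n) y \<oplus>\<^bsub>C\<^esub> h n y" if "y \<in> G" for n y by (rule gh[OF that])
    show "linear_map R P P (\<lambda>x. \<tau> k (\<phi> x))" for k by (rule linear_map_compose[OF \<phi> \<tau>])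
    show "linear_map R P C (\<lambda>x. \<eta> k (\<phi> x))" for k by (rule linear_map_compose[OF \<phi> \<eta>])
  next
    fix x assume x: "x \<in> carrier P"
    have \<phi>x: "\<phi> x \<in> carrier Q" by (rule linear_map_closed[OF \<phi> x])
    show "\<forall>\<^sub>F k in sequentially. \<tau> (Suc k) (\<phi> x) = s k \<odot>\<^bsub>P\<^esub> \<tau> k (\<phi> x)"
      unfolding \<tau>_def by (rule fraction_map_Suc[of P s Y z, OF PM s z(1) \<phi>x[unfolded Q_def]])
    show "\<forall>\<^sub>F k in sequentially. \<eta> (Suc k) (\<phi> x) = \<eta> k (\<phi> x) \<oplus>\<^bsub>C\<^esub> h k (\<tau> k (\<phi> x))"
      by (rule \<eta>_Suc[OF \<phi>x])
    show "\<forall>\<^sub>F k in sequentially. ?s 0 k \<odot>\<^bsub>P\<^esub> x \<ominus>\<^bsub>P\<^esub> \<tau> k (\<phi> x) \<in> plus_coeffs_in p X G"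
      using approx[OF \<phi>x]
    proof eventually_elim
      case (elim k)
      let ?y = "\<phi> x" and ?d = "?s 0 k \<odot>\<^bsub>P\<^esub> x \<ominus>\<^bsub>P\<^esub> \<tau> k (\<phi> x)"
      have \<tau>y: "\<tau> k ?y \<in> carrier P" by (rule linear_map_closed[OF \<tau> \<phi>x])
      have \<omega>y: "\<omega> k ?y \<in> carrier Q" by (rule linear_map_closed[OF \<omega> \<phi>x])
      have \<phi>\<tau>: "\<phi> (\<tau> k ?y) \<in> carrier Q" by (rule linear_map_closed[OF \<phi> \<tau>y])
      have d: "?d \<in> carrier P" using x \<tau>y by simp
      have \<phi>d: "\<phi> ?d = ?s 0 k \<odot>\<^bsub>Q\<^esub> ?y \<ominus>\<^bsub>Q\<^esub> \<phi> (\<tau> k ?y)"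
        using x \<tau>y linear_map_minus[OF PM QM \<phi> _ \<tau>y, of "?s 0 k \<odot>\<^bsub>P\<^esub> x"] linear_map_smult[OF \<phi> sc x] by simp
      \<comment> \<open>The component of \<open>\<phi> x\<close> in the complement vanishes.\<close>
      have eq: "?s 0 k \<odot>\<^bsub>Q\<^esub> ?y \<ominus>\<^bsub>Q\<^esub> \<omega> k ?y \<ominus>\<^bsub>Q\<^esub> \<phi> (\<tau> k ?y) = \<phi> ?d \<ominus>\<^bsub>Q\<^esub> \<omega> k ?y"
        unfolding \<phi>d using \<phi>x \<omega>y \<phi>\<tau> by (simp add: a_minus_def Q.a_ac)
      have 1: "\<phi> ?d \<ominus>\<^bsub>Q\<^esub> \<omega> k ?y \<in> coeffs_in p Y" using elim unfolding eq .
      have \<phi>dQ: "\<phi> ?d \<in> carrier Q" by (rule linear_map_closed[OF \<phi> d])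
      have "\<phi> ?d \<ominus>\<^bsub>Q\<^esub> (\<phi> ?d \<ominus>\<^bsub>Q\<^esub> \<omega> k ?y) \<in> plus_coeffs_in p Y (\<phi> ` carrier P)"
        by (intro nsub(6) nn(1) nn(2) imageI d 1)
      then have "\<omega> k ?y \<in> plus_coeffs_in p Y (\<phi> ` carrier P)"
        using \<phi>dQ \<omega>y by (simp add: Q.minus_minus_cancel)
      then have "\<omega> k ?y \<in> coeffs_in p Y" using \<omega>B[OF \<phi>x] B(2) by blast
      then have "(\<phi> ?d \<ominus>\<^bsub>Q\<^esub> \<omega> k ?y) \<oplus>\<^bsub>Q\<^esub> \<omega> k ?y \<in> coeffs_in p Y" using 1 by (intro csub(3))
      then have "\<phi> ?d \<in> coeffs_in p Y" using \<phi>dQ \<omega>y by (simp add: Q.minus_add_cancel)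
      from locally_retract_image_coeffs_in[OF \<phi>[unfolded P_def Q_def] G0[unfolded P_def Q_def] I, folded P_def Q_def, OF this imageI[OF d]]
      obtain c where c: "c \<in> coeffs_in p X" "\<phi> c = \<phi> ?d" unfolding P_def by blast
      have cP: "c \<in> carrier P" using c(1) by (simp add: coeffs_in_def P_def)
      have "?d \<ominus>\<^bsub>P\<^esub> c \<in> G"
        unfolding G_def using d cP linear_map_minus[OF PM QM \<phi> d cP] c(2) \<phi>dQ by (simp add: Q.minus_self)
      moreover have "?d \<ominus>\<^bsub>P\<^esub> (?d \<ominus>\<^bsub>P\<^esub> c) = c" using d cP by (simp add: P.minus_minus_cancel)
      ultimately show "?d \<in> plus_coeffs_in p X G" using d c(1) unfolding plus_coeffs_in_def P_def[symmetric]
        by (intro CollectI conjI bexI[of _ "?d \<ominus>\<^bsub>P\<^esub> c"]) simp_all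
    qed
  next
    fix x assume "x \<in> G"
    then have "\<phi> x = \<zero>\<^bsub>Q\<^esub>" by (simp add: G_def)
    then have "\<tau> k (\<phi> x) = \<zero>\<^bsub>P\<^esub>" "\<eta> k (\<phi> x) = \<zero>\<^bsub>C\<^esub>" for k
      using linear_map_zero[OF QM PM \<tau>] linear_map_zero[OF QM C \<eta>] by simp_all
    then show "\<forall>\<^sub>F k in sequentially. \<tau> k (\<phi> x) \<in> coeffs_in p X"
      "\<forall>\<^sub>F k in sequentially. \<eta> k (\<phi> x) = \<zero>\<^bsub>C\<^esub>"
      using submodule_simps(2)[OF PM coeffs_in_submodule[OF I, of X, folded P_def]] by simp_all
  qed
qed

end

section \<open>Inverting everything outside of a prime ideal\<close>

lemma (in cring) add_cgenideal:
  assumes "ideal I R" "a \<in> carrier R"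
  shows "ideal (I <+>\<^bsub>R\<^esub> PIdl a) R" "I \<subseteq> I <+>\<^bsub>R\<^esub> PIdl a" "a \<in> I <+>\<^bsub>R\<^esub> PIdl a"
    "x \<in> I <+>\<^bsub>R\<^esub> PIdl a \<longleftrightarrow> (\<exists>y \<in> I. \<exists>r \<in> carrier R. x = y \<oplus> r \<otimes> a)"
proof -
  interpret I: ideal I R by fact
  show *: "x \<in> I <+>\<^bsub>R\<^esub> PIdl a \<longleftrightarrow> (\<exists>y \<in> I. \<exists>r \<in> carrier R. x = y \<oplus> r \<otimes> a)" for x
    by (auto simp: set_add_def' cgenideal_def)
  show "ideal (I <+>\<^bsub>R\<^esub> PIdl a) R" using assms by (intro add_ideals cgenideal_ideal)
  show "I \<subseteq> I <+>\<^bsub>R\<^esub> PIdl a"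
  proof
    fix y assume y: "y \<in> I"
    then have "y = y \<oplus> \<zero> \<otimes> a" using assms by (simp add: I.Icarr)
    then show "y \<in> I <+>\<^bsub>R\<^esub> PIdl a" unfolding * using y by blast
  qed
  have "a = \<zero> \<oplus> \<one> \<otimes> a" using assms by simp
  then show "a \<in> I <+>\<^bsub>R\<^esub> PIdl a" unfolding * using I.zero_closed by blast
qed

lemma (in cring) prime_disjoint_from_submonoid:
  assumes noeth: "noetherian_ring R" and I: "ideal I R" and S: "submonoid S R" and IS: "I \<inter> S = {}"
  obtains q where "primeideal q R" "I \<subseteq> q" "q \<inter> S = {}"
proof -
  interpret S: submonoid S R by fact
  define \<A> where "\<A> = {J. ideal J R \<and> I \<subseteq> J \<and> J \<inter> S = {}}"
  have "\<exists>M\<in>\<A>. \<forall>X\<in>\<A>. M \<subseteq> X \<longrightarrow> X = M"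
  proof (rule subset_Zorn_nonempty)
    show "\<A> \<noteq> {}" using I IS by (auto simp: \<A>_def)
    fix \<C> assume C: "\<C> \<noteq> {}" "subset.chain \<A> \<C>"
    then have "subset.chain {I. ideal I R} \<C>" by (auto simp: subset.chain_def \<A>_def)
    from noetherian_ring.ideal_chain_is_trivial[OF noeth C(1) this] C(2)
    show "\<Union>\<C> \<in> \<A>" by (auto simp: subset.chain_def)
  qed
  then obtain q where q: "ideal q R" "I \<subseteq> q" "q \<inter> S = {}" and max: "\<And>J. J \<in> \<A> \<Longrightarrow> q \<subseteq> J \<Longrightarrow> J = q"
    by (auto simp: \<A>_def)
  interpret q: ideal q R by fact
  have meets: "\<exists>s \<in> S. \<exists>y \<in> q. \<exists>r \<in> carrier R. s = y \<oplus> r \<otimes> a" if a: "a \<in> carrier R" "a \<notin> q" for a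
  proof -
    have "q <+>\<^bsub>R\<^esub> PIdl a \<notin> \<A>" using max[of "q <+>\<^bsub>R\<^esub> PIdl a"] add_cgenideal(2,3)[OF q(1) a(1)] a(2) by blast
    then have "(q <+>\<^bsub>R\<^esub> PIdl a) \<inter> S \<noteq> {}"
      using add_cgenideal(1,2)[OF q(1) a(1)] q(2) by (auto simp: \<A>_def)
    then show ?thesis using add_cgenideal(4)[OF q(1) a(1)] by blast
  qed
  have "primeideal q R"
  proof (rule primeidealI[OF q(1) is_cring])
    show "carrier R \<noteq> q" using S.one_closed q(3) by auto
    fix a b assume a: "a \<in> carrier R" and b: "b \<in> carrier R" and ab: "a \<otimes> b \<in> q"
    show "a \<in> q \<or> b \<in> q"
    proof (rule ccontr)
      assume "\<not> (a \<in> q \<or> b \<in> q)"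
      then obtain s y r s' y' r' where s: "s \<in> S" "y \<in> q" "r \<in> carrier R" "s = y \<oplus> r \<otimes> a"
        and s': "s' \<in> S" "y' \<in> q" "r' \<in> carrier R" "s' = y' \<oplus> r' \<otimes> b"
        using meets[OF a] meets[OF b] by metis
      have yR: "y \<in> carrier R" "y' \<in> carrier R" using s s' q.Icarr by auto
      have "s \<otimes> s' = y \<otimes> s' \<oplus> ((r \<otimes> a) \<otimes> y' \<oplus> (r \<otimes> r') \<otimes> (a \<otimes> b))"
        unfolding s(4) s'(4) using a b s(3) s'(3) yR by algebra
      also have "\<dots> \<in> q"
        using a b s(3) s'(3) S.subset s'(1)
        by (intro q.a_closed q.I_r_closed[OF s(2)] q.I_l_closed[OF s'(2)] q.I_l_closed[OF ab]) auto
      finally show False using q(3) S.m_closed[OF s(1) s'(1)] by blast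
    qed
  qed
  then show ?thesis using q that by blast
qed

text \<open>The multiplicative set is generated by one element of \<open>q - p\<close> for each prime ideal \<open>q\<close> strictly above
  \<open>p\<close>. If \<open>p + Ra\<close> missed it, then so would a prime ideal above \<open>p + Ra\<close>, which is absurd. The sequence
  runs through each element infinitely often, so that the elements of the set are invertible in the
  colimit and not only at its first level.\<close>

lemma (in cring) exists_inverting_sequence:
  assumes noeth: "noetherian_ring R" and count: "countable (Spec R)" and p: "primeideal p R"
  obtains s :: "nat \<Rightarrow> 'a" where "submonoid (range s) R" "range s \<inter> p = {}"
    "\<And>n. infinite {m. s m = s n}"
    "\<And>a. a \<in> carrier R - p \<Longrightarrow> \<exists>k. \<exists>r \<in> carrier R. segment_prod s 0 k \<ominus> r \<otimes> a \<in> p"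
proof -
  interpret p: primeideal p R by fact
  define T where "T = {q \<in> Spec R. p \<subset> q}"
  have "\<forall>q \<in> T. \<exists>x. x \<in> q - p" unfolding T_def by blast
  then obtain x where x: "\<And>q. q \<in> T \<Longrightarrow> x q \<in> q - p" by metis
  have xR: "x q \<in> carrier R" if "q \<in> T" for q
  proof -
    have "ideal q R" using that by (auto simp: T_def Spec_def primeideal_def)
    then show ?thesis using x[OF that] ideal.Icarr by fastforce
  qed
  define mul where "mul = (\<lambda>l. foldr (\<otimes>) l \<one>)"
  define S where "S = mul ` lists (x ` T)"
  have "countable T" unfolding T_def by (rule countable_subset[OF _ count]) auto
  then have "countable S" unfolding S_def by (intro countable_image countable_lists)
  have mul: "mul l \<in> carrier R" if "l \<in> lists (x ` T)" for l
    using that by (induction l) (use xR in \<open>auto simp: mul_def\<close>)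
  have app: "mul (l @ l') = mul l \<otimes> mul l'" if "l \<in> lists (x ` T)" "l' \<in> lists (x ` T)" for l l'
    using that(1)
  proof (induction l)
    case Nil
    then show ?case using mul[OF that(2)] by (simp add: mul_def)
  next
    case (Cons y l)
    have "mul l \<in> carrier R" "mul l' \<in> carrier R" using mul Cons that by auto
    moreover have "y \<in> carrier R" using Cons xR by auto
    ultimately show ?case using Cons by (simp add: mul_def m_assoc)
  qed
  have S: "submonoid S R"
  proof
    show "S \<subseteq> carrier R" using mul by (auto simp: S_def)
    show "\<one> \<in> S" unfolding S_def by (rule image_eqI[of _ _ "[]"]) (simp_all add: mul_def)
    fix a b assume "a \<in> S" "b \<in> S"
    then obtain l l' where "a = mul l" "b = mul l'" "l \<in> lists (x ` T)" "l' \<in> lists (x ` T)" by (auto simp: S_def)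
    then show "a \<otimes> b \<in> S" unfolding S_def using app[of l l'] by (intro image_eqI[of _ _ "l @ l'"]) auto
  qed
  have "\<one> \<notin> p" using p.one_imp_carrier p.I_notcarr by auto
  have "mul l \<notin> p" if "l \<in> lists (x ` T)" for l using that
  proof (induction l)
    case Nil
    show ?case using \<open>\<one> \<notin> p\<close> by (simp add: mul_def)
  next
    case (Cons y l)
    have "mul l \<in> carrier R" using mul Cons by auto
    moreover have "y \<in> carrier R" "y \<notin> p" using Cons xR x by auto
    ultimately have "y \<otimes> mul l \<notin> p" using Cons p.I_prime by blast
    then show ?case by (simp add: mul_def)
  qed
  then have Sp: "S \<inter> p = {}" by (auto simp: S_def)
  have meets: "\<exists>t \<in> S. \<exists>r \<in> carrier R. t \<ominus> r \<otimes> a \<in> p" if a: "a \<in> carrier R - p" for a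
  proof -
    have aR: "a \<in> carrier R" using a by simp
    note ga = add_cgenideal[OF p.is_ideal aR]
    have "(p <+>\<^bsub>R\<^esub> PIdl a) \<inter> S \<noteq> {}"
    proof
      assume "(p <+>\<^bsub>R\<^esub> PIdl a) \<inter> S = {}"
      from prime_disjoint_from_submonoid[OF noeth ga(1) S this] obtain q where
        q: "primeideal q R" "p <+>\<^bsub>R\<^esub> PIdl a \<subseteq> q" "q \<inter> S = {}" by blast
      have "p \<subset> q" using q(2) ga(2,3) a by blast
      then have qT: "q \<in> T" using q(1) by (simp add: T_def Spec_def)
      have "x q \<in> S" unfolding S_def
        by (rule image_eqI[of _ _ "[x q]"]) (use xR[OF qT] qT in \<open>auto simp: mul_def\<close>)
      then show False using x[OF qT] q(3) by blast
    qed
    then obtain t y r where t: "t \<in> S" "y \<in> p" "r \<in> carrier R" "t = y \<oplus> r \<otimes> a" using ga(4) by blast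
    have "y \<in> carrier R" using t(2) p.Icarr by simp
    then have "t \<ominus> r \<otimes> a = y" unfolding t(4) using t(3) aR by algebra
    then show ?thesis using t(1,2,3) by (intro bexI[of _ t] bexI[of _ r]) simp_all
  qed
  have Sne: "S \<noteq> {}" using S submonoid.one_closed by blast
  define s where "s = (\<lambda>n. from_nat_into S (fst (prod_decode n)))"
  have s_enc: "s (prod_encode (i, j)) = from_nat_into S i" for i j by (simp add: s_def)
  have range: "range s = S"
  proof -
    have "from_nat_into S i \<in> range s" for i using s_enc[of i 0] rangeI[of s "prod_encode (i, 0)"] by simp
    then have "range s = range (from_nat_into S)" unfolding s_def by blast
    then show ?thesis using Sne \<open>countable S\<close> by (simp add: range_from_nat_into)
  qed
  have sR: "s n \<in> carrier R" for n using range submonoid.subset[OF S] by blast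
  show ?thesis
  proof (rule that)
    show "submonoid (range s) R" "range s \<inter> p = {}" using S Sp range by auto
    show "infinite {m. s m = s n}" for n
    proof -
      have "range (\<lambda>j. prod_encode (fst (prod_decode n), j)) \<subseteq> {m. s m = s n}" 
        using s_enc by (auto simp: s_def)
      moreover have "infinite (range (\<lambda>j. prod_encode (fst (prod_decode n), j)))"
        by (rule range_inj_infinite) (auto simp: inj_on_def prod_encode_eq)
      ultimately show ?thesis using infinite_super by blast
    qed
    fix a assume a: "a \<in> carrier R - p"
    from meets[OF a] obtain t r where t: "t \<in> S" "r \<in> carrier R" "t \<ominus> r \<otimes> a \<in> p" by blast
    then obtain j where j: "t = s j" using range by blast
    let ?\<sigma> = "segment_prod s 0 j"
    have \<sigma>: "?\<sigma> \<in> carrier R" using sR by simp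
    have aR: "a \<in> carrier R" using a by simp
    \<comment> \<open>\<open>\<sigma>\<^sub>j\<^sub>+\<^sub>1\<close> is a multiple of \<open>t = s\<^sub>j\<close>.\<close>
    have "segment_prod s 0 (Suc j) \<ominus> (?\<sigma> \<otimes> r) \<otimes> a = ?\<sigma> \<otimes> (s j \<ominus> r \<otimes> a)"
      using sR[of j] \<sigma> aR t(2) by simp algebra
    also have "\<dots> \<in> p" using t(3) \<sigma> by (simp add: j p.I_l_closed)
    finally show "\<exists>k. \<exists>r \<in> carrier R. segment_prod s 0 k \<ominus> r \<otimes> a \<in> p"
      using \<sigma> t(2) by (intro exI[of _ "Suc j"] bexI[of _ "?\<sigma> \<otimes> r"]) auto
  qed
qed

section \<open>Telescopic systems of equations\<close>

text \<open>If \<open>s\<close> runs through a multiplicative set \<open>S\<close>, and infinitely often through each element, then \<open>S\<^sup>-\<^sup>1R\<close>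
  has the presentation with generators \<open>e\<^sub>n\<close> and independent relations \<open>e\<^sub>n = s\<^sub>n e\<^sub>n\<^sub>+\<^sub>1\<close>. So the equations
  express that \<open>Ext\<^sup>1(S\<^sup>-\<^sup>1R, C) = 0\<close>.\<close>

definition telescopic :: "('r, 'm) ring_scheme \<Rightarrow> ('r, 'c) module \<Rightarrow> bool"
  where "telescopic R C \<longleftrightarrow>
    (\<forall>s c. submonoid (range s) R \<and> (\<forall>n. infinite {m. s m = s n}) \<and> (\<forall>n::nat. c n \<in> carrier C) \<longrightarrow>
      (\<exists>d. \<forall>n. d n \<in> carrier C \<and> d n = c n \<oplus>\<^bsub>C\<^esub> s n \<odot>\<^bsub>C\<^esub> d (Suc n)))"

lemma telescopic_image:
  assumes C: "module R C" and Q: "module R Q" and f: "linear_map R C Q f"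
    and onto: "f ` carrier C = carrier Q" and tel: "telescopic R C"
  shows "telescopic R Q"
  unfolding telescopic_def
proof (intro allI impI)
  interpret C: module R C by fact
  fix s :: "nat \<Rightarrow> 'a" and c :: "nat \<Rightarrow> 'd"
  assume s: "submonoid (range s) R \<and> (\<forall>n. infinite {m. s m = s n}) \<and> (\<forall>n. c n \<in> carrier Q)"
  then have "\<forall>n. \<exists>b. b \<in> carrier C \<and> f b = c n" using onto by (metis imageE)
  then obtain b where b: "\<And>n. b n \<in> carrier C" "\<And>n. f (b n) = c n" by metis
  then obtain d where d: "\<And>n. d n \<in> carrier C" "\<And>n. d n = b n \<oplus>\<^bsub>C\<^esub> s n \<odot>\<^bsub>C\<^esub> d (Suc n)"
    using tel s unfolding telescopic_def by metis
  have sR: "s n \<in> carrier R" for n using s submonoid.subset by blast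
  have fd:  "f (d n) = c n \<oplus>\<^bsub>Q\<^esub> s n \<odot>\<^bsub>Q\<^esub> f (d (Suc n))" for n
    by (subst d(2)) (simp add: linear_map_add[OF f] linear_map_smult[OF f] b d(1) sR)
  show "\<exists>d. \<forall>n. d n \<in> carrier Q \<and> d n = c n \<oplus>\<^bsub>Q\<^esub> s n \<odot>\<^bsub>Q\<^esub> d (Suc n)"
    using linear_map_closed[OF f d(1)] by (intro exI[of _ "\<lambda>n. f (d n)"] allI conjI fd)
qed

section \<open>Noetherian induction on the annihilator\<close>

definition annihilator :: "('r, 'm) ring_scheme \<Rightarrow> ('r, 'c) module \<Rightarrow> 'r set"
  where "annihilator R C = {r \<in> carrier R. \<forall>x \<in> carrier C. r \<odot>\<^bsub>C\<^esub> x = \<zero>\<^bsub>C\<^esub>}"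

lemma annihilatorI:
  "r \<in> carrier R \<Longrightarrow> (\<And>x. x \<in> carrier C \<Longrightarrow> r \<odot>\<^bsub>C\<^esub> x = \<zero>\<^bsub>C\<^esub>) \<Longrightarrow> r \<in> annihilator R C"
  by (simp add: annihilator_def)

lemma annihilatorD: "r \<in> annihilator R C \<Longrightarrow> x \<in> carrier C \<Longrightarrow> r \<odot>\<^bsub>C\<^esub> x = \<zero>\<^bsub>C\<^esub>"
  by (simp add: annihilator_def)

lemma annihilator_ideal:
  assumes "module R C" shows "ideal (annihilator R C) R"
proof -
  interpret C: module R C by fact
  show ?thesis
  proof (rule idealI)
    show "ring R" by (rule C.ring_axioms)
    show "subgroup (annihilator R C) (add_monoid R)"
    proof (rule C.R.add.subgroupI)
      show "annihilator R C \<noteq> {}" using C.smult_l_null by (auto simp: annihilator_def)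
    qed (auto simp: annihilator_def C.smult_l_minus C.smult_l_distr a_inv_def[symmetric])
  qed (auto simp: annihilator_def C.smult_assoc1 C.smult_commute C.R.m_comm)
qed

lemma smult_linear:
  assumes "module R C" "a \<in> carrier R"
  shows "linear_map R C C (\<lambda>x. a \<odot>\<^bsub>C\<^esub> x)"
  by (rule linear_map_smultf[OF assms(1) linear_map_id assms(2)])

lemma annihilator_submodule:
  "submodule H R C \<Longrightarrow> module R C \<Longrightarrow> annihilator R C \<subseteq> annihilator R (C\<lparr>carrier := H\<rparr>)"
  using submodule_simps(1) by (fastforce simp: annihilator_def)

lemma annihilator_quotient:
  assumes "module R C" "module R Q" "linear_map R C Q f" "f ` carrier C = carrier Q"
  shows "annihilator R C \<subseteq> annihilator R Q"
proof
  fix r assume r: "r \<in> annihilator R C"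
  have "r \<odot>\<^bsub>Q\<^esub> f y = \<zero>\<^bsub>Q\<^esub>" if y: "y \<in> carrier C" for y
    using r y linear_map_smult[OF assms(3) _ y, of r] linear_map_zero[OF assms(1,2,3)]
    by (simp add: annihilator_def)
  then show "r \<in> annihilator R Q" using r by (auto simp: annihilator_def assms(4)[symmetric])
qed

lemma noetherian_annihilator_induct [consumes 3, case_names less]:
  fixes C :: "('r, 'c) module"
  assumes noeth: "noetherian_ring R" and C: "module R C" and E: "E C"
    and step: "\<And>C :: ('r, 'c) module. module R C \<Longrightarrow> E C \<Longrightarrow>
      (\<And>Q :: ('r, 'c) module. module R Q \<Longrightarrow> E Q \<Longrightarrow> annihilator R C \<subset> annihilator R Q \<Longrightarrow> S Q) \<Longrightarrow> S C"
  shows "S C"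
proof (rule ccontr)
  assume "\<not> S C"
  define \<A> where "\<A> = {annihilator R C | C :: ('r, 'c) module. module R C \<and> E C \<and> \<not> S C}"
  have "\<exists>M\<in>\<A>. \<forall>X\<in>\<A>. M \<subseteq> X \<longrightarrow> X = M"
  proof (rule subset_Zorn_nonempty)
    show "\<A> \<noteq> {}" using C E \<open>\<not> S C\<close> by (auto simp: \<A>_def)
    fix \<C> assume ch: "\<C> \<noteq> {}" "subset.chain \<A> \<C>"
    have "\<A> \<subseteq> {I. ideal I R}" using annihilator_ideal by (auto simp: \<A>_def)
    then have "subset.chain {I. ideal I R} \<C>" using ch by (auto simp: subset.chain_def)
    from noetherian_ring.ideal_chain_is_trivial[OF noeth ch(1) this] ch(2)
    show "\<Union>\<C> \<in> \<A>" by (auto simp: subset.chain_def)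
  qed
  then obtain D where D: "module R D" "E D" "\<not> S D"
    and max: "\<And>X. X \<in> \<A> \<Longrightarrow> annihilator R D \<subseteq> X \<Longrightarrow> X = annihilator R D"
    by (auto simp: \<A>_def)
  have "S Q" if "module R Q" "E Q" "annihilator R D \<subset> annihilator R Q" for Q
    using max[of "annihilator R Q"] that by (auto simp: \<A>_def)
  then show False using step D by blast
qed

context cring
begin

text \<open>The induction reduces the extension property, for all submodules in \<open>\<G>\<close> and all modules in a class \<open>E\<close>
  closed under quotients, to modules with prime annihilator. The class contains \<open>aC\<close> along with \<open>C\<close>,
  because \<open>aC\<close> is a quotient of \<open>C\<close>.\<close>

lemma noetherian_devissage:
  fixes C :: "('a, 'c) module" and X :: "'x set"
  defines "P \<equiv> free_module R X"
  assumes noeth: "noetherian_ring R" and C: "module R C" and E: "E C"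
    and E_image: "\<And>(C :: ('a, 'c) module) (Q :: ('a, 'c) module) f. module R C \<Longrightarrow> module R Q \<Longrightarrow> E C \<Longrightarrow>
      linear_map R C Q f \<Longrightarrow> f ` carrier C = carrier Q \<Longrightarrow> E Q"
    and sub: "\<And>G. G \<in> \<G> \<Longrightarrow> submodule G R P"
    and prime: "\<And>C :: ('a, 'c) module. module R C \<Longrightarrow> E C \<Longrightarrow> primeideal (annihilator R C) R \<Longrightarrow>
      (\<And>(Q :: ('a, 'c) module) G. module R Q \<Longrightarrow> E Q \<Longrightarrow> annihilator R C \<subset> annihilator R Q \<Longrightarrow>
         G \<in> \<G> \<Longrightarrow> homs_extend R P G Q) \<Longrightarrow>
      (\<And>G. G \<in> \<G> \<Longrightarrow> homs_extend R P G C)"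
  shows "\<forall>G \<in> \<G>. homs_extend R P G C"
  using noeth C E
proof (induction C rule: noetherian_annihilator_induct)
  case (less C)
  interpret C: module R C by (rule less)
  interpret P: module R P unfolding P_def by (rule free_module_is_module)
  interpret I: ideal "annihilator R C" R by (rule annihilator_ideal[OF less(1)])
  show ?case
  proof (cases "primeideal (annihilator R C) R")
    case True
    then show ?thesis using prime less by blast
  next
    case not_prime: False
    show ?thesis
    proof (cases "annihilator R C = carrier R")
      case True
      have "x = \<zero>\<^bsub>C\<^esub>" if x: "x \<in> carrier C" for x
      proof -
        have "\<one> \<in> annihilator R C" using True by simp
        then have "\<one> \<odot>\<^bsub>C\<^esub> x = \<zero>\<^bsub>C\<^esub>" using x by (simp only: annihilator_def mem_Collect_eq) 
        then show ?thesis using x by simp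
      qed
      then show ?thesis using linear_map_zerof[OF less(1), of P] linear_map_sub_simps(1)
        unfolding homs_extend_def by metis
    next
      case False
      then obtain a b where a: "a \<in> carrier R" "a \<notin> annihilator R C" and b: "b \<in> carrier R" "b \<notin> annihilator R C"
        and ab: "a \<otimes> b \<in> annihilator R C"
        using not_prime primeidealI[OF I.is_ideal is_cring] by blast
      \<comment> \<open>\<open>C\<close> is an extension of \<open>C / aC\<close> by \<open>aC\<close>, and these are killed by \<open>a\<close> and by \<open>b\<close>.\<close>
      have lin: "linear_map R C C (\<lambda>x. a \<odot>\<^bsub>C\<^esub> x)" by (rule smult_linear[OF less(1) a(1)])
      let ?H = "(\<lambda>x. a \<odot>\<^bsub>C\<^esub> x) ` carrier C"
      have H: "submodule ?H R C" by (rule linear_map_image[OF less(1,1) lin])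
      obtain Q :: "('a, 'c) module" and \<pi> where Q: "module R Q" and \<pi>: "linear_map R C Q \<pi>"
        and onto: "\<pi> ` carrier C = carrier Q" and ker: "{x \<in> carrier C. \<pi> x = \<zero>\<^bsub>Q\<^esub>} = ?H"
        using quotient_on_same_type[OF less(1) H] by blast
      let ?D = "C\<lparr>carrier := ?H\<rparr>"
      have D: "module R ?D" by (rule submodule_carrier_module[OF less(1) H])
      have linD: "linear_map R C ?D (\<lambda>x. a \<odot>\<^bsub>C\<^esub> x)" by (rule linear_map_restrict_codomain[OF lin]) simp
      have "a \<in> annihilator R Q"
      proof -
        have "a \<odot>\<^bsub>Q\<^esub> \<pi> x = \<zero>\<^bsub>Q\<^esub>" if "x \<in> carrier C" for x
        proof -
          have "a \<odot>\<^bsub>C\<^esub> x \<in> {x \<in> carrier C. \<pi> x = \<zero>\<^bsub>Q\<^esub>}" unfolding ker using that by simp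
          then show ?thesis using linear_map_smult[OF \<pi> a(1) that] by simp
        qed
        then show ?thesis using a(1) unfolding annihilator_def onto[symmetric] by blast
      qed
      then have 1: "annihilator R C \<subset> annihilator R Q"
        using annihilator_quotient[OF less(1) Q \<pi> onto] a(2) by blast
      have "b \<odot>\<^bsub>C\<^esub> (a \<odot>\<^bsub>C\<^esub> x) = \<zero>\<^bsub>C\<^esub>" if "x \<in> carrier C" for x
      proof -
        have "(a \<otimes> b) \<odot>\<^bsub>C\<^esub> x = \<zero>\<^bsub>C\<^esub>" by (rule annihilatorD[OF ab that])
        then show ?thesis
          unfolding C.smult_assoc1[OF a(1) b(1) that] C.smult_commute[OF a(1) b(1) that] .
      qed
      then have "b \<in> annihilator R ?D" by (intro annihilatorI[OF b(1)]) (simp, elim imageE, simp only:)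
      then have 2: "annihilator R C \<subset> annihilator R ?D"
        using annihilator_submodule[OF H less(1)] b(2) by blast
      have EQ: "E Q" by (rule E_image[OF less(1) Q less(2) \<pi> onto])
      have ED: "E ?D" by (rule E_image[OF less(1) D less(2) linD]) simp
      show ?thesis
      proof
        fix G assume G: "G \<in> \<G>"
        show "homs_extend R P G C" unfolding P_def
          by (rule homs_extend_extension[OF less(1) Q \<pi> onto sub[OF G, unfolded P_def]])
            (use less(3)[OF Q EQ 1] less(3)[OF D ED 2] G ker in \<open>simp_all add: P_def\<close>)
      qed
    qed
  qed
qed

lemma linear_map_factor:
  assumes M: "module R M" and N: "module R N" and C: "module R C"
    and f: "linear_map R M N f" and k: "linear_map R M C k"
    and ker: "\<And>x. x \<in> carrier M \<Longrightarrow> f x = \<zero>\<^bsub>N\<^esub> \<Longrightarrow> k x = \<zero>\<^bsub>C\<^esub>"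
  obtains g where "linear_map R (N\<lparr>carrier := f ` carrier M\<rparr>) C g"
    "\<And>x. x \<in> carrier M \<Longrightarrow> g (f x) = k x"
proof -
  interpret M: module R M by fact
  interpret N: module R N by fact
  interpret C: module R C by fact
  have eq: "k x = k y" if "x \<in> carrier M" "y \<in> carrier M" "f x = f y" for x y
  proof -
    have "f (x \<ominus>\<^bsub>M\<^esub> y) = \<zero>\<^bsub>N\<^esub>" using that linear_map_closed[OF f] by (simp add: linear_map_minus[OF M N f] N.minus_self)
    then have "k x \<ominus>\<^bsub>C\<^esub> k y = \<zero>\<^bsub>C\<^esub>" using ker[of "x \<ominus>\<^bsub>M\<^esub> y"] that by (simp add: linear_map_minus[OF M C k])
    then show ?thesis by (rule C.minus_eq_zeroD[OF linear_map_closed[OF k that(1)] linear_map_closed[OF k that(2)]])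
  qed
  define g where "g = (\<lambda>y. k (SOME x. x \<in> carrier M \<and> f x = y))"
  have g: "g (f x) = k x" if "x \<in> carrier M" for x
  proof -
    have "(SOME z. z \<in> carrier M \<and> f z = f x) \<in> carrier M \<and> f (SOME z. z \<in> carrier M \<and> f z = f x) = f x"
      by (rule someI[of _ x]) (use that in auto)
    then show ?thesis unfolding g_def by (intro eq) (use that in auto)
  qed
  have "linear_map R (N\<lparr>carrier := f ` carrier M\<rparr>) C g"
  proof (rule linear_mapI)
    fix x assume "x \<in> carrier (N\<lparr>carrier := f ` carrier M\<rparr>)"
    then show "g x \<in> carrier C" using g linear_map_closed[OF k] by auto
  next
    fix x y assume "x \<in> carrier (N\<lparr>carrier := f ` carrier M\<rparr>)" "y \<in> carrier (N\<lparr>carrier := f ` carrier M\<rparr>)"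
    then obtain a b where "x = f a" "y = f b" "a \<in> carrier M" "b \<in> carrier M" by auto
    then show "g (x \<oplus>\<^bsub>N\<lparr>carrier := f ` carrier M\<rparr>\<^esub> y) = g x \<oplus>\<^bsub>C\<^esub> g y"
      using g[of "a \<oplus>\<^bsub>M\<^esub> b"] g[of a] g[of b] by (simp add: linear_map_add[OF f] linear_map_add[OF k])
  next
    fix r x assume "r \<in> carrier R" "x \<in> carrier (N\<lparr>carrier := f ` carrier M\<rparr>)"
    then obtain a where "x = f a" "a \<in> carrier M" "r \<in> carrier R" by auto
    then show "g (r \<odot>\<^bsub>N\<lparr>carrier := f ` carrier M\<rparr>\<^esub> x) = r \<odot>\<^bsub>C\<^esub> g x"
      using g[of "r \<odot>\<^bsub>M\<^esub> a"] g[of a] by (simp add: linear_map_smult[OF f] linear_map_smult[OF k])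
  qed
  then show ?thesis using g that by blast
qed

text \<open>Surjectivity of multiplication by \<open>a\<close> on \<open>Ext\<^sup>1(P / G, C)\<close>, where \<open>G\<close> is the image of \<open>\<psi>\<close>. With
  \<open>Ext\<^sup>1(P / G, C / aC) = 0\<close> one reduces to maps from \<open>G\<close> to \<open>aC\<close>. To divide such a map by \<open>a\<close>, pull it back to
  the free module \<open>L\<close>, where there is a lift \<open>l\<close> along multiplication by \<open>a\<close>. The lift need not vanish
  on the kernel of \<open>\<psi>\<close>, but there it has values killed by \<open>a\<close>; this obstruction, which lies in
  \<open>Ext\<^sup>2(P / G, {c. ac = 0})\<close>, is removed by the second extension property.\<close>

lemma hom_divisible_mod_extendable:
  fixes C :: "('a, 'c) module" and X :: "'x set" and Z :: "'z set"
  defines "P \<equiv> free_module R X" and "L \<equiv> free_module R Z"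
  assumes C: "module R C" and Q: "module R Q" and \<pi>: "linear_map R C Q \<pi>"
    and onto: "\<pi> ` carrier C = carrier Q"
    and ker: "{x \<in> carrier C. \<pi> x = \<zero>\<^bsub>Q\<^esub>} = (\<lambda>x. a \<odot>\<^bsub>C\<^esub> x) ` carrier C"
    and a: "a \<in> carrier R" and \<psi>: "linear_map R L P \<psi>"
    and ext1: "homs_extend R P (\<psi> ` carrier L) Q"
    and ext2: "homs_extend R L {x \<in> carrier L. \<psi> x = \<zero>\<^bsub>P\<^esub>}
      (C\<lparr>carrier := {x \<in> carrier C. a \<odot>\<^bsub>C\<^esub> x = \<zero>\<^bsub>C\<^esub>}\<rparr>)"
    and g: "linear_map R (P\<lparr>carrier := \<psi> ` carrier L\<rparr>) C g"
  shows "\<exists>g' h. linear_map R (P\<lparr>carrier := \<psi> ` carrier L\<rparr>) C g' \<and> linear_map R P C h \<and>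
    (\<forall>y \<in> \<psi> ` carrier L. g y = a \<odot>\<^bsub>C\<^esub> g' y \<oplus>\<^bsub>C\<^esub> h y)"
proof -
  interpret C: module R C by fact
  interpret Q: module R Q by fact
  have PM: "module R P" unfolding P_def by (rule free_module_is_module)
  have LM: "module R L" unfolding L_def by (rule free_module_is_module)
  interpret L: module R L by fact
  have sG: "submodule (\<psi> ` carrier L) R P" by (rule linear_map_image[OF LM PM \<psi>])
  note sub = submodule_simps[OF PM sG]
  \<comment> \<open>Modulo \<open>aC\<close> the map extends, and this reduces to a map into \<open>aC\<close>.\<close>
  from ext1 linear_map_compose[OF g \<pi>] obtain k where k: "linear_map R P Q k"
    "\<And>y. y \<in> \<psi> ` carrier L \<Longrightarrow> k y = \<pi> (g y)" unfolding homs_extend_def by blast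
  have "k (free_gen R t) \<in> \<pi> ` carrier C" if "t \<in> X" for t
    unfolding onto using linear_map_closed[OF k(1)] free_gen_closed[OF that] by (simp add: P_def)
  from free_module_lift[OF C Q \<pi> k(1)[unfolded P_def] this] obtain h where
    h: "linear_map R P C h" "\<And>x. x \<in> carrier P \<Longrightarrow> \<pi> (h x) = k x" unfolding P_def by metis
  define d where "d = (\<lambda>x. g (\<psi> x) \<ominus>\<^bsub>C\<^esub> h (\<psi> x))"
  have \<psi>G: "linear_map R L (P\<lparr>carrier := \<psi> ` carrier L\<rparr>) \<psi>" by (rule linear_map_restrict_codomain[OF \<psi>]) simp
  have d: "linear_map R L C d" unfolding d_def
    by (intro linear_map_minusf[OF C] linear_map_compose[OF \<psi>G g] linear_map_compose[OF \<psi> h(1)])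
  have gc: "g (\<psi> x) \<in> carrier C" and hc: "h (\<psi> x) \<in> carrier C" if "x \<in> carrier L" for x
    using that linear_map_sub_simps(1)[OF g] linear_map_closed[OF h(1) linear_map_closed[OF \<psi>]] by auto
  have "d (free_gen R t) \<in> (\<lambda>x. a \<odot>\<^bsub>C\<^esub> x) ` carrier C" if t: "t \<in> Z" for t
  proof -
    have e: "free_gen R t \<in> carrier L" using free_gen_closed[OF t] by (simp add: L_def)
    then have "\<pi> (d (free_gen R t)) = \<pi> (g (\<psi> (free_gen R t))) \<ominus>\<^bsub>Q\<^esub> \<pi> (h (\<psi> (free_gen R t)))"
      unfolding d_def by (intro linear_map_minus[OF C Q \<pi>] gc hc)
    also have "\<dots> = \<zero>\<^bsub>Q\<^esub>"
      using k(2)[of "\<psi> (free_gen R t)"] h(2)[OF linear_map_closed[OF \<psi> e]] e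
        linear_map_closed[OF \<pi> gc[OF e]] by (simp add: Q.minus_self)
    finally show ?thesis using linear_map_closed[OF d e] unfolding ker[symmetric] by simp
  qed
  \<comment> \<open>A map into \<open>aC\<close> is divided by \<open>a\<close> on \<open>L\<close>; the choice is corrected to descend to the image.\<close>
  from free_module_lift[OF C C smult_linear[OF C a] d[unfolded L_def] this] obtain l where
    l: "linear_map R L C l" "\<And>x. x \<in> carrier L \<Longrightarrow> a \<odot>\<^bsub>C\<^esub> l x = d x" unfolding L_def by metis
  let ?K = "{x \<in> carrier L. \<psi> x = \<zero>\<^bsub>P\<^esub>}" and ?A = "{x \<in> carrier C. a \<odot>\<^bsub>C\<^esub> x = \<zero>\<^bsub>C\<^esub>}"
  have A: "submodule ?A R C" by (rule linear_map_kernel[OF C C smult_linear[OF C a]])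
  have "linear_map R (L\<lparr>carrier := ?K\<rparr>) (C\<lparr>carrier := ?A\<rparr>) l"
  proof (rule linear_map_restrict_codomain[OF linear_map_restrict_domain[OF l(1)]])
    fix x assume "x \<in> carrier (L\<lparr>carrier := ?K\<rparr>)"
    then have x: "x \<in> carrier L" "\<psi> x = \<psi> \<zero>\<^bsub>L\<^esub>" using linear_map_zero[OF LM PM \<psi>] by auto
    have "d x = d \<zero>\<^bsub>L\<^esub>" unfolding d_def x(2) ..
    then show "l x \<in> ?A" using l(2)[OF x(1)] linear_map_zero[OF LM C d] linear_map_closed[OF l(1) x(1)] by simp
  qed auto
  with ext2 obtain l' where l': "linear_map R L (C\<lparr>carrier := ?A\<rparr>) l'" "\<And>x. x \<in> ?K \<Longrightarrow> l' x = l x"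
    unfolding homs_extend_def by blast
  have l'C: "linear_map R L C l'" by (rule linear_map_into_submodule[OF C A l'(1)])
  have "l x \<ominus>\<^bsub>C\<^esub> l' x = \<zero>\<^bsub>C\<^esub>" if "x \<in> carrier L" "\<psi> x = \<zero>\<^bsub>P\<^esub>" for x
    using l'(2)[of x] that linear_map_closed[OF l(1)] by (simp add: C.minus_self)
  from linear_map_factor[OF LM PM C \<psi> linear_map_minusf[OF C l(1) l'C] this] obtain g' where
    g': "linear_map R (P\<lparr>carrier := \<psi> ` carrier L\<rparr>) C g'"
    "\<And>x. x \<in> carrier L \<Longrightarrow> g' (\<psi> x) = l x \<ominus>\<^bsub>C\<^esub> l' x" by blast
  have "g (\<psi> x) = a \<odot>\<^bsub>C\<^esub> g' (\<psi> x) \<oplus>\<^bsub>C\<^esub> h (\<psi> x)" if x: "x \<in> carrier L" for x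
  proof -
    have "a \<odot>\<^bsub>C\<^esub> l' x = \<zero>\<^bsub>C\<^esub>" using linear_map_closed[OF l'(1) x] by simp
    then have "a \<odot>\<^bsub>C\<^esub> g' (\<psi> x) = d x"
      using x a linear_map_closed[OF l(1) x] linear_map_closed[OF l'C x]
      by (simp add: g'(2) C.smult_r_diff l(2) C.minus_zero_right linear_map_closed[OF d])
    then show ?thesis using gc[OF x] hc[OF x] by (simp add: d_def C.minus_add_cancel)
  qed
  then show ?thesis using g'(1) h(1) by blast
qed

text \<open>Successive division of a class by the \<open>s\<^sub>n\<close>.\<close>

lemma exists_tower:
  assumes div: "\<And>n g. linear_map R (P\<lparr>carrier := G\<rparr>) C g \<Longrightarrow>
      \<exists>g' h. linear_map R (P\<lparr>carrier := G\<rparr>) C g' \<and> linear_map R P C h \<and>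
        (\<forall>y \<in> G. g y = s n \<odot>\<^bsub>C\<^esub> g' y \<oplus>\<^bsub>C\<^esub> h y)"
    and g0: "linear_map R (P\<lparr>carrier := G\<rparr>) C g0"
  obtains g h where "g 0 = g0" "\<And>n. linear_map R (P\<lparr>carrier := G\<rparr>) C (g n)" "\<And>n :: nat. linear_map R P C (h n)"
    "\<And>n y. y \<in> G \<Longrightarrow> g n y = s n \<odot>\<^bsub>C\<^esub> g (Suc n) y \<oplus>\<^bsub>C\<^esub> h n y"
proof -
  let ?div = "\<lambda>n g x. linear_map R (P\<lparr>carrier := G\<rparr>) C g \<longrightarrow> linear_map R (P\<lparr>carrier := G\<rparr>) C (fst x) \<and>
      linear_map R P C (snd x) \<and> (\<forall>y \<in> G. g y = s n \<odot>\<^bsub>C\<^esub> fst x y \<oplus>\<^bsub>C\<^esub> snd x y)"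
  have ex: "\<exists>x. ?div n g x" for n g
  proof (cases "linear_map R (P\<lparr>carrier := G\<rparr>) C g")
    case True
    from div[OF this, of n] obtain g' h where "linear_map R (P\<lparr>carrier := G\<rparr>) C g'" "linear_map R P C h"
      "\<forall>y \<in> G. g y = s n \<odot>\<^bsub>C\<^esub> g' y \<oplus>\<^bsub>C\<^esub> h y" by blast
    then show ?thesis by (intro exI[of _ "(g', h)"]) simp
  qed simp
  define F where "F = (\<lambda>n g. SOME x. ?div n g x)"
  have F: "?div n g (F n g)" for n g unfolding F_def by (rule someI_ex[OF ex])
  define d e where "d = (\<lambda>n g. fst (F n g))" and "e = (\<lambda>n g. snd (F n g))"
  have de: "linear_map R (P\<lparr>carrier := G\<rparr>) C (d n g) \<and> linear_map R P C (e n g) \<and>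
      (\<forall>y \<in> G. g y = s n \<odot>\<^bsub>C\<^esub> d n g y \<oplus>\<^bsub>C\<^esub> e n g y)" if "linear_map R (P\<lparr>carrier := G\<rparr>) C g" for n g
    using F that unfolding d_def e_def by blast
  define g where "g = rec_nat g0 d"
  have g: "g 0 = g0" "g (Suc n) = d n (g n)" for n by (simp_all add: g_def)
  have lin: "linear_map R (P\<lparr>carrier := G\<rparr>) C (g n)" for n
    by (induction n) (simp_all add: g g0 de)
  show ?thesis
  proof (rule that[of g "\<lambda>n. e n (g n)"])
    show "g n y = s n \<odot>\<^bsub>C\<^esub> g (Suc n) y \<oplus>\<^bsub>C\<^esub> e n (g n) y" if "y \<in> G" for n y
      unfolding g(2) using de[OF lin[of n]] that by blast
  qed (use g(1) lin de in blast)+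
qed

text \<open>The modules \<open>C / aC\<close> and \<open>{c. ac = 0}\<close> are killed by \<open>a\<close>, so they have larger annihilators than \<open>C\<close>.\<close>

lemma hom_divisible_outside_annihilator:
  fixes C :: "('a, 'c) module" and X :: "'x set" and Z :: "'z set"
  defines "P \<equiv> free_module R X" and "L \<equiv> free_module R Z"
  assumes C: "module R C" and a: "a \<in> carrier R" "a \<notin> annihilator R C"
    and \<psi>: "linear_map R L P \<psi>" and E: "E C"
    and E_image: "\<And>(C :: ('a, 'c) module) (Q :: ('a, 'c) module) f. module R C \<Longrightarrow> module R Q \<Longrightarrow> E C \<Longrightarrow>
      linear_map R C Q f \<Longrightarrow> f ` carrier C = carrier Q \<Longrightarrow> E Q"
    and ext1: "\<And>Q :: ('a, 'c) module. module R Q \<Longrightarrow> E Q \<Longrightarrow> annihilator R C \<subset> annihilator R Q \<Longrightarrow>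
      homs_extend R P (\<psi> ` carrier L) Q"
    and ext2: "\<And>Q :: ('a, 'c) module. module R Q \<Longrightarrow> annihilator R C \<subset> annihilator R Q \<Longrightarrow>
      homs_extend R L {x \<in> carrier L. \<psi> x = \<zero>\<^bsub>P\<^esub>} Q"
    and g: "linear_map R (P\<lparr>carrier := \<psi> ` carrier L\<rparr>) C g"
  shows "\<exists>g' h. linear_map R (P\<lparr>carrier := \<psi> ` carrier L\<rparr>) C g' \<and> linear_map R P C h \<and>
    (\<forall>y \<in> \<psi> ` carrier L. g y = a \<odot>\<^bsub>C\<^esub> g' y \<oplus>\<^bsub>C\<^esub> h y)"
proof -
  interpret C: module R C by fact
  have lin: "linear_map R C C (\<lambda>x. a \<odot>\<^bsub>C\<^esub> x)" by (rule smult_linear[OF C a(1)])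
  let ?H = "(\<lambda>x. a \<odot>\<^bsub>C\<^esub> x) ` carrier C"
  have H: "submodule ?H R C" by (rule linear_map_image[OF C C lin])
  obtain Q :: "('a, 'c) module" and \<pi> where Q: "module R Q" and \<pi>: "linear_map R C Q \<pi>"
    and onto: "\<pi> ` carrier C = carrier Q" and ker: "{x \<in> carrier C. \<pi> x = \<zero>\<^bsub>Q\<^esub>} = ?H"
    using quotient_on_same_type[OF C H] by blast
  have "a \<in> annihilator R Q"
  proof -
    have "a \<odot>\<^bsub>Q\<^esub> \<pi> x = \<zero>\<^bsub>Q\<^esub>" if "x \<in> carrier C" for x
    proof -
      have "a \<odot>\<^bsub>C\<^esub> x \<in> {x \<in> carrier C. \<pi> x = \<zero>\<^bsub>Q\<^esub>}" unfolding ker using that by simp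
      then show ?thesis using linear_map_smult[OF \<pi> a(1) that] by simp
    qed
    then show ?thesis using a(1) unfolding annihilator_def onto[symmetric] by blast
  qed
  then have 1: "annihilator R C \<subset> annihilator R Q"
    using annihilator_quotient[OF C Q \<pi> onto] a(2) by blast
  let ?A = "{x \<in> carrier C. a \<odot>\<^bsub>C\<^esub> x = \<zero>\<^bsub>C\<^esub>}"
  have A: "submodule ?A R C" by (rule linear_map_kernel[OF C C lin])
  have "a \<in> annihilator R (C\<lparr>carrier := ?A\<rparr>)" using a(1) by (simp add: annihilator_def)
  then have 2: "annihilator R C \<subset> annihilator R (C\<lparr>carrier := ?A\<rparr>)"
    using annihilator_submodule[OF A C] a(2) by blast
  show ?thesis unfolding P_def L_def
    by (rule hom_divisible_mod_extendable[OF C Q \<pi> onto ker a(1) \<psi>[unfolded P_def L_def]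
      ext1[OF Q E_image[OF C Q E \<pi> onto] 1, unfolded P_def L_def]
      ext2[OF submodule_carrier_module[OF C A] 2, unfolded P_def L_def] g[unfolded P_def L_def]])
qed

section \<open>Extension properties over rings with countable spectrum\<close>

text \<open>Under the assumption on \<open>\<kappa>\<close>, all syzygies of a module with generators indexed by \<open>'t\<close> have
  presentations over one and the same free module. This keeps the induction on one type.\<close>

lemma submodule_is_image_of_free:
  fixes \<kappa> :: "'t \<Rightarrow> ('t \<Rightarrow> 'a)"
  defines "P \<equiv> free_module R (UNIV :: 't set)"
  assumes \<kappa>: "carrier P \<subseteq> range \<kappa>" and G: "submodule G R P"
  obtains \<phi> where "linear_map R P P \<phi>" "\<phi> ` carrier P = G"
proof -
  have PM: "module R P" unfolding P_def by (rule free_module_is_module)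
  note sub = submodule_simps[OF PM G]
  define h where "h = (\<lambda>t. if \<kappa> t \<in> G then \<kappa> t else \<zero>\<^bsub>P\<^esub>)"
  have hG: "h t \<in> G" for t using sub(2) by (simp add: h_def)
  have hP: "h \<in> UNIV \<rightarrow> carrier P" using hG sub(1) by blast
  have lin: "linear_map R P P (linear_ext R P h)"
    using linear_ext_linear[OF PM hP] unfolding P_def .
  have gen: "linear_ext R P h (free_gen R t) = h t" for t
    by (rule linear_ext_gen[OF PM hP]) simp
  have "linear_ext R P h x \<in> G" if "x \<in> carrier P" for x
    by (rule linear_map_in_submodule_on_support[OF PM linear_ext_linear[OF PM hP] G])
      (use that gen hG in \<open>simp_all add: P_def\<close>)
  moreover have "y \<in> linear_ext R P h ` carrier P" if y: "y \<in> G" for y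
  proof -
    obtain t where "y = \<kappa> t" using y sub(1) \<kappa> by blast
    then have "y = linear_ext R P h (free_gen R t)" using y gen[of t] by (simp add: h_def)
    moreover have "free_gen R t \<in> carrier P" by (simp add: P_def free_gen_closed)
    ultimately show ?thesis by blast
  qed
  ultimately have "linear_ext R P h ` carrier P = G" by blast
  then show ?thesis using lin that by blast
qed

lemma exists_dividing_tower:
  fixes C :: "('a, 'c) module" and X :: "'x set" and Z :: "'z set"
  defines "P \<equiv> free_module R X" and "L \<equiv> free_module R Z"
  assumes noeth: "noetherian_ring R" and count: "countable (Spec R)"
    and C: "module R C" and p: "primeideal (annihilator R C) R"
    and \<psi>: "linear_map R L P \<psi>" and im: "\<psi> ` carrier L = G" and E: "E C"
    and E_image: "\<And>(C :: ('a, 'c) module) (Q :: ('a, 'c) module) f. module R C \<Longrightarrow> module R Q \<Longrightarrow> E C \<Longrightarrow>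
      linear_map R C Q f \<Longrightarrow> f ` carrier C = carrier Q \<Longrightarrow> E Q"
    and ext1: "\<And>Q :: ('a, 'c) module. module R Q \<Longrightarrow> E Q \<Longrightarrow> annihilator R C \<subset> annihilator R Q \<Longrightarrow>
      homs_extend R P G Q"
    and ext2: "\<And>Q :: ('a, 'c) module. module R Q \<Longrightarrow> annihilator R C \<subset> annihilator R Q \<Longrightarrow>
      homs_extend R L {x \<in> carrier L. \<psi> x = \<zero>\<^bsub>P\<^esub>} Q"
    and g0: "linear_map R (P\<lparr>carrier := G\<rparr>) C g0"
  obtains s g h where "submonoid (range s) R" "\<And>n. infinite {m. s m = s n}" "\<And>n. s n \<in> carrier R"
    "\<And>a. a \<in> carrier R - annihilator R C \<Longrightarrow>
      \<exists>k. \<exists>r \<in> carrier R. segment_prod s 0 k \<ominus> r \<otimes> a \<in> annihilator R C"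
    "g 0 = g0" "\<And>n. linear_map R (P\<lparr>carrier := G\<rparr>) C (g n)" "\<And>n. linear_map R P C (h n)"
    "\<And>n y. y \<in> G \<Longrightarrow> g n y = s n \<odot>\<^bsub>C\<^esub> g (Suc n) y \<oplus>\<^bsub>C\<^esub> h n y"
proof -
  obtain s where s: "submonoid (range s) R" "range s \<inter> annihilator R C = {}" "\<And>n. infinite {m. s m = s n}"
    and inv: "\<And>a. a \<in> carrier R - annihilator R C \<Longrightarrow>
      \<exists>k. \<exists>r \<in> carrier R. segment_prod s 0 k \<ominus> r \<otimes> a \<in> annihilator R C"
    using exists_inverting_sequence[OF noeth count p] by metis
  have sR: "s n \<in> carrier R" and sp: "s n \<notin> annihilator R C" for n
    using submonoid.subset[OF s(1)] s(2) by auto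
  have div: "\<exists>g' h. linear_map R (P\<lparr>carrier := G\<rparr>) C g' \<and> linear_map R P C h \<and>
      (\<forall>y \<in> G. g y = s n \<odot>\<^bsub>C\<^esub> g' y \<oplus>\<^bsub>C\<^esub> h y)"
    if g: "linear_map R (P\<lparr>carrier := G\<rparr>) C g" for n g
    by (rule hom_divisible_outside_annihilator[where X = X and Z = Z and \<psi> = \<psi> and E = E and C = C,
        folded P_def L_def, unfolded im, OF C sR sp \<psi> E E_image ext1 ext2 g])
  obtain g h where "g 0 = g0" "\<And>n. linear_map R (P\<lparr>carrier := G\<rparr>) C (g n)"
    "\<And>n :: nat. linear_map R P C (h n)"
    "\<And>n y. y \<in> G \<Longrightarrow> g n y = s n \<odot>\<^bsub>C\<^esub> g (Suc n) y \<oplus>\<^bsub>C\<^esub> h n y"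
    by (rule exists_tower[where s = s, OF div g0]) (assumption | rule that)+
  with s(1,3) sR inv show ?thesis by (rule that)
qed

text \<open>Flat modules have projective dimension at most one: the image \<open>\<phi> P\<close> and the kernel of \<open>\<phi>\<close> are a first
  and a second syzygy of the flat module \<open>P / \<phi> P\<close>, and the conclusion says \<open>Ext\<^sup>1(\<phi> P, C) = 0\<close>. The class
  of all such kernels is closed under passage to the next syzygy, so the obstruction in
  \<open>hom_divisible_mod_extendable\<close> is covered by the induction.\<close>

lemma homs_extend_from_syzygy:
  fixes C :: "('a, 'c) module" and \<kappa> :: "'t \<Rightarrow> ('t \<Rightarrow> 'a)"
  defines "P \<equiv> free_module R (UNIV :: 't set)"
  assumes noeth: "noetherian_ring R" and count: "countable (Spec R)" and \<kappa>: "carrier P \<subseteq> range \<kappa>"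
    and C: "module R C" and \<phi>: "linear_map R P P \<phi>" and G: "locally_retract R P (\<phi> ` carrier P)"
  shows "homs_extend R P {x \<in> carrier P. \<phi> x = \<zero>\<^bsub>P\<^esub>} C"
proof -
  define \<G> where "\<G> = {{x \<in> carrier P. \<phi> x = \<zero>\<^bsub>P\<^esub>} | \<phi>. linear_map R P P \<phi> \<and> locally_retract R P (\<phi> ` carrier P)}"
  have retract: "locally_retract R P G" if "G \<in> \<G>" for G
    using that locally_retract_kernel[of UNIV UNIV] unfolding \<G>_def P_def by blast
  have "\<forall>G \<in> \<G>. homs_extend R P G C" unfolding P_def
  proof (rule noetherian_devissage[OF noeth C, where E = "\<lambda>_. True"])
    show "submodule G R (free_module R UNIV)" if "G \<in> \<G>" for G
      using retract[OF that] by (simp add: locally_retract_def P_def)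
    fix C :: "('a, 'c) module" and G
    assume C: "module R C" and p: "primeideal (annihilator R C) R" and G: "G \<in> \<G>"
      and IH: "\<And>(Q :: ('a, 'c) module) G. module R Q \<Longrightarrow> True \<Longrightarrow> annihilator R C \<subset> annihilator R Q \<Longrightarrow>
         G \<in> \<G> \<Longrightarrow> homs_extend R (free_module R UNIV) G Q"
    obtain \<phi> where \<phi>: "linear_map R P P \<phi>" "locally_retract R P (\<phi> ` carrier P)"
      and G_eq: "G = {x \<in> carrier P. \<phi> x = \<zero>\<^bsub>P\<^esub>}" using G by (auto simp: \<G>_def)
    have rG: "locally_retract R P G" by (rule retract[OF G])
    then have sG: "submodule G R P" by (simp add: locally_retract_def)
    from submodule_is_image_of_free[OF \<kappa>[unfolded P_def] sG[unfolded P_def], folded P_def]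
    obtain \<psi> where \<psi>: "linear_map R P P \<psi>" "\<psi> ` carrier P = G" by blast
    have G': "{x \<in> carrier P. \<psi> x = \<zero>\<^bsub>P\<^esub>} \<in> \<G>" using \<psi> rG by (auto simp: \<G>_def)
    show "homs_extend R (free_module R UNIV) G C" unfolding P_def[symmetric] homs_extend_def
    proof (intro allI impI)
      fix g0 assume g0: "linear_map R (P\<lparr>carrier := G\<rparr>) C g0"
      obtain s g h where sR: "\<And>n. s n \<in> carrier R" and inv: "\<And>a. a \<in> carrier R - annihilator R C \<Longrightarrow>
          \<exists>k. \<exists>r \<in> carrier R. segment_prod s 0 k \<ominus> r \<otimes> a \<in> annihilator R C"
        and "g 0 = g0" and g: "\<And>n. linear_map R (P\<lparr>carrier := G\<rparr>) C (g n)"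
        and h: "\<And>n. linear_map R P C (h n)"
        and gh: "\<And>n y. y \<in> G \<Longrightarrow> g n y = s n \<odot>\<^bsub>C\<^esub> g (Suc n) y \<oplus>\<^bsub>C\<^esub> h n y"
        by (rule exists_dividing_tower[where X = "UNIV :: 't set" and Z = "UNIV :: 't set" and E = "\<lambda>_. True", folded P_def,
            OF noeth count C p \<psi> TrueI TrueI IH[folded P_def, OF _ _ _ G] IH[folded P_def, OF _ TrueI _ G'] g0])
          (assumption | rule that)+
      have "\<exists>u. linear_map R P C u \<and> (\<forall>x \<in> {x \<in> carrier P. \<phi> x = \<zero>\<^bsub>P\<^esub>}. u x = g 0 x)"
        unfolding P_def
      proof (rule prime_tower_extends_syzygy[where h = h, OF C _ _ p _ sR inv])
        show "linear_map R (free_module R UNIV) C (h n)" for n using h unfolding P_def .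
        show "linear_map R (free_module R UNIV) (free_module R UNIV) \<phi>"
          "locally_retract R (free_module R UNIV) (\<phi> ` carrier (free_module R UNIV))"
          using \<phi> unfolding P_def .
        show "a \<odot>\<^bsub>C\<^esub> x = \<zero>\<^bsub>C\<^esub>" if "a \<in> annihilator R C" "x \<in> carrier C" for a x
          by (rule annihilatorD[OF that])
        show "linear_map R (free_module R UNIV\<lparr>carrier := {x \<in> carrier (free_module R UNIV).
            \<phi> x = \<zero>\<^bsub>free_module R UNIV\<^esub>}\<rparr>) C (g n)" for n
          using g unfolding P_def G_eq .
        show "g n y = s n \<odot>\<^bsub>C\<^esub> g (Suc n) y \<oplus>\<^bsub>C\<^esub> h n y"
          if "y \<in> {x \<in> carrier (free_module R UNIV). \<phi> x = \<zero>\<^bsub>free_module R UNIV\<^esub>}" for n y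
          by (rule gh) (use that in \<open>simp add: G_eq P_def\<close>)
      qed
      then show "\<exists>h. linear_map R P C h \<and> (\<forall>x\<in>G. h x = g0 x)"
        unfolding G_eq \<open>g 0 = g0\<close> .
    qed
  qed simp_all
  moreover have "{x \<in> carrier P. \<phi> x = \<zero>\<^bsub>P\<^esub>} \<in> \<G>" using \<phi> G by (auto simp: \<G>_def)
  ultimately show ?thesis by blast
qed

text \<open>\<open>Ext\<^sup>1(P / G, C) = 0\<close> for flat \<open>P / G\<close>. The obstruction in \<open>hom_divisible_mod_extendable\<close> lives on the
  module \<open>{c. ac = 0}\<close>, which need not be telescopic; it is removed by \<open>homs_extend_from_syzygy\<close>.\<close>

lemma homs_extend_to_telescopic:
  fixes C :: "('a, 'c) module" and \<kappa> :: "'t \<Rightarrow> ('t \<Rightarrow> 'a)"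
  defines "P \<equiv> free_module R (UNIV :: 't set)"
  assumes noeth: "noetherian_ring R" and count: "countable (Spec R)" and \<kappa>: "carrier P \<subseteq> range \<kappa>"
    and C: "module R C" and tel: "telescopic R C" and G: "locally_retract R P G"
  shows "homs_extend R P G C"
proof -
  have sG: "submodule G R P" using G by (simp add: locally_retract_def)
  from submodule_is_image_of_free[OF \<kappa>[unfolded P_def] sG[unfolded P_def], folded P_def]
  obtain \<psi> where \<psi>: "linear_map R P P \<psi>" "\<psi> ` carrier P = G" by blast
  have "\<forall>G \<in> {G}. homs_extend R P G C" unfolding P_def
  proof (rule noetherian_devissage[OF noeth C, where E = "telescopic R"])
    show "submodule G' R (free_module R UNIV)" if "G' \<in> {G}" for G'
      using sG that by (simp add: P_def)
    show "telescopic R C" by fact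
    show "telescopic R Q" if "module R C" "module R Q" "telescopic R C" "linear_map R C Q f"
      "f ` carrier C = carrier Q" for C Q :: "('a, 'c) module" and f
      using telescopic_image[OF that(1,2,4,5,3)] .
    fix C :: "('a, 'c) module" and G'
    assume C: "module R C" and tel: "telescopic R C" and p: "primeideal (annihilator R C) R" and G': "G' \<in> {G}"
      and IH: "\<And>(Q :: ('a, 'c) module) G'. module R Q \<Longrightarrow> telescopic R Q \<Longrightarrow>
         annihilator R C \<subset> annihilator R Q \<Longrightarrow> G' \<in> {G} \<Longrightarrow> homs_extend R (free_module R UNIV) G' Q"
    have "homs_extend R P G C" unfolding homs_extend_def
    proof (intro allI impI)
      fix g0 assume g0: "linear_map R (P\<lparr>carrier := G\<rparr>) C g0"
      obtain s g h where sR: "\<And>n. s n \<in> carrier R" and s: "submonoid (range s) R" "\<And>n. infinite {m. s m = s n}"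
        and inv: "\<And>a. a \<in> carrier R - annihilator R C \<Longrightarrow>
          \<exists>k. \<exists>r \<in> carrier R. segment_prod s 0 k \<ominus> r \<otimes> a \<in> annihilator R C"
        and "g 0 = g0" and g: "\<And>n. linear_map R (P\<lparr>carrier := G\<rparr>) C (g n)"
        and h: "\<And>n. linear_map R P C (h n)"
        and gh: "\<And>n y. y \<in> G \<Longrightarrow> g n y = s n \<odot>\<^bsub>C\<^esub> g (Suc n) y \<oplus>\<^bsub>C\<^esub> h n y"
      proof (rule exists_dividing_tower[where X = "UNIV :: 't set" and Z = "UNIV :: 't set" and E = "telescopic R", folded P_def,
            OF noeth count C p \<psi> tel _ IH[folded P_def] _ g0])
        show "telescopic R Q" if "module R C" "module R Q" "telescopic R C" "linear_map R C Q f"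
          "f ` carrier C = carrier Q" for C Q :: "('a, 'c) module" and f
          using telescopic_image[OF that(1,2,4,5,3)] .
        show "homs_extend R P {x \<in> carrier P. \<psi> x = \<zero>\<^bsub>P\<^esub>} Q" if "module R Q" for Q :: "('a, 'c) module"
          using homs_extend_from_syzygy[OF noeth count \<kappa>[unfolded P_def] that \<psi>(1)[unfolded P_def]] G \<psi>(2)
          by (simp add: P_def)
      qed (assumption | rule that | simp)+
      have "\<exists>u. linear_map R P C u \<and> (\<forall>x \<in> G. u x = g 0 x)"
        unfolding P_def
      proof (rule prime_tower_extends_telescopic[where h = h, OF C _ p _ sR inv])
        show "linear_map R (free_module R UNIV) C (h n)" for n using h unfolding P_def .
        show "\<exists>d. \<forall>n. d n \<in> carrier C \<and> d n = c n \<oplus>\<^bsub>C\<^esub> s n \<odot>\<^bsub>C\<^esub> d (Suc n)"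
          if "\<And>n. c n \<in> carrier C" for c
          using tel s that unfolding telescopic_def by blast
        show "locally_retract R (free_module R UNIV) G" using G unfolding P_def .
        show "a \<odot>\<^bsub>C\<^esub> x = \<zero>\<^bsub>C\<^esub>" if "a \<in> annihilator R C" "x \<in> carrier C" for a x
          by (rule annihilatorD[OF that])
        show "linear_map R (free_module R UNIV\<lparr>carrier := G\<rparr>) C (g n)" for n
          using g unfolding P_def .
        show "g n y = s n \<odot>\<^bsub>C\<^esub> g (Suc n) y \<oplus>\<^bsub>C\<^esub> h n y" if "y \<in> G" for n y
          by (rule gh[OF that])
      qed
      then show "\<exists>h. linear_map R P C h \<and> (\<forall>x\<in>G. h x = g0 x)"
        unfolding \<open>g 0 = g0\<close> .
    qed
    then show "homs_extend R (free_module R UNIV) G' C" using G' by (simp add: P_def)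
  qed
  then show ?thesis by simp
qed

end

section \<open>Ext and extension of homomorphisms\<close>

lemma carrier_hom_module:
  "f \<in> carrier (hom_module R M N) \<longleftrightarrow> f \<in> extensional (carrier M) \<and> linear_map R M N f"
  by (auto simp: hom_module_def linear_map_def PiE_def)

lemma zero_hom_module: "\<zero>\<^bsub>hom_module R M N\<^esub> = (\<lambda>x \<in> carrier M. \<zero>\<^bsub>N\<^esub>)"
  by (simp add: hom_module_def)

lemma compose_eq_restrict: "compose A g f = restrict (\<lambda>x. g (f x)) A"
  by (simp add: compose_def)

context cring
begin

text \<open>A cocycle on the free module over the kernel of the augmentation factors through that kernel, and it
  is a coboundary if and only if the resulting map extends to the free module over \<open>F\<close>.\<close>

lemma zero_module_Ext1_iff:
  fixes F :: "('a, 'f) module" and C :: "('a, 'c) module"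
  assumes F: "module R F" and C: "module R C"
  shows "zero_module (Ext1 R F C) \<longleftrightarrow>
    homs_extend R (res0 R F) {x \<in> carrier (res0 R F). aug R F x = \<zero>\<^bsub>F\<^esub>} C"
proof -
  interpret C: module R C by fact
  define P0 where "P0 = res0 R F"
  define P1 where "P1 = res1 R F"
  define P2 where "P2 = res2 R F"
  define d0 where "d0 = aug R F"
  define d1 where "d1 = diff1 R F"
  define d2 where "d2 = diff2 R F"
  define G where "G = {x \<in> carrier P0. d0 x = \<zero>\<^bsub>F\<^esub>}"
  define K where "K = {x \<in> carrier P1. d1 x = \<zero>\<^bsub>P0\<^esub>}"
  have P0: "P0 = free_module R (carrier F)" by (simp add: P0_def res0_def)
  have P1: "P1 = free_module R G" by (simp add: P1_def res1_def G_def a_kernel_def' P0_def d0_def)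
  have P2: "P2 = free_module R K" by (simp add: P2_def res2_def K_def a_kernel_def' P0_def P1_def d1_def)
  have m0: "module R P0" and m1: "module R P1" and m2: "module R P2"
    unfolding P0 P1 P2 by (rule free_module_is_module)+
  interpret P0: module R P0 by fact
  interpret P1: module R P1 by fact
  have GP: "(\<lambda>x. x) \<in> G \<rightarrow> carrier P0" and KP: "(\<lambda>x. x) \<in> K \<rightarrow> carrier P1" by (auto simp: G_def K_def)
  have l0: "linear_map R P0 F d0"
    unfolding P0 d0_def aug_def by (rule linear_ext_linear[OF F]) auto
  have l1: "linear_map R P1 P0 d1" and g1: "\<And>x. x \<in> G \<Longrightarrow> d1 (free_gen R x) = x"
    using linear_ext_linear[OF m0 GP] linear_ext_gen[OF m0 GP]
    by (simp_all add: P1 d1_def diff1_def P0_def[symmetric])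
  have l2: "linear_map R P2 P1 d2" and g2: "\<And>x. x \<in> K \<Longrightarrow> d2 (free_gen R x) = x"
    using linear_ext_linear[OF m1 KP] linear_ext_gen[OF m1 KP]
    by (simp_all add: P2 d2_def diff2_def P1_def[symmetric])
  have e1: "free_gen R x \<in> carrier P1" if "x \<in> G" for x using that by (simp add: P1 free_gen_closed)
  have e2: "free_gen R x \<in> carrier P2" if "x \<in> K" for x using that by (simp add: P2 free_gen_closed)
  have sG: "submodule G R P0" unfolding G_def by (rule linear_map_kernel[OF m0 F l0])
  have sK: "submodule K R P1" unfolding K_def by (rule linear_map_kernel[OF m1 m0 l1])
  have d1G: "d1 x \<in> G" if "x \<in> carrier P1" for x
    by (rule linear_map_in_submodule_on_support[OF m0 l1[unfolded P1] sG that[unfolded P1]])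
      (use free_support[OF that[unfolded P1]] g1 in auto)
  have d2K: "d2 x \<in> K" if "x \<in> carrier P2" for x
    by (rule linear_map_in_submodule_on_support[OF m1 l2[unfolded P2] sK that[unfolded P2]])
      (use free_support[OF that[unfolded P2]] g2 in auto)
  have onto1: "d1 ` carrier P1 = G" using d1G g1 e1 by (force simp: image_iff)
  define Z where "Z = cocycles1 R F C"
  define B where "B = coboundaries1 R F C"
  let ?H = "hom_module R P1 C"
  have Z: "z \<in> Z \<longleftrightarrow> z \<in> carrier ?H \<and> (\<forall>x \<in> K. z x = \<zero>\<^bsub>C\<^esub>)" for z
  proof -
    have "z \<in> Z \<longleftrightarrow> z \<in> carrier ?H \<and> compose (carrier P2) z d2 = (\<lambda>x \<in> carrier P2. \<zero>\<^bsub>C\<^esub>)"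
      by (simp add: Z_def cocycles1_def a_kernel_def' zero_hom_module P1_def P2_def d2_def)
    also have "compose (carrier P2) z d2 = (\<lambda>x \<in> carrier P2. \<zero>\<^bsub>C\<^esub>) \<longleftrightarrow> (\<forall>x \<in> carrier P2. z (d2 x) = \<zero>\<^bsub>C\<^esub>)"
      unfolding compose_eq_restrict by (auto simp: fun_eq_iff restrict_def)
    also have "\<dots> \<longleftrightarrow> (\<forall>x \<in> K. z x = \<zero>\<^bsub>C\<^esub>)"
      using d2K g2 e2 by metis
    finally show ?thesis .
  qed
  have B: "z \<in> B \<longleftrightarrow> (\<exists>h. linear_map R P0 C h \<and> z = restrict (\<lambda>x. h (d1 x)) (carrier P1))" for z
  proof
    assume "z \<in> B"
    then show "\<exists>h. linear_map R P0 C h \<and> z = restrict (\<lambda>x. h (d1 x)) (carrier P1)"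
      unfolding B_def coboundaries1_def compose_eq_restrict P0_def[symmetric] P1_def[symmetric] d1_def[symmetric]
      using carrier_hom_module by blast
  next
    assume "\<exists>h. linear_map R P0 C h \<and> z = restrict (\<lambda>x. h (d1 x)) (carrier P1)"
    then obtain h where h: "linear_map R P0 C h" "z = restrict (\<lambda>x. h (d1 x)) (carrier P1)" by blast
    let ?h = "restrict h (carrier P0)"
    have "?h \<in> carrier (hom_module R P0 C)"
      unfolding carrier_hom_module using linear_map_cong[OF m0 h(1), of ?h] by simp
    moreover have "z = restrict (\<lambda>x. ?h (d1 x)) (carrier P1)"
      unfolding h(2) by (rule restrict_ext) (use linear_map_closed[OF l1] in simp)
    ultimately show "z \<in> B"
      unfolding B_def coboundaries1_def compose_eq_restrict P0_def[symmetric] P1_def[symmetric] d1_def[symmetric]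
      by blast
  qed
  have B_add: "z \<oplus>\<^bsub>?H\<^esub> y \<in> B" if "z \<in> B" "y \<in> B" for z y
  proof -
    obtain h k where h: "linear_map R P0 C h" "z = restrict (\<lambda>x. h (d1 x)) (carrier P1)"
      and k: "linear_map R P0 C k" "y = restrict (\<lambda>x. k (d1 x)) (carrier P1)" using \<open>z \<in> B\<close> \<open>y \<in> B\<close> unfolding B by blast
    have "z \<oplus>\<^bsub>?H\<^esub> y = restrict (\<lambda>x. h (d1 x) \<oplus>\<^bsub>C\<^esub> k (d1 x)) (carrier P1)"
      unfolding h(2) k(2) by (auto simp: hom_module_def fun_eq_iff)
    then show ?thesis unfolding B using linear_map_addf[OF C h(1) k(1)] by blast
  qed
  have B_diff: "\<exists>w \<in> B. z = w \<oplus>\<^bsub>?H\<^esub> y" if "z \<in> B" "y \<in> B" for z y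
  proof -
    obtain h k where h: "linear_map R P0 C h" "z = restrict (\<lambda>x. h (d1 x)) (carrier P1)"
      and k: "linear_map R P0 C k" "y = restrict (\<lambda>x. k (d1 x)) (carrier P1)" using \<open>z \<in> B\<close> \<open>y \<in> B\<close> unfolding B by blast
    let ?w = "restrict (\<lambda>x. h (d1 x) \<ominus>\<^bsub>C\<^esub> k (d1 x)) (carrier P1)"
    have "z = ?w \<oplus>\<^bsub>?H\<^esub> y"
      unfolding h(2) k(2) using linear_map_closed[OF h(1) linear_map_closed[OF l1]] linear_map_closed[OF k(1) linear_map_closed[OF l1]]
      by (auto simp: hom_module_def fun_eq_iff C.minus_add_cancel)
    moreover have "?w \<in> B" unfolding B using linear_map_minusf[OF C h(1) k(1)] by blast
    ultimately show ?thesis by blast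
  qed
  have B0: "(\<lambda>x \<in> carrier P1. \<zero>\<^bsub>C\<^esub>) \<in> B" unfolding B using linear_map_zerof[OF C] by blast
  have BZ: "B \<subseteq> Z"
  proof
    fix z assume "z \<in> B"
    then obtain h where h: "linear_map R P0 C h" "z = restrict (\<lambda>x. h (d1 x)) (carrier P1)" unfolding B by blast
    have "linear_map R P1 C z" unfolding h(2)
      by (rule linear_map_cong[OF m1 linear_map_compose[OF l1 h(1)]]) simp
    then have "z \<in> carrier ?H" unfolding carrier_hom_module using h(2) by simp
    moreover have "z x = \<zero>\<^bsub>C\<^esub>" if "x \<in> K" for x
      using that linear_map_zero[OF m0 C h(1)] by (simp add: h(2) K_def)
    ultimately show "z \<in> Z" unfolding Z by blast
  qed
  define coset where "coset = (\<lambda>z. (\<lambda>w. w \<oplus>\<^bsub>?H\<^esub> z) ` B)"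
  have coset: "B +>\<^bsub>?H\<lparr>carrier := Z\<rparr>\<^esub> z = coset z" for z
    by (auto simp: a_r_coset_def' coset_def)
  have carr: "carrier (Ext1 R F C) = coset ` Z"
    by (auto simp: Ext1_def quotient_module_def A_RCOSETS_def' Z_def[symmetric] B_def[symmetric]
      P1_def[symmetric] coset)
  have zero: "\<zero>\<^bsub>Ext1 R F C\<^esub> = B" by (simp add: Ext1_def quotient_module_def B_def)
  have "zero_module (Ext1 R F C) \<longleftrightarrow> Z \<subseteq> B"
  proof
    assume zm: "zero_module (Ext1 R F C)"
    show "Z \<subseteq> B"
    proof
      fix z assume z: "z \<in> Z"
      then have "coset z \<in> {B}" using zm unfolding zero_module_def carr zero by (metis imageI)
      moreover have "(\<lambda>x \<in> carrier P1. \<zero>\<^bsub>C\<^esub>) \<oplus>\<^bsub>?H\<^esub> z = z"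
      proof -
        have "z \<in> extensional (carrier P1)" "linear_map R P1 C z"
          using z unfolding Z carrier_hom_module by auto
        then show ?thesis
          by (auto simp: hom_module_def fun_eq_iff extensional_def linear_map_closed)
      qed
      ultimately show "z \<in> B" using imageI[OF B0, of "\<lambda>w. w \<oplus>\<^bsub>?H\<^esub> z"] by (simp add: coset_def)
    qed
  next
    assume ZB: "Z \<subseteq> B"
    have "coset z = B" if "z \<in> Z" for z
    proof
      have zB: "z \<in> B" using that ZB by blast
      show "coset z \<subseteq> B" unfolding coset_def using B_add[OF _ zB] by (rule image_subsetI)
      show "B \<subseteq> coset z"
      proof
        fix y assume "y \<in> B"
        from B_diff[OF this zB] obtain w where "w \<in> B" "y = w \<oplus>\<^bsub>?H\<^esub> z" ..
        then show "y \<in> coset z" unfolding coset_def by blast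
      qed
    qed
    moreover have "Z \<noteq> {}" using B0 BZ by blast
    ultimately have "coset ` Z = {B}" by (simp add: image_constant_conv cong: image_cong)
    then show "zero_module (Ext1 R F C)" unfolding zero_module_def carr zero .
  qed
  also have "\<dots> \<longleftrightarrow> homs_extend R P0 G C"
  proof
    assume ZB: "Z \<subseteq> B"
    show "homs_extend R P0 G C" unfolding homs_extend_def
    proof (intro allI impI)
      fix g assume g: "linear_map R (P0\<lparr>carrier := G\<rparr>) C g"
      have "linear_map R P1 (P0\<lparr>carrier := G\<rparr>) d1" using d1G by (intro linear_map_restrict_codomain[OF l1])
      from linear_map_compose[OF this g] have gl: "linear_map R P1 C (\<lambda>x. g (d1 x))" .
      let ?z = "restrict (\<lambda>x. g (d1 x)) (carrier P1)"
      have "linear_map R P1 C ?z" by (rule linear_map_cong[OF m1 gl]) simp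
      moreover have "g \<zero>\<^bsub>P0\<^esub> = \<zero>\<^bsub>C\<^esub>"
        using linear_map_zero[OF submodule_carrier_module[OF m0 sG] C g] by simp
      ultimately have "?z \<in> Z" unfolding Z carrier_hom_module by (simp add: K_def)
      with ZB have "?z \<in> B" ..
      then obtain h where h: "linear_map R P0 C h" "?z = restrict (\<lambda>x. h (d1 x)) (carrier P1)" unfolding B by blast
      have "h y = g y" if "y \<in> G" for y
        using fun_cong[OF h(2), of "free_gen R y"] e1[OF that] g1[OF that] by simp
      then show "\<exists>h. linear_map R P0 C h \<and> (\<forall>x\<in>G. h x = g x)" using h(1) by blast
    qed
  next
    assume ext: "homs_extend R P0 G C"
    show "Z \<subseteq> B"
    proof
      fix z assume "z \<in> Z"
      then have z: "z \<in> extensional (carrier P1)" "linear_map R P1 C z" "\<And>x. x \<in> K \<Longrightarrow> z x = \<zero>\<^bsub>C\<^esub>"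
        unfolding Z carrier_hom_module by auto
      have "z x = \<zero>\<^bsub>C\<^esub>" if "x \<in> carrier P1" "d1 x = \<zero>\<^bsub>P0\<^esub>" for x
        using z(3) that by (simp add: K_def)
      from linear_map_factor[OF m1 m0 C l1 z(2) this, unfolded onto1] obtain g where
        g: "linear_map R (P0\<lparr>carrier := G\<rparr>) C g" "\<And>x. x \<in> carrier P1 \<Longrightarrow> g (d1 x) = z x" by blast
      from ext g(1) obtain h where h: "linear_map R P0 C h" "\<And>x. x \<in> G \<Longrightarrow> h x = g x" unfolding homs_extend_def by blast
      have "z = restrict (\<lambda>x. h (d1 x)) (carrier P1)"
        using z(1) h(2) g(2) d1G by (auto simp: extensional_def fun_eq_iff)
      then show "z \<in> B" unfolding B using h(1) by blast
    qed
  qed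
  finally show ?thesis by (simp add: P0_def G_def d0_def)
qed

section \<open>Flat modules are locally retractable\<close>

context
  fixes M :: "('a, 'd) module" and F :: "('a, 'f) module"
  assumes M: "module R M" and F: "module R F"
begin

lemma tensor_gen_relations_closed:
  "tensor_gen_relations R M F \<subseteq> carrier (free_module R (carrier M \<times> carrier F))"
proof -
  interpret M: module R M by (rule M)
  interpret F: module R F by (rule F)
  interpret P: module R "free_module R (carrier M \<times> carrier F)" by (rule free_module_is_module)
  have e: "free_gen R (m, n) \<in> carrier (free_module R (carrier M \<times> carrier F))"
    if "m \<in> carrier M" "n \<in> carrier F" for m n using that by (simp add: free_gen_closed)
  show ?thesis
    unfolding tensor_gen_relations_def Let_def
    by (intro Un_least subsetI; elim CollectE exE conjE; simp add: e)
qed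

lemma tensor_relations_submodule:
  "submodule (tensor_relations R M F) R (free_module R (carrier M \<times> carrier F))"
proof -
  let ?P = "free_module R (carrier M \<times> carrier F)"
  interpret P: module R ?P by (rule free_module_is_module)
  let ?\<S> = "{t. submodule t R ?P \<and> tensor_gen_relations R M F \<subseteq> t}"
  have T: "tensor_relations R M F = \<Inter>?\<S>" by (simp add: tensor_relations_def hull_def)
  have c: "carrier ?P \<in> ?\<S>" using P.carrier_is_submodule tensor_gen_relations_closed by blast
  note sub = submodule_simps[OF free_module_is_module[of "carrier M \<times> carrier F"]]
  show ?thesis unfolding T
  proof (rule submodule_of_closedI[OF free_module_is_module])
    show "\<Inter>?\<S> \<subseteq> carrier ?P" using c by blast
  qed (auto intro: sub(2,3,4))
qed

text \<open>A map on pairs that is bilinear modulo \<open>H\<close> induces a map on the tensor product.\<close>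

lemma tensor_relations_linear_ext:
  assumes Q: "module R Q" and H: "submodule H R Q"
    and b: "\<And>m n. m \<in> carrier M \<Longrightarrow> n \<in> carrier F \<Longrightarrow> b (m, n) \<in> carrier Q"
    and "\<And>m m' n. m \<in> carrier M \<Longrightarrow> m' \<in> carrier M \<Longrightarrow> n \<in> carrier F \<Longrightarrow>
      b (m \<oplus>\<^bsub>M\<^esub> m', n) \<ominus>\<^bsub>Q\<^esub> (b (m, n) \<oplus>\<^bsub>Q\<^esub> b (m', n)) \<in> H"
    and "\<And>m n n'. m \<in> carrier M \<Longrightarrow> n \<in> carrier F \<Longrightarrow> n' \<in> carrier F \<Longrightarrow>
      b (m, n \<oplus>\<^bsub>F\<^esub> n') \<ominus>\<^bsub>Q\<^esub> (b (m, n) \<oplus>\<^bsub>Q\<^esub> b (m, n')) \<in> H"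
    and "\<And>r m n. r \<in> carrier R \<Longrightarrow> m \<in> carrier M \<Longrightarrow> n \<in> carrier F \<Longrightarrow>
      b (r \<odot>\<^bsub>M\<^esub> m, n) \<ominus>\<^bsub>Q\<^esub> r \<odot>\<^bsub>Q\<^esub> b (m, n) \<in> H"
    and "\<And>r m n. r \<in> carrier R \<Longrightarrow> m \<in> carrier M \<Longrightarrow> n \<in> carrier F \<Longrightarrow>
      b (m, r \<odot>\<^bsub>F\<^esub> n) \<ominus>\<^bsub>Q\<^esub> r \<odot>\<^bsub>Q\<^esub> b (m, n) \<in> H"
    and x: "x \<in> tensor_relations R M F"
  shows "linear_ext R Q b x \<in> H"
proof -
  interpret M: module R M by (rule M)
  interpret F: module R F by (rule F)
  interpret Q: module R Q by fact
  define P where "P = free_module R (carrier M \<times> carrier F)"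
  have PM: "module R P" unfolding P_def by (rule free_module_is_module)
  interpret P: module R P by (rule PM)
  have bP: "b \<in> carrier M \<times> carrier F \<rightarrow> carrier Q" using b by auto
  let ?L = "linear_ext R Q b"
  have L: "linear_map R P Q ?L" unfolding P_def by (rule linear_ext_linear[OF Q bP])
  have e: "free_gen R (m, n) \<in> carrier P" and Le: "?L (free_gen R (m, n)) = b (m, n)"
    if "m \<in> carrier M" "n \<in> carrier F" for m n
    using that by (simp_all add: free_gen_closed P_def linear_ext_gen[OF Q bP])
  let ?K = "{x \<in> carrier P. ?L x \<in> H}"
  have K: "submodule ?K R P" by (rule linear_map_vimage[OF PM Q L H])
  have "tensor_gen_relations R M F \<subseteq> ?K"
    unfolding tensor_gen_relations_def Let_def P_def[symmetric]
    by (intro Un_least subsetI; elim CollectE exE conjE;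
        simp add: e Le assms(4-7) linear_map_minus[OF PM Q L] linear_map_add[OF L] linear_map_smult[OF L])
  then have "tensor_relations R M F \<subseteq> ?K"
    unfolding tensor_relations_def P_def[symmetric] by (intro hull_minimal K)
  then show ?thesis using x by blast
qed

lemma tensor_relationsI:
  defines "P \<equiv> free_module R (carrier M \<times> carrier F)"
  shows "m \<in> carrier M \<Longrightarrow> m' \<in> carrier M \<Longrightarrow> n \<in> carrier F \<Longrightarrow>
      free_gen R (m \<oplus>\<^bsub>M\<^esub> m', n) \<ominus>\<^bsub>P\<^esub> (free_gen R (m, n) \<oplus>\<^bsub>P\<^esub> free_gen R (m', n)) \<in> tensor_relations R M F"
    and "m \<in> carrier M \<Longrightarrow> n \<in> carrier F \<Longrightarrow> n' \<in> carrier F \<Longrightarrow>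
      free_gen R (m, n \<oplus>\<^bsub>F\<^esub> n') \<ominus>\<^bsub>P\<^esub> (free_gen R (m, n) \<oplus>\<^bsub>P\<^esub> free_gen R (m, n')) \<in> tensor_relations R M F"
    and "r \<in> carrier R \<Longrightarrow> m \<in> carrier M \<Longrightarrow> n \<in> carrier F \<Longrightarrow>
      free_gen R (r \<odot>\<^bsub>M\<^esub> m, n) \<ominus>\<^bsub>P\<^esub> r \<odot>\<^bsub>P\<^esub> free_gen R (m, n) \<in> tensor_relations R M F"
    and "r \<in> carrier R \<Longrightarrow> m \<in> carrier M \<Longrightarrow> n \<in> carrier F \<Longrightarrow>
      free_gen R (m, r \<odot>\<^bsub>F\<^esub> n) \<ominus>\<^bsub>P\<^esub> r \<odot>\<^bsub>P\<^esub> free_gen R (m, n) \<in> tensor_relations R M F"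
proof -
  have "tensor_gen_relations R M F \<subseteq> tensor_relations R M F"
    unfolding tensor_relations_def by (rule hull_subset)
  then have *: "x \<in> tensor_relations R M F" if "x \<in> tensor_gen_relations R M F" for x using that by blast
  show "m \<in> carrier M \<Longrightarrow> m' \<in> carrier M \<Longrightarrow> n \<in> carrier F \<Longrightarrow>
      free_gen R (m \<oplus>\<^bsub>M\<^esub> m', n) \<ominus>\<^bsub>P\<^esub> (free_gen R (m, n) \<oplus>\<^bsub>P\<^esub> free_gen R (m', n)) \<in> tensor_relations R M F"
    by (rule *) (unfold tensor_gen_relations_def Let_def P_def, blast)
  show "m \<in> carrier M \<Longrightarrow> n \<in> carrier F \<Longrightarrow> n' \<in> carrier F \<Longrightarrow>
      free_gen R (m, n \<oplus>\<^bsub>F\<^esub> n') \<ominus>\<^bsub>P\<^esub> (free_gen R (m, n) \<oplus>\<^bsub>P\<^esub> free_gen R (m, n')) \<in> tensor_relations R M F"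
    by (rule *) (unfold tensor_gen_relations_def Let_def P_def, blast)
  show "r \<in> carrier R \<Longrightarrow> m \<in> carrier M \<Longrightarrow> n \<in> carrier F \<Longrightarrow>
      free_gen R (r \<odot>\<^bsub>M\<^esub> m, n) \<ominus>\<^bsub>P\<^esub> r \<odot>\<^bsub>P\<^esub> free_gen R (m, n) \<in> tensor_relations R M F"
    by (rule *) (unfold tensor_gen_relations_def Let_def P_def, blast)
  show "r \<in> carrier R \<Longrightarrow> m \<in> carrier M \<Longrightarrow> n \<in> carrier F \<Longrightarrow>
      free_gen R (m, r \<odot>\<^bsub>F\<^esub> n) \<ominus>\<^bsub>P\<^esub> r \<odot>\<^bsub>P\<^esub> free_gen R (m, n) \<in> tensor_relations R M F"
    by (rule *) (unfold tensor_gen_relations_def Let_def P_def, blast)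
qed

end

lemma submodule_coset_self:
  assumes P: "module R P" and T: "submodule T R P" and w: "w \<in> T"
  shows "T +>\<^bsub>P\<^esub> w = T"
proof -
  interpret P: module R P by fact
  note sub = submodule_simps[OF P T]
  show ?thesis
  proof
    show "T +>\<^bsub>P\<^esub> w \<subseteq> T" using sub(3)[OF _ w] by (auto simp: a_r_coset_def')
    show "T \<subseteq> T +>\<^bsub>P\<^esub> w"
    proof
      fix h assume h: "h \<in> T"
      then have "h = (h \<ominus>\<^bsub>P\<^esub> w) \<oplus>\<^bsub>P\<^esub> w" using w sub(1) by (simp add: P.minus_add_cancel)
      then show "h \<in> T +>\<^bsub>P\<^esub> w" unfolding a_r_coset_def' using sub(6)[OF h w] by blast
    qed
  qed
qed

lemma tensor_relations_of_inj_tensor_map: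
  assumes M: "module R M" and N: "module R N" and F: "module R F"
    and f: "f \<in> carrier (hom_module R M N)"
    and inj: "inj_on (tensor_map R N F f) (carrier (tensor R M F))"
    and z: "z \<in> carrier (free_module R (carrier M \<times> carrier F))"
    and fz: "linear_ext R (free_module R (carrier N \<times> carrier F)) (\<lambda>(m, x). free_gen R (f m, x)) z
      \<in> tensor_relations R N F"
  shows "z \<in> tensor_relations R M F"
proof -
  define P where "P = free_module R (carrier M \<times> carrier F)"
  define Q where "Q = free_module R (carrier N \<times> carrier F)"
  define S where "S = tensor_relations R M F"
  define T where "T = tensor_relations R N F"
  let ?b = "\<lambda>(m, x). free_gen R (f m, x)"
  let ?L = "linear_ext R Q ?b"
  have PM: "module R P" and QM: "module R Q" unfolding P_def Q_def by (rule free_module_is_module)+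
  interpret P: module R P by fact
  interpret Q: module R Q by fact
  have S: "submodule S R P" unfolding S_def P_def by (rule tensor_relations_submodule[OF M F])
  have T: "submodule T R Q" unfolding T_def Q_def by (rule tensor_relations_submodule[OF N F])
  note ssub = submodule_simps[OF PM S] and tsub = submodule_simps[OF QM T]
  have lf: "linear_map R M N f" using f unfolding carrier_hom_module by blast
  have bP: "?b \<in> carrier M \<times> carrier F \<rightarrow> carrier Q"
    using linear_map_closed[OF lf] by (auto simp: Q_def intro!: free_gen_closed)
  have L: "linear_map R P Q ?L" unfolding P_def by (rule linear_ext_linear[OF QM bP])
  have LS: "?L x \<in> T" if "x \<in> S" for x
    using that unfolding S_def
  proof (rule tensor_relations_linear_ext[OF M F QM T, rotated -1])
    fix m n assume "m \<in> carrier M" "n \<in> carrier F"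
    then show "?b (m, n) \<in> carrier Q" using bP by blast
  qed (use tensor_relationsI[OF N F] in \<open>simp_all add: linear_map_add[OF lf] linear_map_smult[OF lf]
        linear_map_closed[OF lf] T_def Q_def\<close>)
  have tm: "tensor_map R N F f (S +>\<^bsub>P\<^esub> w) = T" if w: "w \<in> carrier P" "?L w \<in> T" for w
  proof -
    have "T +>\<^bsub>Q\<^esub> ?L v = T" if "v \<in> S +>\<^bsub>P\<^esub> w" for v
    proof -
      from that obtain s where s: "s \<in> S" "v = s \<oplus>\<^bsub>P\<^esub> w" by (auto simp: a_r_coset_def')
      then have "?L v = ?L s \<oplus>\<^bsub>Q\<^esub> ?L w" using linear_map_add[OF L ssub(1)[OF s(1)] w(1)] by simp
      then have "?L v \<in> T" using tsub(3)[OF LS[OF s(1)] w(2)] by simp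
      then show ?thesis by (rule submodule_coset_self[OF QM T])
    qed
    moreover have "\<zero>\<^bsub>P\<^esub> \<oplus>\<^bsub>P\<^esub> w \<in> S +>\<^bsub>P\<^esub> w" using ssub(2) unfolding a_r_coset_def' by blast
    ultimately show ?thesis unfolding tensor_map_def Let_def Q_def[symmetric] T_def[symmetric] by blast
  qed
  have carr: "S +>\<^bsub>P\<^esub> w \<in> carrier (tensor R M F)" if "w \<in> carrier P" for w
    unfolding tensor_def quotient_module_def using that
    by (auto simp: A_RCOSETS_def' S_def[symmetric] P_def[symmetric])
  have zP: "z \<in> carrier P" using z by (simp add: P_def)
  have "?L z \<in> T" using fz by (simp add: Q_def T_def)
  moreover have "?L \<zero>\<^bsub>P\<^esub> \<in> T" using linear_map_zero[OF PM QM L] tsub(2) by simp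
  ultimately have "S +>\<^bsub>P\<^esub> z = S +>\<^bsub>P\<^esub> \<zero>\<^bsub>P\<^esub>"
    using inj_onD[OF inj _ carr[OF zP] carr[OF P.zero_closed]] tm zP by simp
  also have "\<dots> = S" by (rule submodule_coset_self[OF PM S ssub(2)])
  finally have "S +>\<^bsub>P\<^esub> z = S" .
  moreover have "\<zero>\<^bsub>P\<^esub> \<oplus>\<^bsub>P\<^esub> z \<in> S +>\<^bsub>P\<^esub> z" using ssub(2) unfolding a_r_coset_def' by blast
  ultimately show ?thesis using zP by (simp add: S_def)
qed

text \<open>The ideal \<open>I\<close> as a test module on the type over which \<^const>\<open>flat_module\<close> quantifies; \<open>a\<close> is encoded
  as the singleton of the constant sequence \<open>a\<close>.\<close>

definition ideal_module :: "'a set \<Rightarrow> ('a, (nat \<Rightarrow> 'a) set) module"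
  where "ideal_module I =
    \<lparr>carrier = (\<lambda>a. {\<lambda>n. a}) ` I, mult = undefined, one = undefined, zero = {\<lambda>n. \<zero>},
     add = (\<lambda>A B. {\<lambda>n. the_elem A n \<oplus> the_elem B n}), smult = (\<lambda>r A. {\<lambda>n. r \<otimes> the_elem A n})\<rparr>"

lemma ideal_module_is_module:
  assumes "ideal I R" shows "module R (ideal_module I)"
proof -
  interpret I: ideal I R by fact
  have c: "a \<in> carrier R" if "a \<in> I" for a using that I.Icarr by simp
  have "abelian_group (ideal_module I)"
  proof (rule abelian_groupI)
    fix x assume "x \<in> carrier (ideal_module I)"
    then obtain a where a: "a \<in> I" "x = {\<lambda>n. a}" by (auto simp: ideal_module_def)
    then show "\<exists>y\<in>carrier (ideal_module I). y \<oplus>\<^bsub>ideal_module I\<^esub> x = \<zero>\<^bsub>ideal_module I\<^esub>"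
      using c[OF a(1)] by (intro bexI[of _ "{\<lambda>n. \<ominus> a}"]) (auto simp: ideal_module_def l_neg)
  qed (auto simp: ideal_module_def c a_assoc a_comm a_lcomm)
  then show ?thesis
    by (intro moduleI is_cring) (auto simp: ideal_module_def c I.I_l_closed l_distr r_distr m_assoc)
qed

text \<open>The values at \<open>y\<close> of all linear maps from the free module to \<open>G\<close>. They form the submodule
  \<open>JG\<close> for the ideal \<open>J\<close> generated by the coefficients of \<open>y\<close>, and \<open>G\<close> is locally retractable if and only
  if \<open>y \<in> hom_values X G y\<close> for all \<open>y \<in> G\<close>.\<close>

definition hom_values :: "'x set \<Rightarrow> ('x \<Rightarrow> 'a) set \<Rightarrow> ('x \<Rightarrow> 'a) \<Rightarrow> ('x \<Rightarrow> 'a) set"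
  where "hom_values X G y = {\<theta> y | \<theta>. linear_map R (free_module R X) (free_module R X) \<theta> \<and>
    (\<forall>x \<in> carrier (free_module R X). \<theta> x \<in> G)}"

lemma
  fixes X :: "'x set"
  defines "P \<equiv> free_module R X"
  assumes sG: "submodule G R P" and y: "y \<in> carrier P"
  shows hom_values_submodule: "submodule (hom_values X G y) R P"
    and coefficient_ideal_smult_in_hom_values:
      "c \<in> Idl (range y) \<Longrightarrow> g \<in> G \<Longrightarrow> c \<odot>\<^bsub>P\<^esub> g \<in> hom_values X G y"
proof -
  have PM: "module R P" unfolding P_def by (rule free_module_is_module)
  interpret P: module R P by fact
  note sub = submodule_simps[OF PM sG]
  have yR: "y t \<in> carrier R" for t using y by (simp add: P_def mem_free_module)
  have fin: "finite {u. y u \<noteq> \<zero>}" using y by (simp add: P_def mem_free_module)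
  define W where W_alt: "W = hom_values X G y"
  have W_def: "W = {\<theta> y | \<theta>. linear_map R P P \<theta> \<and> (\<forall>x \<in> carrier P. \<theta> x \<in> G)}"
    by (simp add: W_alt hom_values_def P_def)
  have W: "submodule W R P"
  proof (rule submodule_of_closedI[OF PM])
    show "W \<subseteq> carrier P" using y by (auto simp: W_def linear_map_closed)
    show "\<zero>\<^bsub>P\<^esub> \<in> W" unfolding W_def using linear_map_zerof[OF PM, of P] sub(2)
      by (intro CollectI exI[of _ "\<lambda>x. \<zero>\<^bsub>P\<^esub>"]) simp
  next
    fix u v assume "u \<in> W" "v \<in> W"
    then obtain \<theta> \<eta> where "u = \<theta> y" "v = \<eta> y" and t: "linear_map R P P \<theta>" "\<forall>x \<in> carrier P. \<theta> x \<in> G"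
      and h: "linear_map R P P \<eta>" "\<forall>x \<in> carrier P. \<eta> x \<in> G" by (auto simp: W_def)
    then show "u \<oplus>\<^bsub>P\<^esub> v \<in> W" unfolding W_def using linear_map_addf[OF PM t(1) h(1)] sub(3)
      by (intro CollectI exI[of _ "\<lambda>x. \<theta> x \<oplus>\<^bsub>P\<^esub> \<eta> x"]) simp
  next
    fix r u assume r: "r \<in> carrier R" and "u \<in> W"
    then obtain \<theta> where "u = \<theta> y" and t: "linear_map R P P \<theta>" "\<forall>x \<in> carrier P. \<theta> x \<in> G"
      by (auto simp: W_def)
    then show "r \<odot>\<^bsub>P\<^esub> u \<in> W" unfolding W_def using linear_map_smultf[OF PM t(1) r] sub(4)[OF r]
      by (intro CollectI exI[of _ "\<lambda>x. r \<odot>\<^bsub>P\<^esub> \<theta> x"]) simp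
  qed
  note wsub = submodule_simps[OF PM W]
  have yW: "y t \<odot>\<^bsub>P\<^esub> g \<in> W" if t: "t \<in> X" and g: "g \<in> G" for t g
  proof -
    let ?h = "\<lambda>u. if u = t then g else \<zero>\<^bsub>P\<^esub>"
    have h: "?h \<in> X \<rightarrow> carrier P" using sub(1)[OF g] by simp
    have l: "linear_map R P P (linear_ext R P ?h)" using linear_ext_linear[OF PM h] by (simp add: P_def)
    have im: "linear_ext R P ?h x \<in> G" if "x \<in> carrier P" for x
      by (rule linear_map_in_submodule_on_support[OF PM linear_ext_linear[OF PM h] sG])
        (use that free_support[of x X] g sub(2) in \<open>auto simp: P_def[symmetric] linear_ext_gen[OF PM h]\<close>)
    have "linear_ext R P ?h y = y t \<odot>\<^bsub>P\<^esub> g"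
    proof -
      have "linear_ext R P ?h y = (\<Oplus>\<^bsub>P\<^esub> u \<in> insert t {u. y u \<noteq> \<zero>}. y u \<odot>\<^bsub>P\<^esub> ?h u)"
        by (rule linear_ext_superset[OF PM h]) (use y t in \<open>auto simp: P_def mem_free_module\<close>)
      also have "\<dots> = (\<Oplus>\<^bsub>P\<^esub> u \<in> insert t {u. y u \<noteq> \<zero>}. if t = u then y u \<odot>\<^bsub>P\<^esub> g else \<zero>\<^bsub>P\<^esub>)"
        using sub(1)[OF g] yR by (intro P.finsum_cong') auto
      also have "\<dots> = y t \<odot>\<^bsub>P\<^esub> g"
        using sub(1)[OF g] yR fin by (intro P.finsum_singleton) auto
      finally show ?thesis .
    qed
    then show ?thesis unfolding W_def
      by (intro CollectI exI[of _ "linear_ext R P ?h"] conjI ballI im l) (rule sym)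
  qed
  have "Idl (range y) \<subseteq> {c \<in> carrier R. \<forall>g \<in> G. c \<odot>\<^bsub>P\<^esub> g \<in> W}"
  proof (rule genideal_minimal)
    show "ideal {c \<in> carrier R. \<forall>g \<in> G. c \<odot>\<^bsub>P\<^esub> g \<in> W} R"
    proof (rule idealI[OF ring_axioms])
      show "subgroup {c \<in> carrier R. \<forall>g\<in>G. c \<odot>\<^bsub>P\<^esub> g \<in> W} (add_monoid R)"
      proof (rule add.subgroupI)
        show "{c \<in> carrier R. \<forall>g\<in>G. c \<odot>\<^bsub>P\<^esub> g \<in> W} \<noteq> {}"
          using wsub(2) sub(1) by (intro ex_in_conv[THEN iffD1] exI[of _ \<zero>]) simp
      qed (use wsub(3,5) sub(1) in \<open>auto simp: a_inv_def[symmetric] P.smult_l_minus P.smult_l_distr\<close>)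
    qed (use wsub(4) sub(1,4) in \<open>auto simp: P.smult_assoc1\<close>)
    show "range y \<subseteq> {c \<in> carrier R. \<forall>g \<in> G. c \<odot>\<^bsub>P\<^esub> g \<in> W}"
    proof clarify
      fix t show "y t \<in> carrier R \<and> (\<forall>g \<in> G. y t \<odot>\<^bsub>P\<^esub> g \<in> W)"
      proof (cases "t \<in> X")
        case False
        then have "y t = \<zero>" using y by (simp add: P_def mem_free_module)
        then show ?thesis using wsub(2) sub(1) by simp
      qed (use yW yR in blast)
    qed
  qed
  then show "c \<odot>\<^bsub>P\<^esub> g \<in> hom_values X G y" if "c \<in> Idl (range y)" "g \<in> G" for c g
    using that unfolding W_alt[symmetric] by blast
  show "submodule (hom_values X G y) R P" using W by (simp add: W_alt)
qed

text \<open>Let \<open>y \<in> G\<close>, and let \<open>I\<close> be the ideal generated by its coefficients \<open>y\<^sub>t\<close>. The element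
  \<open>\<Sum>\<^sub>t y\<^sub>t \<otimes> \<alpha> e\<^sub>t\<close> of \<open>I \<otimes> F\<close> becomes \<open>1 \<otimes> \<alpha> y = 0\<close> in \<open>R \<otimes> F\<close>, so by flatness it is zero. On the other
  hand, choosing preimages under \<open>\<alpha>\<close> defines a map from \<open>I \<otimes> F\<close> to \<open>P / IG\<close> which sends this element to
  the class of \<open>y\<close>. So \<open>y \<in> IG\<close>, and \<open>IG\<close> consists of values at \<open>y\<close> of maps from \<open>P\<close> to \<open>G\<close>.\<close>

lemma flat_module_locally_retract:
  fixes F :: "('a, 'f) module" and X :: "'x set"
  defines "P \<equiv> free_module R X"
  assumes flat: "flat_module R F" and \<alpha>: "linear_map R P F \<alpha>" and onto: "\<alpha> ` carrier P = carrier F"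
  shows "locally_retract R P {x \<in> carrier P. \<alpha> x = \<zero>\<^bsub>F\<^esub>}"
proof -
  have F: "module R F" using flat by (simp add: flat_module_def)
  interpret F: module R F by fact
  have PM: "module R P" unfolding P_def by (rule free_module_is_module)
  interpret P: module R P by fact
  define G where "G = {x \<in> carrier P. \<alpha> x = \<zero>\<^bsub>F\<^esub>}"
  have sG: "submodule G R P" unfolding G_def by (rule linear_map_kernel[OF PM F \<alpha>])
  note sub = submodule_simps[OF PM sG]
  have e: "free_gen R t \<in> carrier P" if "t \<in> X" for t using that by (simp add: P_def free_gen_closed)
  have "\<exists>\<theta>. linear_map R P P \<theta> \<and> \<theta> ` carrier P \<subseteq> G \<and> \<theta> y = y" if yG: "y \<in> G" for y
  proof -
    have y: "y \<in> carrier P" using yG sub by simp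
    have yR: "y t \<in> carrier R" for t using y by (simp add: P_def mem_free_module)
    define W where "W = hom_values X G y"
    have W: "submodule W R P" unfolding W_def P_def by (rule hom_values_submodule) (use sG y in \<open>simp_all add: P_def\<close>)
    note wsub = submodule_simps[OF PM W]
    define I where "I = Idl (range y)"
    have I: "ideal I R" unfolding I_def by (rule genideal_ideal) (use yR in auto)
    interpret I: ideal I R by fact
    have yI: "y t \<in> I" for t using genideal_self[of "range y"] yR by (auto simp: I_def)
    have IW: "c \<odot>\<^bsub>P\<^esub> g \<in> W" if "c \<in> I" "g \<in> G" for c g
      unfolding W_def P_def
      by (rule coefficient_ideal_smult_in_hom_values) (use sG y that in \<open>simp_all add: P_def I_def\<close>)
    \<comment> \<open>The test map is the inclusion of \<open>I\<close> into \<open>R\<close>.\<close>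
    define M where "M = ideal_module I"
    define N where "N = ideal_module (carrier R)"
    have MM: "module R M" unfolding M_def by (rule ideal_module_is_module[OF I])
    have NM: "module R N" unfolding N_def by (rule ideal_module_is_module[OF oneideal])
    let ?\<iota> = "\<lambda>a. {\<lambda>n::nat. a}"
    have \<iota>M: "?\<iota> c \<in> carrier M \<longleftrightarrow> c \<in> I" for c by (auto simp: M_def ideal_module_def fun_eq_iff)
    have \<iota>N: "?\<iota> c \<in> carrier N \<longleftrightarrow> c \<in> carrier R" for c by (auto simp: N_def ideal_module_def fun_eq_iff)
    define f where "f = restrict (\<lambda>x. x) (carrier M)"
    have f: "f \<in> carrier (hom_module R M N)"
      unfolding carrier_hom_module
    proof
      show "linear_map R M N f"
        by (rule linear_map_cong[OF MM, of _ "\<lambda>x. x"], rule linear_mapI)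
          (auto simp: M_def N_def ideal_module_def f_def I.Icarr)
    qed (simp add: f_def)
    have "inj_on f (carrier M)" by (simp add: f_def inj_on_def)
    then have inj: "inj_on (tensor_map R N F f) (carrier (tensor R M F))"
      using flat MM NM f unfolding flat_module_def by blast
    define PM' where "PM' = free_module R (carrier M \<times> carrier F)"
    define PN where "PN = free_module R (carrier N \<times> carrier F)"
    have PMm: "module R PM'" and PNm: "module R PN" unfolding PM'_def PN_def by (rule free_module_is_module)+
    interpret PN: module R PN by fact
    let ?T = "tensor_relations R N F"
    have T: "submodule ?T R PN" unfolding PN_def by (rule tensor_relations_submodule[OF NM F])
    have \<alpha>e: "\<alpha> (free_gen R t) \<in> carrier F" if "t \<in> X" for t by (rule linear_map_closed[OF \<alpha> e[OF that]])
    let ?k = "\<lambda>t. free_gen R (?\<iota> (y t), \<alpha> (free_gen R t))"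
    have k: "?k \<in> X \<rightarrow> carrier PM'"
      using yI \<alpha>e by (auto simp: PM'_def \<iota>M intro!: free_gen_closed)
    define L where "L = linear_ext R PM' ?k"
    have L: "linear_map R P PM' L" unfolding P_def L_def by (rule linear_ext_linear[OF PMm k])
    have Le: "L (free_gen R t) = ?k t" if "t \<in> X" for t
      unfolding L_def by (rule linear_ext_gen[OF PMm k that])
    \<comment> \<open>\<open>L one\<close> represents \<open>\<Sum>\<^sub>t y\<^sub>t \<otimes> \<alpha> e\<^sub>t\<close>, the sum being taken over the support of \<open>y\<close>. Being the value of
      a linear map at \<open>one\<close>, it can be handled by comparing linear maps on the basis.\<close>
    define one where "one = (\<lambda>t. if y t = \<zero> then \<zero> else \<one>)"
    have "{t. one t \<noteq> \<zero>} \<subseteq> {t. y t \<noteq> \<zero>}" by (auto simp: one_def)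
    then have one: "one \<in> carrier P"
      using y by (auto simp: P_def mem_free_module one_def intro: finite_subset)
    define D where "D = (\<lambda>x t. y t \<otimes> x t)"
    have D: "linear_map R P P D"
    proof (rule linear_mapI)
      fix x assume x: "x \<in> carrier P"
      have "{t. y t \<otimes> x t \<noteq> \<zero>} \<subseteq> {t. x t \<noteq> \<zero>}" using yR by auto
      then show "D x \<in> carrier P"
        using x yR by (auto simp: D_def P_def mem_free_module intro: finite_subset)
    qed (use yR in \<open>auto simp: D_def P_def mem_free_module free_module_simps r_distr m_lcomm\<close>)
    have De: "D (free_gen R t) = y t \<odot>\<^bsub>P\<^esub> free_gen R t" for t
      using yR by (auto simp: D_def P_def free_module_simps free_gen_def)
    have D1: "D one = y" using yR by (auto simp: D_def one_def)
    \<comment> \<open>In \<open>R \<otimes> F = F\<close> the element \<open>L one\<close> becomes \<open>\<alpha> y = 0\<close>.\<close>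
    let ?b = "\<lambda>(m, x). free_gen R (f m, x)"
    have bN: "?b \<in> carrier M \<times> carrier F \<rightarrow> carrier PN"
      by (auto simp: PN_def f_def M_def N_def ideal_module_def I.Icarr intro!: free_gen_closed)
    have b: "linear_map R PM' PN (linear_ext R PN ?b)"
      unfolding PM'_def by (rule linear_ext_linear[OF PNm bN])
    have L1: "L one \<in> tensor_relations R M F"
    proof (rule tensor_relations_of_inj_tensor_map[OF MM NM F f inj])
      show "L one \<in> carrier (free_module R (carrier M \<times> carrier F))"
        using linear_map_closed[OF L one] by (simp add: PM'_def)
      obtain Q :: "('a, (nat \<Rightarrow> 'a) set \<times> 'f \<Rightarrow> 'a) module" and \<pi> where Q: "module R Q" and \<pi>: "linear_map R PN Q \<pi>"
        and ker: "{x \<in> carrier PN. \<pi> x = \<zero>\<^bsub>Q\<^esub>} = ?T"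
        by (rule quotient_on_same_type[OF PNm T]) (rule that; assumption)
      interpret Q: module R Q by fact
      have eqI: "\<pi> u = \<pi> v" if "u \<ominus>\<^bsub>PN\<^esub> v \<in> ?T" "u \<in> carrier PN" "v \<in> carrier PN" for u v
      proof -
        have "\<pi> (u \<ominus>\<^bsub>PN\<^esub> v) = \<zero>\<^bsub>Q\<^esub>" using that(1) unfolding ker[symmetric] by blast
        then show ?thesis using linear_map_minus[OF PNm Q \<pi> that(2,3)]
          by (intro Q.minus_eq_zeroD[OF linear_map_closed[OF \<pi> that(2)] linear_map_closed[OF \<pi> that(3)]]) simp
      qed
      define \<beta> where "\<beta> = (\<lambda>x. \<pi> (free_gen R (?\<iota> \<one>, x)))"
      have g1: "free_gen R (?\<iota> r, x) \<in> carrier PN" if "r \<in> carrier R" "x \<in> carrier F" for r x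
        using that by (auto simp: PN_def \<iota>N intro!: free_gen_closed)
      note rel = tensor_relationsI[OF NM F, folded PN_def]
      have 1: "?\<iota> \<one> \<in> carrier N" by (simp add: \<iota>N)
      have \<beta>: "linear_map R F Q \<beta>"
      proof (rule linear_mapI)
        fix x assume "x \<in> carrier F"
        then show "\<beta> x \<in> carrier Q" unfolding \<beta>_def by (intro linear_map_closed[OF \<pi>] g1) simp_all
      next
        fix x x' assume x: "x \<in> carrier F" "x' \<in> carrier F"
        have "\<beta> (x \<oplus>\<^bsub>F\<^esub> x') = \<pi> (free_gen R (?\<iota> \<one>, x) \<oplus>\<^bsub>PN\<^esub> free_gen R (?\<iota> \<one>, x'))"
          unfolding \<beta>_def by (rule eqI[OF rel(2)[OF 1 x]]) (use x g1 in simp_all)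
        then show "\<beta> (x \<oplus>\<^bsub>F\<^esub> x') = \<beta> x \<oplus>\<^bsub>Q\<^esub> \<beta> x'"
          unfolding \<beta>_def using x g1 by (simp add: linear_map_add[OF \<pi>])
      next
        fix r x assume x: "r \<in> carrier R" "x \<in> carrier F"
        have "\<beta> (r \<odot>\<^bsub>F\<^esub> x) = \<pi> (r \<odot>\<^bsub>PN\<^esub> free_gen R (?\<iota> \<one>, x))"
          unfolding \<beta>_def by (rule eqI[OF rel(4)[OF x(1) 1 x(2)]]) (use x g1 in simp_all)
        then show "\<beta> (r \<odot>\<^bsub>F\<^esub> x) = r \<odot>\<^bsub>Q\<^esub> \<beta> x"
          unfolding \<beta>_def using x g1 by (simp add: linear_map_smult[OF \<pi>])
      qed
      have "\<pi> (linear_ext R PN ?b (L one)) = \<beta> (\<alpha> (D one))"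
      proof (rule linear_map_free_eqI[OF Q, where X = X and y = one, folded P_def])
        show "linear_map R P Q (\<lambda>x. \<pi> (linear_ext R PN ?b (L x)))"
          by (rule linear_map_compose[OF linear_map_compose[OF L b] \<pi>])
        show "linear_map R P Q (\<lambda>x. \<beta> (\<alpha> (D x)))"
          by (rule linear_map_compose[OF linear_map_compose[OF D \<alpha>] \<beta>])
        show "one \<in> carrier P" by (rule one)
        fix t assume t: "t \<in> X"
        have yt: "?\<iota> (y t) \<in> carrier M" using yI by (simp add: \<iota>M)
        have "linear_ext R PN ?b (L (free_gen R t)) = free_gen R (f (?\<iota> (y t)), \<alpha> (free_gen R t))"
          unfolding Le[OF t] using linear_ext_gen[OF PNm bN, of "(?\<iota> (y t), \<alpha> (free_gen R t))"] yt \<alpha>e[OF t] by simp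
        also have "f (?\<iota> (y t)) = y t \<odot>\<^bsub>N\<^esub> ?\<iota> \<one>"
          using yt yR by (simp add: f_def N_def ideal_module_def)
        finally have "\<pi> (linear_ext R PN ?b (L (free_gen R t))) =
            \<pi> (free_gen R (y t \<odot>\<^bsub>N\<^esub> ?\<iota> \<one>, \<alpha> (free_gen R t)))" by simp
        also have "\<dots> = \<pi> (y t \<odot>\<^bsub>PN\<^esub> free_gen R (?\<iota> \<one>, \<alpha> (free_gen R t)))"
        proof (rule eqI[OF rel(3)[OF yR 1 \<alpha>e[OF t]]])
          have "y t \<odot>\<^bsub>N\<^esub> ?\<iota> \<one> = ?\<iota> (y t)" using yR by (simp add: N_def ideal_module_def)
          then show "free_gen R (y t \<odot>\<^bsub>N\<^esub> ?\<iota> \<one>, \<alpha> (free_gen R t)) \<in> carrier PN"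
            using g1[OF yR \<alpha>e[OF t]] by simp
        qed (use g1 yR \<alpha>e[OF t] in simp)
        also have "\<dots> = y t \<odot>\<^bsub>Q\<^esub> \<beta> (\<alpha> (free_gen R t))"
          unfolding \<beta>_def by (rule linear_map_smult[OF \<pi> yR g1]) (use \<alpha>e[OF t] in simp_all)
        also have "\<dots> = \<beta> (\<alpha> (D (free_gen R t)))"
          unfolding De using linear_map_smult[OF \<alpha> yR e[OF t]] linear_map_smult[OF \<beta> yR \<alpha>e[OF t]] by simp
        finally show "\<pi> (linear_ext R PN ?b (L (free_gen R t))) = \<beta> (\<alpha> (D (free_gen R t)))" .
      qed
      also have "\<dots> = \<zero>\<^bsub>Q\<^esub>" unfolding D1 using yG linear_map_zero[OF F Q \<beta>] by (simp add: G_def)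
      finally have "linear_ext R PN ?b (L one) \<in> ?T"
        unfolding ker[symmetric] using linear_map_closed[OF b linear_map_closed[OF L one]] by simp
      then show "linear_ext R (free_module R (carrier N \<times> carrier F)) ?b (L one) \<in> ?T" by (simp add: PN_def)
    qed
    \<comment> \<open>Lifting \<open>F\<close> to \<open>P\<close> carries \<open>I \<otimes> F\<close> into \<open>P\<close> modulo \<open>W\<close>, and \<open>L one\<close> to \<open>y\<close>.\<close>
    have "\<forall>x \<in> carrier F. \<exists>u. u \<in> carrier P \<and> \<alpha> u = x" using onto by (metis imageE)
    then obtain l where l: "\<And>x. x \<in> carrier F \<Longrightarrow> l x \<in> carrier P" "\<And>x. x \<in> carrier F \<Longrightarrow> \<alpha> (l x) = x" by metis
    define c where "c = (\<lambda>(m :: (nat \<Rightarrow> 'a) set, x). the_elem m 0 \<odot>\<^bsub>P\<^esub> l x)"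
    have c: "c (m, x) \<in> carrier P" if "m \<in> carrier M" "x \<in> carrier F" for m x
      using that l by (auto simp: c_def M_def ideal_module_def I.Icarr)
    have cX: "c \<in> carrier M \<times> carrier F \<rightarrow> carrier P" using c by auto
    have Lc: "linear_map R PM' P (linear_ext R P c)" unfolding PM'_def by (rule linear_ext_linear[OF PM cX])
    have "linear_ext R P c (L one) \<in> W"
    proof (rule tensor_relations_linear_ext[where b = c, OF MM F PM W _ _ _ _ _ L1])
      show "c (m, n) \<in> carrier P" if "m \<in> carrier M" "n \<in> carrier F" for m n by (rule c[OF that])
    next
      fix m m' n assume "m \<in> carrier M" "m' \<in> carrier M" and n: "n \<in> carrier F"
      then obtain a a' where a: "m = ?\<iota> a" "m' = ?\<iota> a'" "a \<in> I" "a' \<in> I" by (auto simp: M_def ideal_module_def)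
      then have "c (m \<oplus>\<^bsub>M\<^esub> m', n) = c (m, n) \<oplus>\<^bsub>P\<^esub> c (m', n)"
        using l(1)[OF n] by (simp add: c_def M_def ideal_module_def I.Icarr P.smult_l_distr)
      then show "c (m \<oplus>\<^bsub>M\<^esub> m', n) \<ominus>\<^bsub>P\<^esub> (c (m, n) \<oplus>\<^bsub>P\<^esub> c (m', n)) \<in> W"
        using c[of m n] c[of m' n] a n wsub(2) by (simp add: \<iota>M P.minus_self)
    next
      fix m n n' assume "m \<in> carrier M" and n: "n \<in> carrier F" "n' \<in> carrier F"
      then obtain a where a: "m = ?\<iota> a" "a \<in> I" by (auto simp: M_def ideal_module_def)
      have "l (n \<oplus>\<^bsub>F\<^esub> n') \<ominus>\<^bsub>P\<^esub> (l n \<oplus>\<^bsub>P\<^esub> l n') \<in> G"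
        unfolding G_def using n l by (simp add: linear_map_minus[OF PM F \<alpha>] linear_map_add[OF \<alpha>] F.minus_self)
      then have "a \<odot>\<^bsub>P\<^esub> (l (n \<oplus>\<^bsub>F\<^esub> n') \<ominus>\<^bsub>P\<^esub> (l n \<oplus>\<^bsub>P\<^esub> l n')) \<in> W" by (rule IW[OF a(2)])
      then show "c (m, n \<oplus>\<^bsub>F\<^esub> n') \<ominus>\<^bsub>P\<^esub> (c (m, n) \<oplus>\<^bsub>P\<^esub> c (m, n')) \<in> W"
        using n l(1) a by (simp add: c_def I.Icarr P.smult_r_diff P.smult_r_distr)
    next
      fix r m n assume r: "r \<in> carrier R" and "m \<in> carrier M" and n: "n \<in> carrier F"
      then obtain a where a: "m = ?\<iota> a" "a \<in> I" by (auto simp: M_def ideal_module_def)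
      have "c (r \<odot>\<^bsub>M\<^esub> m, n) = r \<odot>\<^bsub>P\<^esub> c (m, n)"
        using l(1)[OF n] r a by (simp add: c_def M_def ideal_module_def I.Icarr P.smult_assoc1)
      then show "c (r \<odot>\<^bsub>M\<^esub> m, n) \<ominus>\<^bsub>P\<^esub> r \<odot>\<^bsub>P\<^esub> c (m, n) \<in> W"
        using c[of m n] a n r wsub(2) by (simp add: \<iota>M P.minus_self)
      have "l (r \<odot>\<^bsub>F\<^esub> n) \<ominus>\<^bsub>P\<^esub> r \<odot>\<^bsub>P\<^esub> l n \<in> G"
        unfolding G_def using n l r by (simp add: linear_map_minus[OF PM F \<alpha>] linear_map_smult[OF \<alpha>] F.minus_self)
      then have "a \<odot>\<^bsub>P\<^esub> (l (r \<odot>\<^bsub>F\<^esub> n) \<ominus>\<^bsub>P\<^esub> r \<odot>\<^bsub>P\<^esub> l n) \<in> W" by (rule IW[OF a(2)])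
      then show "c (m, r \<odot>\<^bsub>F\<^esub> n) \<ominus>\<^bsub>P\<^esub> r \<odot>\<^bsub>P\<^esub> c (m, n) \<in> W"
        using n l(1) a r by (simp add: c_def I.Icarr P.smult_r_diff P.smult_commute[of a r])
    qed
    moreover have "linear_ext R P c (L one) \<ominus>\<^bsub>P\<^esub> D one \<in> W"
    proof (rule linear_map_in_submodule_on_support[OF PM _ W one[unfolded P_def]])
      show "linear_map R (free_module R X) P (\<lambda>x. linear_ext R P c (L x) \<ominus>\<^bsub>P\<^esub> D x)"
        unfolding P_def[symmetric] by (rule linear_map_minusf[OF PM linear_map_compose[OF L Lc] D])
      fix t assume "one t \<noteq> \<zero>"
      then have t: "t \<in> X" using one free_support by (simp add: P_def)
      have "linear_ext R P c (L (free_gen R t)) = y t \<odot>\<^bsub>P\<^esub> l (\<alpha> (free_gen R t))"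
        unfolding Le[OF t] using linear_ext_gen[OF PM cX, of "(?\<iota> (y t), \<alpha> (free_gen R t))"] yI \<alpha>e[OF t]
        by (simp add: \<iota>M c_def)
      then have "linear_ext R P c (L (free_gen R t)) \<ominus>\<^bsub>P\<^esub> D (free_gen R t) =
          y t \<odot>\<^bsub>P\<^esub> (l (\<alpha> (free_gen R t)) \<ominus>\<^bsub>P\<^esub> free_gen R t)"
        unfolding De using l(1)[OF \<alpha>e[OF t]] e[OF t] yR by (simp add: P.smult_r_diff)
      also have "\<dots> \<in> W"
        by (rule IW[OF yI]) (use l[OF \<alpha>e[OF t]] e[OF t] \<alpha>e[OF t] in \<open>simp add: G_def linear_map_minus[OF PM F \<alpha>] F.minus_self\<close>)
      finally show "linear_ext R P c (L (free_gen R t)) \<ominus>\<^bsub>P\<^esub> D (free_gen R t) \<in> W" .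
    qed
    ultimately have "linear_ext R P c (L one) \<ominus>\<^bsub>P\<^esub> (linear_ext R P c (L one) \<ominus>\<^bsub>P\<^esub> D one) \<in> W"
      by (rule wsub(6))
    then have "y \<in> W" using linear_map_closed[OF Lc linear_map_closed[OF L one]] y D1
      by (simp add: P.minus_minus_cancel)
    then obtain \<theta> where "y = \<theta> y" "linear_map R P P \<theta>" "\<forall>x \<in> carrier P. \<theta> x \<in> G"
      unfolding W_def hom_values_def P_def[symmetric] by blast
    then show ?thesis by (metis image_subsetI)
  qed
  then show ?thesis using sG unfolding locally_retract_def G_def by blast
qed

section \<open>Localizations\<close>

context
  fixes S assumes S: "submonoid S R"
begin

interpretation S: submonoid S R by (rule S)

lemma frac_rel_equiv: "equiv (carrier R \<times> S) (frac_rel R S)"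
proof (rule equivI)
  show "frac_rel R S \<subseteq> (carrier R \<times> S) \<times> (carrier R \<times> S)" by (auto simp: frac_rel_def)
  show "refl_on (carrier R \<times> S) (frac_rel R S)"
  proof (rule refl_onI)
    fix x assume "x \<in> carrier R \<times> S"
    then obtain a s where x: "x = (a, s)" "a \<in> carrier R" "s \<in> S" by auto
    have "\<one> \<otimes> (a \<otimes> s \<ominus> a \<otimes> s) = \<zero>" using x S.subset by (simp add: a_minus_def r_neg)
    then show "(x, x) \<in> frac_rel R S" using x S.one_closed unfolding frac_rel_def by blast
  qed
  show "sym (frac_rel R S)"
  proof (rule symI)
    fix x y assume "(x, y) \<in> frac_rel R S"
    then obtain a s b t u where x: "x = (a, s)" "y = (b, t)" "a \<in> carrier R" "b \<in> carrier R" "s \<in> S" "t \<in> S"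
      "u \<in> S" "u \<otimes> (a \<otimes> t \<ominus> b \<otimes> s) = \<zero>" unfolding frac_rel_def by blast
    have "u \<otimes> (b \<otimes> s \<ominus> a \<otimes> t) = \<ominus> (u \<otimes> (a \<otimes> t \<ominus> b \<otimes> s))"
    proof -
      have "s \<in> carrier R" "t \<in> carrier R" "u \<in> carrier R" using x(5-7) S.subset by auto
      then show ?thesis using x(3,4) by algebra
    qed
    then have "u \<otimes> (b \<otimes> s \<ominus> a \<otimes> t) = \<zero>" using x(8) by simp
    then show "(y, x) \<in> frac_rel R S" using x unfolding frac_rel_def by blast
  qed
  show "trans (frac_rel R S)"
  proof (rule transI)
    fix x y z assume "(x, y) \<in> frac_rel R S" "(y, z) \<in> frac_rel R S"
    then obtain a s b t u c r v where x: "x = (a, s)" "y = (b, t)" "z = (c, r)"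
      "a \<in> carrier R" "b \<in> carrier R" "c \<in> carrier R" "s \<in> S" "t \<in> S" "r \<in> S" "u \<in> S" "v \<in> S"
      "u \<otimes> (a \<otimes> t \<ominus> b \<otimes> s) = \<zero>" "v \<otimes> (b \<otimes> r \<ominus> c \<otimes> t) = \<zero>" unfolding frac_rel_def by blast
    have m: "s \<in> carrier R" "t \<in> carrier R" "r \<in> carrier R" "u \<in> carrier R" "v \<in> carrier R"
      using x(7-11) S.subset by auto
    have "(u \<otimes> v \<otimes> t) \<otimes> (a \<otimes> r \<ominus> c \<otimes> s) =
        v \<otimes> r \<otimes> (u \<otimes> (a \<otimes> t \<ominus> b \<otimes> s)) \<oplus> u \<otimes> s \<otimes> (v \<otimes> (b \<otimes> r \<ominus> c \<otimes> t))"
      using x(4-6) m by algebra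
    also have "\<dots> = \<zero>" unfolding x(12,13) using m by simp
    finally have "(u \<otimes> v \<otimes> t) \<otimes> (a \<otimes> r \<ominus> c \<otimes> s) = \<zero>" .
    moreover have "u \<otimes> v \<otimes> t \<in> S" using x by simp
    ultimately show "(x, z) \<in> frac_rel R S" using x(1,3-9) unfolding frac_rel_def by blast
  qed
qed

lemma fraction_eq_iff:
  assumes "a \<in> carrier R" "b \<in> carrier R" "s \<in> S" "t \<in> S"
  shows "fraction R S a s = fraction R S b t \<longleftrightarrow> (\<exists>u \<in> S. u \<otimes> (a \<otimes> t \<ominus> b \<otimes> s) = \<zero>)"
proof -
  have "fraction R S a s = fraction R S b t \<longleftrightarrow> ((a, s), (b, t)) \<in> frac_rel R S"
    unfolding fraction_def by (rule eq_equiv_class_iff[OF frac_rel_equiv]) (use assms in auto)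
  then show ?thesis using assms by (simp add: frac_rel_def)
qed

lemma fraction_eqI:
  assumes "a \<in> carrier R" "b \<in> carrier R" "s \<in> S" "t \<in> S" "a \<otimes> t = b \<otimes> s"
  shows "fraction R S a s = fraction R S b t"
proof -
  have "\<one> \<otimes> (a \<otimes> t \<ominus> b \<otimes> s) = \<zero>" using assms S.subset by (auto simp: a_minus_def r_neg)
  then show ?thesis using fraction_eq_iff[OF assms(1-4)] S.one_closed by blast
qed

lemma mem_fraction:
  assumes "a \<in> carrier R" "s \<in> S"
  shows "x \<in> fraction R S a s \<longleftrightarrow>
    (\<exists>b t. x = (b, t) \<and> b \<in> carrier R \<and> t \<in> S \<and> (\<exists>u \<in> S. u \<otimes> (a \<otimes> t \<ominus> b \<otimes> s) = \<zero>))"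
  using assms by (auto simp: fraction_def frac_rel_def)

lemma fraction_self: "a \<in> carrier R \<Longrightarrow> s \<in> S \<Longrightarrow> (a, s) \<in> fraction R S a s"
  unfolding fraction_def by (rule equiv_class_self[OF frac_rel_equiv]) simp

lemma carrier_localization: "carrier (localization R S) = {fraction R S a s | a s. a \<in> carrier R \<and> s \<in> S}"
  by (auto simp: localization_def quotient_def fraction_def)

lemma fraction_add:
  assumes a: "a \<in> carrier R" "s \<in> S" and b: "b \<in> carrier R" "t \<in> S"
  shows "fraction R S a s \<oplus>\<^bsub>localization R S\<^esub> fraction R S b t = fraction R S (a \<otimes> t \<oplus> b \<otimes> s) (s \<otimes> t)"
proof -
  have "fraction R S (a' \<otimes> t' \<oplus> b' \<otimes> s') (s' \<otimes> t') = fraction R S (a \<otimes> t \<oplus> b \<otimes> s) (s \<otimes> t)"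
    if "(a', s') \<in> fraction R S a s" "(b', t') \<in> fraction R S b t" for a' s' b' t'
  proof -
    from that obtain u v where x: "a' \<in> carrier R" "s' \<in> S" "b' \<in> carrier R" "t' \<in> S" "u \<in> S" "v \<in> S"
      "u \<otimes> (a \<otimes> s' \<ominus> a' \<otimes> s) = \<zero>" "v \<otimes> (b \<otimes> t' \<ominus> b' \<otimes> t) = \<zero>"
      unfolding mem_fraction[OF a] mem_fraction[OF b] by blast
    have m: "s \<in> carrier R" "t \<in> carrier R" "s' \<in> carrier R" "t' \<in> carrier R" "u \<in> carrier R" "v \<in> carrier R"
      using a b x S.subset by auto
    have "(u \<otimes> v) \<otimes> ((a \<otimes> t \<oplus> b \<otimes> s) \<otimes> (s' \<otimes> t') \<ominus> (a' \<otimes> t' \<oplus> b' \<otimes> s') \<otimes> (s \<otimes> t)) =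
      v \<otimes> t \<otimes> t' \<otimes> (u \<otimes> (a \<otimes> s' \<ominus> a' \<otimes> s)) \<oplus> u \<otimes> s \<otimes> s' \<otimes> (v \<otimes> (b \<otimes> t' \<ominus> b' \<otimes> t))"
      using a(1) b(1) x(1,3) m by algebra
    also have "\<dots> = \<zero>" unfolding x(7,8) using m by simp
    finally have "fraction R S (a \<otimes> t \<oplus> b \<otimes> s) (s \<otimes> t) = fraction R S (a' \<otimes> t' \<oplus> b' \<otimes> s') (s' \<otimes> t')"
      using a b x m by (subst fraction_eq_iff) auto
    then show ?thesis by simp
  qed
  then have *: "case x of (a', s') \<Rightarrow> case y of (b', t') \<Rightarrow>
      fraction R S (a' \<otimes> t' \<oplus> b' \<otimes> s') (s' \<otimes> t') = fraction R S (a \<otimes> t \<oplus> b \<otimes> s) (s \<otimes> t)"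
    if "x \<in> fraction R S a s" "y \<in> fraction R S b t" for x y using that by (cases x; cases y) simp
  have "fraction R S a s \<oplus>\<^bsub>localization R S\<^esub> fraction R S b t =
    (\<Union>x \<in> fraction R S a s. \<Union>y \<in> fraction R S b t. case x of (a', s') \<Rightarrow> case y of (b', t') \<Rightarrow>
      fraction R S (a' \<otimes> t' \<oplus> b' \<otimes> s') (s' \<otimes> t'))"
    by (auto simp: localization_def)
  also have "\<dots> = (\<Union>x \<in> fraction R S a s. \<Union>y \<in> fraction R S b t. fraction R S (a \<otimes> t \<oplus> b \<otimes> s) (s \<otimes> t))"
    by (intro SUP_cong refl) (use * in \<open>auto split: prod.splits\<close>)
  also have "\<dots> = fraction R S (a \<otimes> t \<oplus> b \<otimes> s) (s \<otimes> t)"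
    using fraction_self[OF a] fraction_self[OF b] by auto
  finally show ?thesis .
qed

lemma fraction_smult:
  assumes r: "r \<in> carrier R" and a: "a \<in> carrier R" "s \<in> S"
  shows "r \<odot>\<^bsub>localization R S\<^esub> fraction R S a s = fraction R S (r \<otimes> a) s"
proof -
  have *: "(case x of (a', s') \<Rightarrow> fraction R S (r \<otimes> a') s') = fraction R S (r \<otimes> a) s"
    if "x \<in> fraction R S a s" for x
  proof -
    from that obtain a' s' u where x: "x = (a', s')" "a' \<in> carrier R" "s' \<in> S" "u \<in> S"
      "u \<otimes> (a \<otimes> s' \<ominus> a' \<otimes> s) = \<zero>"
      unfolding mem_fraction[OF a] by blast
    have m: "s \<in> carrier R" "s' \<in> carrier R" "u \<in> carrier R"
      using a x S.subset by auto
    have "u \<otimes> ((r \<otimes> a) \<otimes> s' \<ominus> (r \<otimes> a') \<otimes> s) = r \<otimes> (u \<otimes> (a \<otimes> s' \<ominus> a' \<otimes> s))"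
      using r a(1) x(2) m by algebra
    also have "\<dots> = \<zero>" unfolding x(5) using r by simp
    finally have "fraction R S (r \<otimes> a) s = fraction R S (r \<otimes> a') s'"
      using r a x m by (subst fraction_eq_iff) auto
    then show ?thesis using x(1) by simp
  qed
  have "r \<odot>\<^bsub>localization R S\<^esub> fraction R S a s =
    (\<Union>x \<in> fraction R S a s. case x of (a', s') \<Rightarrow> fraction R S (r \<otimes> a') s')"
    by (simp add: localization_def)
  also have "\<dots> = (\<Union>x \<in> fraction R S a s. fraction R S (r \<otimes> a) s)"
    by (intro SUP_cong refl *)
  also have "\<dots> = fraction R S (r \<otimes> a) s"
    using fraction_self[OF a] by auto
  finally show ?thesis .
qed

lemma fraction_closed: "a \<in> carrier R \<Longrightarrow> s \<in> S \<Longrightarrow> fraction R S a s \<in> carrier (localization R S)"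
  unfolding carrier_localization by blast

lemma localization_zero: "\<zero>\<^bsub>localization R S\<^esub> = fraction R S \<zero> \<one>"
  by (simp add: localization_def)

lemma localization_is_module: "module R (localization R S)"
proof -
  let ?L = "localization R S"
  have SR: "s \<in> carrier R" if "s \<in> S" for s using that S.subset by auto
  have cases: thesis if "x \<in> carrier ?L" "\<And>a s. x = fraction R S a s \<Longrightarrow> a \<in> carrier R \<Longrightarrow> s \<in> S \<Longrightarrow> s \<in> carrier R \<Longrightarrow> thesis"
    for x thesis using that SR unfolding carrier_localization by blast
  have "abelian_group ?L"
  proof (rule abelian_groupI)
    show "\<zero>\<^bsub>?L\<^esub> \<in> carrier ?L" unfolding localization_zero by (simp add: fraction_closed)
  next
    fix x y assume "x \<in> carrier ?L" "y \<in> carrier ?L"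
    then show "x \<oplus>\<^bsub>?L\<^esub> y \<in> carrier ?L" by (elim cases) (simp add: fraction_add fraction_closed)
  next
    fix x y z assume "x \<in> carrier ?L" "y \<in> carrier ?L" "z \<in> carrier ?L"
    then show "(x \<oplus>\<^bsub>?L\<^esub> y) \<oplus>\<^bsub>?L\<^esub> z = x \<oplus>\<^bsub>?L\<^esub> (y \<oplus>\<^bsub>?L\<^esub> z)"
    proof (elim cases)
      fix a s b t c r assume m: "a \<in> carrier R" "s \<in> carrier R" "b \<in> carrier R" "t \<in> carrier R"
        "c \<in> carrier R" "r \<in> carrier R" and S: "s \<in> S" "t \<in> S" "r \<in> S" and
        x: "x = fraction R S a s" "y = fraction R S b t" "z = fraction R S c r"
      have "(a \<otimes> t \<oplus> b \<otimes> s) \<otimes> r \<oplus> c \<otimes> (s \<otimes> t) = a \<otimes> (t \<otimes> r) \<oplus> (b \<otimes> r \<oplus> c \<otimes> t) \<otimes> s"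
        using m by algebra
      then show ?thesis using m S by (simp add: x fraction_add m_assoc)
    qed
  next
    fix x y assume "x \<in> carrier ?L" "y \<in> carrier ?L"
    then show "x \<oplus>\<^bsub>?L\<^esub> y = y \<oplus>\<^bsub>?L\<^esub> x"
    proof (elim cases)
      fix a s b t assume m: "a \<in> carrier R" "s \<in> carrier R" "b \<in> carrier R" "t \<in> carrier R"
        and S: "s \<in> S" "t \<in> S" and x: "x = fraction R S a s" "y = fraction R S b t"
      have "a \<otimes> t \<oplus> b \<otimes> s = b \<otimes> s \<oplus> a \<otimes> t" "s \<otimes> t = t \<otimes> s" using m by (simp_all add: a_comm m_comm)
      then show ?thesis using m S by (simp add: x fraction_add)
    qed
  next
    fix x assume "x \<in> carrier ?L"
    then show "\<zero>\<^bsub>?L\<^esub> \<oplus>\<^bsub>?L\<^esub> x = x" by (elim cases) (simp add: localization_zero fraction_add)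
  next
    fix x assume "x \<in> carrier ?L"
    then show "\<exists>y\<in>carrier ?L. y \<oplus>\<^bsub>?L\<^esub> x = \<zero>\<^bsub>?L\<^esub>"
    proof (elim cases)
      fix a s assume m: "a \<in> carrier R" "s \<in> carrier R" and S: "s \<in> S" and x: "x = fraction R S a s"
      have "fraction R S (\<ominus> a) s \<oplus>\<^bsub>?L\<^esub> x = \<zero>\<^bsub>?L\<^esub>"
        unfolding localization_zero x using m S
        by (simp add: fraction_add, intro fraction_eqI) (simp_all add: l_minus l_neg)
      moreover have "fraction R S (\<ominus> a) s \<in> carrier ?L" using m S by (simp add: fraction_closed)
      ultimately show ?thesis by blast
    qed
  qed
  then show ?thesis
  proof (intro moduleI is_cring)
    fix r x assume "r \<in> carrier R" "x \<in> carrier ?L"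
    then show "r \<odot>\<^bsub>?L\<^esub> x \<in> carrier ?L" by (elim cases) (simp add: fraction_smult fraction_closed)
  next
    fix r q x assume r: "r \<in> carrier R" "q \<in> carrier R" and "x \<in> carrier ?L"
    then show "(r \<oplus> q) \<odot>\<^bsub>?L\<^esub> x = r \<odot>\<^bsub>?L\<^esub> x \<oplus>\<^bsub>?L\<^esub> q \<odot>\<^bsub>?L\<^esub> x"
    proof (elim cases)
      fix a s assume m: "a \<in> carrier R" "s \<in> carrier R" and S: "s \<in> S" and x: "x = fraction R S a s"
      have "(r \<oplus> q) \<otimes> a \<otimes> (s \<otimes> s) = (r \<otimes> a \<otimes> s \<oplus> q \<otimes> a \<otimes> s) \<otimes> s" using m r by algebra
      then show ?thesis
        using m S r by (simp add: x fraction_smult fraction_add, intro fraction_eqI) simp_all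
    qed
  next
    fix r x y assume r: "r \<in> carrier R" and "x \<in> carrier ?L" "y \<in> carrier ?L"
    then show "r \<odot>\<^bsub>?L\<^esub> (x \<oplus>\<^bsub>?L\<^esub> y) = r \<odot>\<^bsub>?L\<^esub> x \<oplus>\<^bsub>?L\<^esub> r \<odot>\<^bsub>?L\<^esub> y"
    proof (elim cases)
      fix a s b t assume m: "a \<in> carrier R" "s \<in> carrier R" "b \<in> carrier R" "t \<in> carrier R"
        and S: "s \<in> S" "t \<in> S" and x: "x = fraction R S a s" "y = fraction R S b t"
      have "r \<otimes> (a \<otimes> t \<oplus> b \<otimes> s) = r \<otimes> a \<otimes> t \<oplus> r \<otimes> b \<otimes> s" using m r by algebra
      then show ?thesis using m S r by (simp add: x fraction_add fraction_smult)
    qed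
  next
    fix r q x assume "r \<in> carrier R" "q \<in> carrier R" "x \<in> carrier ?L"
    then show "(r \<otimes> q) \<odot>\<^bsub>?L\<^esub> x = r \<odot>\<^bsub>?L\<^esub> (q \<odot>\<^bsub>?L\<^esub> x)"
      by (elim cases) (simp add: fraction_smult m_assoc)
  next
    fix x assume "x \<in> carrier ?L"
    then show "\<one> \<odot>\<^bsub>?L\<^esub> x = x" by (elim cases) (simp add: fraction_smult)
  qed
qed

end

section \<open>Almost cotorsion modules are telescopic\<close>

text \<open>Present \<open>S\<^sup>-\<^sup>1R\<close> by the generators \<open>e\<^sub>n\<close>, sent to \<open>1 / \<sigma>\<^sub>n\<close>. The kernel \<open>N\<close> has the basis \<open>e\<^sub>n - s\<^sub>n e\<^sub>n\<^sub>+\<^sub>1\<close>, so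
  there is a map from \<open>N\<close> to \<open>C\<close> with the values \<open>c\<^sub>n\<close> on it. An extension of this map to the free module
  has values \<open>d\<^sub>n\<close> at \<open>e\<^sub>n\<close> which solve the equations.\<close>

lemma almost_cotorsion_telescopic:
  fixes C :: "('a, 'c) module"
  assumes ac: "almost_cotorsion R C"
  shows "telescopic R C"
  unfolding telescopic_def
proof (intro allI impI)
  fix s :: "nat \<Rightarrow> 'a" and c :: "nat \<Rightarrow> 'c"
  assume "submonoid (range s) R \<and> (\<forall>n. infinite {m. s m = s n}) \<and> (\<forall>n. c n \<in> carrier C)"
  then have S: "submonoid (range s) R" and inf: "\<And>n. infinite {m. s m = s n}"
    and c: "\<And>n. c n \<in> carrier C" by auto
  have C: "module R C" using ac by (simp add: almost_cotorsion_def)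
  interpret C: module R C by fact
  interpret S: submonoid "range s" R by (rule S)
  let ?L = "localization R (range s)" and ?f = "fraction R (range s)"
  have L: "module R ?L" by (rule localization_is_module[OF S])
  interpret L: module R ?L by fact
  have "countable (range s)" by simp
  then have "zero_module (Ext1 R ?L C)" using ac S by (simp add: almost_cotorsion_def)
  then have ext: "homs_extend R (free_module R (carrier ?L))
      {x \<in> carrier (free_module R (carrier ?L)). aug R ?L x = \<zero>\<^bsub>?L\<^esub>} C"
    using zero_module_Ext1_iff[OF L C] by (simp add: res0_def)
  have sR: "s n \<in> carrier R" for n using S.subset by blast
  let ?\<sigma> = "segment_prod s"
  have \<sigma>R [simp]: "?\<sigma> m k \<in> carrier R" for m k using sR by simp
  have \<sigma>S: "?\<sigma> 0 k \<in> range s" for k by (induction k) auto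
  define P where "P = free_module R (UNIV :: nat set)"
  have PM: "module R P" unfolding P_def by (rule free_module_is_module)
  interpret P: module R P by fact
  have e: "free_gen R n \<in> carrier P" for n by (simp add: P_def free_gen_closed)
  have xR: "x n \<in> carrier R" if "x \<in> carrier P" for x n using that by (simp add: P_def mem_free_module)
  \<comment> \<open>The localization is presented by the generators \<open>1 / \<sigma>\<^sub>n\<close>.\<close>
  define \<beta> where "\<beta> = linear_ext R ?L (\<lambda>n. ?f \<one> (?\<sigma> 0 n))"
  have \<beta>X: "(\<lambda>n. ?f \<one> (?\<sigma> 0 n)) \<in> UNIV \<rightarrow> carrier ?L"
    using fraction_closed[OF S one_closed \<sigma>S] by blast
  have \<beta>: "linear_map R P ?L \<beta>" unfolding P_def \<beta>_def by (rule linear_ext_linear[OF L \<beta>X])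
  have \<beta>e: "\<beta> (free_gen R n) = ?f \<one> (?\<sigma> 0 n)" for n
    unfolding \<beta>_def by (rule linear_ext_gen[OF L \<beta>X]) simp
  have \<alpha>: "linear_map R (free_module R (carrier ?L)) ?L (aug R ?L)"
    unfolding aug_def by (rule linear_ext_linear[OF L]) simp
  have "x \<in> aug R ?L ` carrier (free_module R (carrier ?L))" if "x \<in> carrier ?L" for x
  proof
    show "x = aug R ?L (free_gen R x)" unfolding aug_def using linear_ext_gen[OF L _ that, of "\<lambda>x. x"] by simp
    show "free_gen R x \<in> carrier (free_module R (carrier ?L))" by (rule free_gen_closed[OF that])
  qed
  then have im1: "aug R ?L ` carrier (free_module R (carrier ?L)) = carrier ?L"
    using linear_map_closed[OF \<alpha>] by blast
  have "x \<in> \<beta> ` carrier P" if x: "x \<in> carrier ?L" for x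
  proof -
    obtain a j where a: "x = ?f a (s j)" "a \<in> carrier R"
      using x unfolding carrier_localization[OF S] by blast
    have "\<beta> ((a \<otimes> ?\<sigma> 0 j) \<odot>\<^bsub>P\<^esub> free_gen R (Suc j)) = ?f (a \<otimes> ?\<sigma> 0 j \<otimes> \<one>) (?\<sigma> 0 (Suc j))"
      using a(2) by (simp only: linear_map_smult[OF \<beta> _ e] \<beta>e m_closed \<sigma>R fraction_smult[OF S _ one_closed \<sigma>S])
    also have "\<dots> = x" unfolding a(1)
      by (rule fraction_eqI[OF S]) (use a(2) sR \<sigma>S in \<open>simp_all add: m_ac\<close>)
    finally show ?thesis using a(2) P.smult_closed[OF _ e] by (metis imageI m_closed \<sigma>R)
  qed
  then have im2: "\<beta> ` carrier P = carrier ?L" using linear_map_closed[OF \<beta>] by blast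
  define N where "N = {x \<in> carrier P. \<beta> x = \<zero>\<^bsub>?L\<^esub>}"
  have extN: "homs_extend R P N C"
    unfolding N_def P_def
    by (rule homs_extend_change_presentation[OF L C \<alpha> \<beta>[unfolded P_def] _ ext]) (simp add: im1 im2[unfolded P_def])
  \<comment> \<open>The kernel is free on \<open>e\<^sub>n - s\<^sub>n e\<^sub>n\<^sub>+\<^sub>1\<close>; the coordinates with respect to this basis are \<open>T\<close>.\<close>
  define T where "T = (\<lambda>x. rec_nat (x 0) (\<lambda>n y. x (Suc n) \<oplus> s n \<otimes> y))"
  have T_0: "T x 0 = x 0" and T_Suc: "T x (Suc n) = x (Suc n) \<oplus> s n \<otimes> T x n" for x n by (simp_all add: T_def)
  have TR: "T x n \<in> carrier R" if "x \<in> carrier P" for x n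
    by (induction n) (use xR[OF that] sR in \<open>simp_all add: T_0 T_Suc\<close>)
  have T_add: "T (x \<oplus>\<^bsub>P\<^esub> y) n = T x n \<oplus> T y n" if "x \<in> carrier P" "y \<in> carrier P" for x y n
  proof (induction n)
    case 0
    then show ?case by (simp add: T_0 P_def free_module_simps)
  next
    case (Suc n)
    have "(x \<oplus>\<^bsub>P\<^esub> y) (Suc n) = x (Suc n) \<oplus> y (Suc n)" by (simp add: P_def free_module_simps)
    then show ?case using Suc xR that TR sR by (simp add: T_Suc r_distr a_ac)
  qed
  have T_smult: "T (r \<odot>\<^bsub>P\<^esub> x) n = r \<otimes> T x n" if "r \<in> carrier R" "x \<in> carrier P" for r x n
  proof (induction n)
    case 0
    then show ?case by (simp add: T_0 P_def free_module_simps)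
  next
    case (Suc n)
    have "(r \<odot>\<^bsub>P\<^esub> x) (Suc n) = r \<otimes> x (Suc n)" by (simp add: P_def free_module_simps)
    then show ?case using Suc xR that TR sR by (simp add: T_Suc r_distr m_lcomm)
  qed
  have T_gen: "T (free_gen R i) n = (if i \<le> n then ?\<sigma> i n else \<zero>)" for i n
  proof (induction n)
    case 0
    then show ?case by (auto simp: T_0 free_gen_def)
  next
    case (Suc n)
    then show ?case using sR segment_prod_self[of s i]
      by (auto simp: T_Suc free_gen_def le_Suc_eq simp del: segment_prod.simps) (simp_all add: segment_prod_self)
  qed
  have \<beta>_T: "\<beta> x = ?f (T x n) (?\<sigma> 0 n)" if x: "x \<in> carrier (free_module R {..n})" for x n
  proof (rule linear_map_free_eqI[OF L _ _ _ x])
    show "linear_map R (free_module R {..n}) ?L \<beta>"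
      by (rule linear_map_free_subset[OF \<beta>[unfolded P_def]]) simp
    have xP: "x \<in> carrier P" if "x \<in> carrier (free_module R {..n})" for x
      using that free_module_mono[of "{..n}" UNIV] by (auto simp: P_def)
    show "linear_map R (free_module R {..n}) ?L (\<lambda>x. ?f (T x n) (?\<sigma> 0 n))"
    proof (rule linear_mapI)
      fix x assume "x \<in> carrier (free_module R {..n})"
      then show "?f (T x n) (?\<sigma> 0 n) \<in> carrier ?L" by (intro fraction_closed[OF S] TR xP \<sigma>S)
    next
      fix x y assume "x \<in> carrier (free_module R {..n})" "y \<in> carrier (free_module R {..n})"
      then have x: "x \<in> carrier P" "y \<in> carrier P" using xP by auto
      have eq: "x \<oplus>\<^bsub>free_module R {..n}\<^esub> y = x \<oplus>\<^bsub>P\<^esub> y" by (simp add: P_def free_module_simps)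
      have "(T x n \<oplus> T y n) \<otimes> (?\<sigma> 0 n \<otimes> ?\<sigma> 0 n) = (T x n \<otimes> ?\<sigma> 0 n \<oplus> T y n \<otimes> ?\<sigma> 0 n) \<otimes> ?\<sigma> 0 n"
        using TR[OF x(1)] TR[OF x(2)] by (simp add: l_distr m_assoc)
      then show "?f (T (x \<oplus>\<^bsub>free_module R {..n}\<^esub> y) n) (?\<sigma> 0 n) =
          ?f (T x n) (?\<sigma> 0 n) \<oplus>\<^bsub>?L\<^esub> ?f (T y n) (?\<sigma> 0 n)"
        unfolding eq T_add[OF x] fraction_add[OF S TR[OF x(1)] \<sigma>S TR[OF x(2)] \<sigma>S]
        by (intro fraction_eqI[OF S]) (use TR[OF x(1)] TR[OF x(2)] \<sigma>S in simp_all)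
    next
      fix r x assume r: "r \<in> carrier R" and "x \<in> carrier (free_module R {..n})"
      then have x: "x \<in> carrier P" using xP by auto
      have eq: "r \<odot>\<^bsub>free_module R {..n}\<^esub> x = r \<odot>\<^bsub>P\<^esub> x" by (simp add: P_def free_module_simps)
      show "?f (T (r \<odot>\<^bsub>free_module R {..n}\<^esub> x) n) (?\<sigma> 0 n) = r \<odot>\<^bsub>?L\<^esub> ?f (T x n) (?\<sigma> 0 n)"
        unfolding eq T_smult[OF r x] by (rule fraction_smult[OF S r TR[OF x] \<sigma>S, symmetric])
    qed
    fix i assume "i \<in> {..n}"
    then have i: "i \<le> n" by simp
    show "\<beta> (free_gen R i) = ?f (T (free_gen R i) n) (?\<sigma> 0 n)"
      unfolding \<beta>e T_gen using i segment_prod_mult[OF sR i]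
      by (simp, intro fraction_eqI[OF S]) (use \<sigma>S in simp_all)
  qed
  \<comment> \<open>For \<open>x\<close> in the kernel, the recursion for the coordinates breaks off: beyond the support of \<open>x\<close> it
    multiplies by \<open>s\<^sub>n\<close>, and some \<open>s\<^sub>j\<close> annihilates the numerator of \<open>\<beta> x\<close>.\<close>
  have TP: "T x \<in> carrier P" if x: "x \<in> N" for x
  proof -
    have xP: "x \<in> carrier P" and \<beta>x: "\<beta> x = \<zero>\<^bsub>?L\<^esub>" using x by (auto simp: N_def)
    have "finite {n. x n \<noteq> \<zero>}" using xP by (simp add: P_def mem_free_module)
    then obtain n where n: "\<And>m. x m \<noteq> \<zero> \<Longrightarrow> m \<le> n"
      by (metis (mono_tags, lifting) finite_nat_set_iff_bounded_le mem_Collect_eq)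
    have "x \<in> carrier (free_module R {..n})" using xP n by (auto simp: P_def mem_free_module)
    from \<beta>_T[OF this] \<beta>x have "?f (T x n) (?\<sigma> 0 n) = ?f \<zero> \<one>" by (simp add: localization_zero[OF S])
    then obtain j0 where "s j0 \<otimes> (T x n \<otimes> \<one> \<ominus> \<zero> \<otimes> ?\<sigma> 0 n) = \<zero>"
      using fraction_eq_iff[OF S TR[OF xP] zero_closed \<sigma>S S.one_closed] by blast
    then have j0: "s j0 \<otimes> T x n = \<zero>" using TR[OF xP] by (simp add: a_minus_def)
    \<comment> \<open>The denominator \<open>s j0\<close> occurs again beyond the support of \<open>x\<close>.\<close>
    obtain j where j: "j \<ge> n" "s j = s j0"
      using inf[of j0] unfolding infinite_nat_iff_unbounded_le by blast
    have seg: "T x m = ?\<sigma> n m \<otimes> T x n" if "m \<ge> n" for m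
      using that
    proof (induction m rule: dec_induct)
      case base
      then show ?case using TR[OF xP] by (simp add: segment_prod_self)
    next
      case (step m)
      have "x (Suc m) = \<zero>" using n[of "Suc m"] step by auto
      then show ?case using step TR[OF xP] sR by (simp add: T_Suc m_assoc)
    qed
    have vanish: "T x m = \<zero>" if "m > j" for m
    proof -
      have "T x (Suc j) = s j0 \<otimes> (?\<sigma> n j \<otimes> T x n)"
        using seg[of "Suc j"] j TR[OF xP] sR by (simp add: m_assoc)
      also have "\<dots> = ?\<sigma> n j \<otimes> (s j0 \<otimes> T x n)" using TR[OF xP] sR by (simp add: m_lcomm)
      also have "\<dots> = \<zero>" unfolding j0 by simp
      finally have 0: "T x (Suc j) = \<zero>" .
      have "Suc j \<le> m" using that by simp
      then show ?thesis
      proof (induction m rule: dec_induct)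
        case base
        show ?case by (rule 0)
      next
        case (step m)
        have "x (Suc m) = \<zero>" using n[of "Suc m"] j(1) step by auto
        then show ?case using step sR by (simp add: T_Suc)
      qed
    qed
    have "{m. T x m \<noteq> \<zero>} \<subseteq> {..j}"
    proof
      fix m assume "m \<in> {m. T x m \<noteq> \<zero>}"
      then show "m \<in> {..j}" using vanish[of m] by (cases "m > j") auto
    qed
    then have "finite {m. T x m \<noteq> \<zero>}" by (rule finite_subset) simp
    then show ?thesis using TR[OF xP] by (simp add: P_def mem_free_module)
  qed
  have NP: "x \<in> carrier P" if "x \<in> N" for x using that by (simp add: N_def)
  have T: "linear_map R (P\<lparr>carrier := N\<rparr>) P T"
    by (rule linear_mapI) (use TP NP T_add T_smult in \<open>auto simp: P_def free_module_simps\<close>)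
  define \<nu> where "\<nu> = linear_ext R C c"
  have cX: "c \<in> UNIV \<rightarrow> carrier C" using c by blast
  have \<nu>: "linear_map R P C \<nu>" unfolding P_def \<nu>_def by (rule linear_ext_linear[OF C cX])
  have \<nu>e: "\<nu> (free_gen R n) = c n" for n unfolding \<nu>_def by (rule linear_ext_gen[OF C cX]) simp
  from extN linear_map_compose[OF T \<nu>] obtain h where
    h: "linear_map R P C h" "\<And>x. x \<in> N \<Longrightarrow> h x = \<nu> (T x)" unfolding homs_extend_def by blast
  have hc: "h (free_gen R n) \<in> carrier C" for n by (rule linear_map_closed[OF h(1) e])
  have "h (free_gen R n) = c n \<oplus>\<^bsub>C\<^esub> s n \<odot>\<^bsub>C\<^esub> h (free_gen R (Suc n))" for n
  proof -
    let ?x = "free_gen R n \<ominus>\<^bsub>P\<^esub> s n \<odot>\<^bsub>P\<^esub> free_gen R (Suc n)"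
    have xP: "?x \<in> carrier P" using e sR by simp
    have "s n \<odot>\<^bsub>?L\<^esub> ?f \<one> (?\<sigma> 0 (Suc n)) = ?f \<one> (?\<sigma> 0 n)"
      unfolding fraction_smult[OF S sR one_closed \<sigma>S]
      by (rule fraction_eqI[OF S]) (use sR \<sigma>S in simp_all)
    then have "\<beta> ?x = \<zero>\<^bsub>?L\<^esub>"
      using linear_map_minus[OF PM L \<beta> e P.smult_closed[OF sR e]] linear_map_smult[OF \<beta> sR e] \<beta>e
        linear_map_closed[OF \<beta> e, of n] by (simp add: L.minus_self)
    then have xN: "?x \<in> N" using xP by (simp add: N_def)
    have "T ?x m = free_gen R n m" for m
    proof -
      have "?x = free_gen R n \<oplus>\<^bsub>P\<^esub> (\<ominus> s n) \<odot>\<^bsub>P\<^esub> free_gen R (Suc n)"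
        using e sR by (simp add: a_minus_def P.smult_l_minus)
      then have "T ?x m = T (free_gen R n) m \<oplus> (\<ominus> s n) \<otimes> T (free_gen R (Suc n)) m"
        using e sR by (simp add: T_add T_smult)
      also have "\<dots> = free_gen R n m"
      proof -
        consider "m < n" | "m = n" | "Suc n \<le> m" by linarith
        then show ?thesis
        proof cases
          case 3
          have "?\<sigma> n m = ?\<sigma> (Suc n) m \<otimes> s n"
            using 3
          proof (induction m rule: dec_induct)
            case base
            have "?\<sigma> n (Suc n) = s n \<otimes> ?\<sigma> n n" by simp
            then show ?case using sR by (simp only: segment_prod_self) simp
          next
            case (step m)
            then show ?case using sR by (simp add: m_assoc)
          qed
          then show ?thesis using 3 sR unfolding T_gen
            by (simp add: free_gen_def l_minus r_neg m_comm[of "s n"])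
        qed (unfold T_gen, use sR in \<open>simp_all add: free_gen_def segment_prod_self\<close>)
      qed
      finally show ?thesis .
    qed
    then have "T ?x = free_gen R n" by (rule HOL.ext)
    then have "h ?x = c n" using h(2)[OF xN] \<nu>e by simp
    then have "h (free_gen R n) \<ominus>\<^bsub>C\<^esub> s n \<odot>\<^bsub>C\<^esub> h (free_gen R (Suc n)) = c n"
      using linear_map_minus[OF PM C h(1) e P.smult_closed[OF sR e]] linear_map_smult[OF h(1) sR e] by simp
    then show ?thesis using C.minus_add_cancel[OF hc[of n] C.smult_closed[OF sR hc], of n "Suc n"] by simp
  qed
  then show "\<exists>d. \<forall>n. d n \<in> carrier C \<and> d n = c n \<oplus>\<^bsub>C\<^esub> s n \<odot>\<^bsub>C\<^esub> d (Suc n)"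
    using hc by (intro exI[of _ "\<lambda>n. h (free_gen R n)"] allI conjI)
qed

end

section \<open>Flat modules are quite flat\<close>

text \<open>An index type for free modules that is large enough to map onto \<open>F\<close> and, by reading a list of
  indices with coefficients as a linear combination, also onto the free module over itself.\<close>

datatype ('f, 'r) syzygy_index = Base 'f | Combination "(('f, 'r) syzygy_index \<times> 'r) list"

lemma free_module_subset_combinations:
  fixes R :: "('r, 'm) ring_scheme"
  shows "carrier (free_module R (UNIV :: ('f, 'r) syzygy_index set)) \<subseteq>
    range (\<lambda>t :: ('f, 'r) syzygy_index. case t of Base a \<Rightarrow> (\<lambda>u. \<zero>\<^bsub>R\<^esub>)
      | Combination l \<Rightarrow> (\<lambda>u. case map_of l u of None \<Rightarrow> \<zero>\<^bsub>R\<^esub> | Some r \<Rightarrow> r))"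
proof
  fix x :: "('f, 'r) syzygy_index \<Rightarrow> 'r" assume "x \<in> carrier (free_module R UNIV)"
  then have "finite {u. x u \<noteq> \<zero>\<^bsub>R\<^esub>}" by (simp add: mem_free_module)
  then obtain us where us: "set us = {u. x u \<noteq> \<zero>\<^bsub>R\<^esub>}" using finite_list by blast
  have "x = (\<lambda>u. case map_of (map (\<lambda>u. (u, x u)) us) u of None \<Rightarrow> \<zero>\<^bsub>R\<^esub> | Some r \<Rightarrow> r)"
  proof
    fix u show "x u = (case map_of (map (\<lambda>u. (u, x u)) us) u of None \<Rightarrow> \<zero>\<^bsub>R\<^esub> | Some r \<Rightarrow> r)"
      using us by (auto simp: map_of_map_restrict restrict_map_def)
  qed
  then show "x \<in> range (\<lambda>t :: ('f, 'r) syzygy_index. case t of Base a \<Rightarrow> (\<lambda>u. \<zero>\<^bsub>R\<^esub>)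
      | Combination l \<Rightarrow> (\<lambda>u. case map_of l u of None \<Rightarrow> \<zero>\<^bsub>R\<^esub> | Some r \<Rightarrow> r))"
    by (intro image_eqI[of _ _ "Combination (map (\<lambda>u. (u, x u)) us)"]) simp_all
qed

theorem theorem1p17:
  fixes R :: "('r, 'm) ring_scheme" and F :: "('r, 'f) module"
  assumes "cring R" and "noetherian_ring R" and "countable (Spec R)"
    and "flat_module R F"
  shows "quite_flat TYPE('c) R F"
proof -
  interpret R: cring R by fact
  have F: "module R F" using assms(4) by (simp add: flat_module_def)
  interpret F: module R F by fact
  let ?P = "free_module R (UNIV :: ('f, 'r) syzygy_index set)"
  define p :: "('f, 'r) syzygy_index \<Rightarrow> 'f" where
    "p = (\<lambda>t. case t of Base x \<Rightarrow> if x \<in> carrier F then x else \<zero>\<^bsub>F\<^esub> | Combination l \<Rightarrow> \<zero>\<^bsub>F\<^esub>)"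
  have p: "p \<in> UNIV \<rightarrow> carrier F" by (auto simp: p_def split: syzygy_index.split)
  let ?\<alpha> = "linear_ext R F p"
  have \<alpha>: "linear_map R ?P F ?\<alpha>" by (rule R.linear_ext_linear[OF F p])
  have "x \<in> ?\<alpha> ` carrier ?P" if "x \<in> carrier F" for x
  proof
    show "x = ?\<alpha> (free_gen R (Base x))" using R.linear_ext_gen[OF F p, of "Base x"] that by (simp add: p_def)
    show "free_gen R (Base x) \<in> carrier ?P" by (simp add: R.free_gen_closed)
  qed
  then have onto: "?\<alpha> ` carrier ?P = carrier F" using linear_map_closed[OF \<alpha>] by blast
  have aug: "linear_map R (res0 R F) F (aug R F)"
    unfolding res0_def aug_def by (rule R.linear_ext_linear[OF F]) simp
  have "x \<in> aug R F ` carrier (res0 R F)" if "x \<in> carrier F" for x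
  proof
    show "x = aug R F (free_gen R x)" unfolding aug_def using R.linear_ext_gen[OF F _ that, of "\<lambda>x. x"] by simp
    show "free_gen R x \<in> carrier (res0 R F)" unfolding res0_def by (rule R.free_gen_closed[OF that])
  qed
  then have aug_onto: "aug R F ` carrier (res0 R F) = carrier F" using linear_map_closed[OF aug] by blast
  have "zero_module (Ext1 R F C)" if ac: "almost_cotorsion R C" for C :: "('r, 'c) module"
  proof -
    have C: "module R C" using ac by (simp add: almost_cotorsion_def)
    have "homs_extend R ?P {x \<in> carrier ?P. ?\<alpha> x = \<zero>\<^bsub>F\<^esub>} C"
      by (rule R.homs_extend_to_telescopic[OF assms(2,3) free_module_subset_combinations C
          R.almost_cotorsion_telescopic[OF ac] R.flat_module_locally_retract[OF assms(4) \<alpha> onto]])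
    from R.homs_extend_change_presentation[OF F C \<alpha> aug[unfolded res0_def] _ this]
    have "homs_extend R (res0 R F) {x \<in> carrier (res0 R F). aug R F x = \<zero>\<^bsub>F\<^esub>} C"
      using onto aug_onto by (simp add: res0_def)
    then show ?thesis using R.zero_module_Ext1_iff[OF F C] by simp
  qed
  then show ?thesis using F by (simp add: quite_flat_def)
qed

end
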